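(* Let $d\ge 1$ be an integer and $T>0$, let $\mathcal{L}$ be the space of (first) multiparameter persistence landscapes $\lambda:[0,T]^d\to\mathbb{R}$ of persistence modules with parameters in the box $[0,T]^d$, and let $P$ be a probability distribution on $\mathcal{L}$. Let $\Lambda_1,\Lambda_2,\dots$ be i.i.d. random elements of $\mathcal{L}$ with distribution $P$. For $n\ge 1$ and $\mathbf{x}\in[0,T]^d$ put $$\overline{\Lambda}_n(\mathbf{x})=\frac1n\sum_{i=1}^n\Lambda_i(\mathbf{x}),\qquad \mu(\mathbf{x})=\mathbb{E}_{\Lambda\sim P}[\Lambda(\mathbf{x})],\qquad \mathbb{G}_n(\mathbf{x})=\sqrt{n}\,\bigl(\overline{\Lambda}_n(\mathbf{x})-\mu(\mathbf{x})\bigr).$$ Then there is a Gaussian process $\mathbb{G}=\{\mathbb{G}(\mathbf{x})\}_{\mathbf{x}\in[0,T]^d}$, realized as a Borel measurable random element of $\ell^\infty([0,T]^d)$, with mean zero and covariance function $$\kappa(\mathbf{x},\mathbf{y})=\int_{\mathcal{L}}\lambda(\mathbf{x})\lambda(\mathbf{y})\,dP(\lambda)-\int_{\mathcal{L}}\lambda(\mathbf{x})\,dP(\lambda)\int_{\mathcal{L}}\lambda(\mathbf{y})\,dP(\lambda),\qquad \mathbf{x},\mathbf{y}\in[0,T]^d,$$ such that $\mathbb{G}_n\rightsquigarrow\mathbb{G}$ as $n\to\infty$, i.e. $\mathbb{G}_n$ converges weakly to $\mathbb{G}$ in $\ell^\infty([0,T]^d)$.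
   Context: Persistence modules. Order $\mathbb{R}^d$ by the product order: $\mathbf{x}\le\mathbf{y}$ iff $x_i\le y_i$ for all $i$. A persistence module $M_\bullet$ is a family of vector spaces $\{M_{\mathbf{x}}:\mathbf{x}\in\mathbb{R}^d\}$ over a fixed field together with linear maps $\varphi^{\mathbf{x}}_{\mathbf{y}}:M_{\mathbf{x}}\to M_{\mathbf{y}}$ for $\mathbf{x}\le\mathbf{y}$, which are functorial ($\varphi^{\mathbf{x}}_{\mathbf{x}}=\mathrm{id}$ and $\varphi^{\mathbf{y}}_{\mathbf{z}}\circ\varphi^{\mathbf{x}}_{\mathbf{y}}=\varphi^{\mathbf{x}}_{\mathbf{z}}$ for $\mathbf{x}\le\mathbf{y}\le\mathbf{z}$). Write $\beta^{\mathbf{x}}_{\mathbf{y}}=\dim(\mathrm{Im}\,\varphi^{\mathbf{x}}_{\mathbf{y}})$ for $\mathbf{x}\le\mathbf{y}$. The module has parameters in the box $[0,T]^d$ if $M_{\mathbf{x}}=0$ for $\mathbf{x}\notin[0,T]^d$. Landscapes. The (first) multiparameter persistence landscape of $M_\bullet$ is the function $$\lambda(\mathbf{x})=\sup\{\epsilon>0:\ \beta^{\mathbf{x}-\mathbf{h}}_{\mathbf{x}+\mathbf{h}}\ge 1\ \text{for all}\ \mathbf{h}\ge\mathbf{0}\ \text{with}\ \|\mathbf{h}\|_\infty\le\epsilon\},$$ with the convention $\sup\emptyset=0$. $\mathcal{L}$ denotes the set of all such functions, restricted to $[0,T]^d$, arising from persistence modules with parameters in $[0,T]^d$. It is a known fact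 that every such $\lambda$ is nonnegative and 1-Lipschitz with respect to $\|\cdot\|_\infty$. The set $\mathcal{L}$ carries the Borel $\sigma$-algebra induced by the supremum norm; the evaluation maps $f_{\mathbf{x}}:\mathcal{L}\to\mathbb{R}$, $f_{\mathbf{x}}(\lambda)=\lambda(\mathbf{x})$, are measurable. Weak convergence. $\ell^\infty([0,T]^d)$ is the Banach space of all bounded functions $[0,T]^d\to\mathbb{R}$ with the supremum norm. The process $\mathbb{G}_n$ is the empirical process indexed by the family $\mathcal{F}=\{f_{\mathbf{x}}\}_{\mathbf{x}\in[0,T]^d}$, which is identified with a process indexed by $[0,T]^d$. For processes $Y_n$ with sample paths in $\ell^\infty([0,T]^d)$ (not necessarily Borel measurable) and a Borel measurable random element $Y$ of $\ell^\infty([0,T]^d)$, $Y_n\rightsquigarrow Y$ means $\lim_{n\to\infty}\mathbb{E}^*[g(Y_n)]=\mathbb{E}[g(Y)]$ for every bounded continuous $g:\ell^\infty([0,T]^d)\to\mathbb{R}$, where $\mathbb{E}^*$ denotes outer expectation. A Gaussian process is a family of real-valued random variables such that every finite subfamily has a (possibly degenerate) multivariate normal distribution. *)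

theory Defs
  imports "HOL-Probability.Probability" "Jordan_Normal_Form.Missing_VectorSpace"
begin

section \<open>Persistence modules and landscapes\<close>

definition cube :: "real \<Rightarrow> (real ^ 'd) set" where
  "cube T = {0..(\<chi> i. T)}"

text \<open>
  The order on \<^typ>\<open>real ^ 'd\<close> is the product order. The vector spaces of a module are
  records whose carriers are arbitrary subsets of one type \<open>'v\<close>; their operations may
  differ from point to point.
\<close>

locale persistence_module =
  fixes K :: "'k ring"
    and M :: "real ^ 'd \<Rightarrow> ('k, 'v) module"
    and \<phi> :: "real ^ 'd \<Rightarrow> real ^ 'd \<Rightarrow> 'v \<Rightarrow> 'v"
  assumes vectorspace: "vectorspace K (M x)"
    and linear_map: "x \<le> y \<Longrightarrow> linear_map K (M x) (M y) (\<phi> x y)"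
    and map_id: "v \<in> carrier (M x) \<Longrightarrow> \<phi> x x v = v"
    and map_comp: "x \<le> y \<Longrightarrow> y \<le> z \<Longrightarrow> v \<in> carrier (M x) \<Longrightarrow> \<phi> y z (\<phi> x y v) = \<phi> x z v"

definition parameters_in_cube :: "real \<Rightarrow> (real ^ 'd \<Rightarrow> ('k, 'v) module) \<Rightarrow> bool" where
  "parameters_in_cube T M \<longleftrightarrow> (\<forall>x. x \<notin> cube T \<longrightarrow> carrier (M x) = {\<zero>\<^bsub>M x\<^esub>})"

text \<open>
  The modules need not be pointwise finite-dimensional, and \<^const>\<open>vectorspace.dim\<close> is
  unspecified on infinite-dimensional spaces, so the dimension takes values in \<^typ>\<open>enat\<close>.
\<close>

definition edim :: "'k ring \<Rightarrow> ('k, 'v) module \<Rightarrow> enat" where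
  "edim K V = (if vectorspace.fin_dim K V then enat (vectorspace.dim K V) else \<infinity>)"

definition betti :: "'k ring \<Rightarrow> (real ^ 'd \<Rightarrow> ('k, 'v) module) \<Rightarrow>
    (real ^ 'd \<Rightarrow> real ^ 'd \<Rightarrow> 'v \<Rightarrow> 'v) \<Rightarrow> real ^ 'd \<Rightarrow> real ^ 'd \<Rightarrow> enat" where
  "betti K M \<phi> x y = edim K ((M y)\<lparr>carrier := \<phi> x y ` carrier (M x)\<rparr>)"

definition landscape :: "'k ring \<Rightarrow> (real ^ 'd \<Rightarrow> ('k, 'v) module) \<Rightarrow>
    (real ^ 'd \<Rightarrow> real ^ 'd \<Rightarrow> 'v \<Rightarrow> 'v) \<Rightarrow> real ^ 'd \<Rightarrow> real" where
  "landscape K M \<phi> x =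
    (let E = {\<epsilon>. \<epsilon> > 0 \<and> (\<forall>h. 0 \<le> h \<and> infnorm h \<le> \<epsilon> \<longrightarrow> betti K M \<phi> (x - h) (x + h) \<ge> 1)}
     in if E = {} then 0 else Sup E)"

text \<open>
  Functions on the cube are represented as functions on \<^typ>\<open>real ^ 'd\<close> that are
  \<^const>\<open>undefined\<close> elsewhere. The type argument names the type \<open>'v\<close> in which the
  carriers of the modules live.
\<close>

definition landscapes :: "'v itself \<Rightarrow> 'k ring \<Rightarrow> real \<Rightarrow> (real ^ 'd \<Rightarrow> real) set" where
  "landscapes _ K T =
    {restrict (landscape K M \<phi>) (cube T) | (M :: real ^ 'd \<Rightarrow> ('k, 'v) module) \<phi>.
      persistence_module K M \<phi> \<and> parameters_in_cube T M}"

section \<open>Bounded functions with the supremum metric\<close>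

definition linf :: "'a set \<Rightarrow> ('a \<Rightarrow> real) set" where
  "linf S = {f \<in> extensional S. bounded (f ` S)}"

text \<open>The value 0 outside \<^const>\<open>linf\<close> only serves to meet the \<^locale>\<open>Metric_space\<close> axioms.\<close>

definition linf_dist :: "'a set \<Rightarrow> ('a \<Rightarrow> real) \<Rightarrow> ('a \<Rightarrow> real) \<Rightarrow> real" where
  "linf_dist S f g = (if f \<in> linf S \<and> g \<in> linf S then SUP x\<in>S. \<bar>f x - g x\<bar> else 0)"

definition linf_topology :: "'a set \<Rightarrow> ('a \<Rightarrow> real) topology" where
  "linf_topology S = Metric_space.mtopology (linf S) (linf_dist S)"

lemma linf_bdd_above:
  assumes "f \<in> linf S" "g \<in> linf S"
  shows "bdd_above ((\<lambda>x. \<bar>f x - g x\<bar>) ` S)"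
proof -
  obtain a b where a: "\<forall>x\<in>S. \<bar>f x\<bar> \<le> a" and b: "\<forall>x\<in>S. \<bar>g x\<bar> \<le> b"
    using assms unfolding linf_def bounded_iff by auto
  have "\<bar>f x - g x\<bar> \<le> a + b" if "x \<in> S" for x
    using a b that by (smt (verit))
  then show ?thesis by (auto simp: bdd_above_def)
qed

lemma Metric_space_linf:
  assumes "S \<noteq> {}"
  shows "Metric_space (linf S) (linf_dist S)"
proof
  have upper: "\<bar>f x - g x\<bar> \<le> linf_dist S f g" if "f \<in> linf S" "g \<in> linf S" "x \<in> S" for f g x
    using that linf_bdd_above[of f S g] unfolding linf_dist_def by (auto intro: cSUP_upper)
  fix f g h :: "'a \<Rightarrow> real"
  show "0 \<le> linf_dist S f g"
    using upper[of f g] assms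
    by (cases "f \<in> linf S \<and> g \<in> linf S") (force simp: linf_dist_def)+
  show "linf_dist S f g = linf_dist S g f"
    by (auto simp: linf_dist_def abs_minus_commute)
  show "linf_dist S f g = 0 \<longleftrightarrow> f = g" if "f \<in> linf S" "g \<in> linf S"
  proof
    assume 0: "linf_dist S f g = 0"
    have "f x = g x" for x
      using upper[of f g x] that 0 by (cases "x \<in> S") (auto simp: linf_def extensional_def)
    then show "f = g" by auto
  next
    assume "f = g"
    then show "linf_dist S f g = 0" using assms by (simp add: linf_dist_def)
  qed
  show "linf_dist S f h \<le> linf_dist S f g + linf_dist S g h"
    if "f \<in> linf S" "g \<in> linf S" "h \<in> linf S"
  proof -
    have "\<bar>f x - h x\<bar> \<le> linf_dist S f g + linf_dist S g h" if "x \<in> S" for x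
      using upper[of f g x] upper[of g h x] that \<open>f \<in> linf S\<close> \<open>g \<in> linf S\<close> \<open>h \<in> linf S\<close>
      by (smt (verit))
    then show ?thesis
      using that assms by (subst (1) linf_dist_def) (auto intro!: cSUP_least)
  qed
qed

lemma topspace_linf_topology: "S \<noteq> {} \<Longrightarrow> topspace (linf_topology S) = linf S"
  by (simp add: linf_topology_def Metric_space.topspace_mtopology Metric_space_linf)

definition borel_of :: "'a topology \<Rightarrow> 'a measure" where
  "borel_of X = sigma (topspace X) {U. openin X U}"

section \<open>Weak convergence\<close>

text \<open>
  Only meant for bounded \<open>f\<close> on a probability space. There, integrable real-valued majorants
  give the same infimum as extended-real-valued ones.
\<close>

definition outer_expectation :: "'w measure \<Rightarrow> ('w \<Rightarrow> real) \<Rightarrow> real" where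
  "outer_expectation N f =
    Inf {integral\<^sup>L N U | U. integrable N U \<and> (\<forall>\<omega>\<in>space N. f \<omega> \<le> U \<omega>)}"

definition weakly_converges ::
  "'b topology \<Rightarrow> 'w measure \<Rightarrow> (nat \<Rightarrow> 'w \<Rightarrow> 'b) \<Rightarrow> 'u measure \<Rightarrow> ('u \<Rightarrow> 'b) \<Rightarrow> bool" where
  "weakly_converges X N Y N' Z \<longleftrightarrow>
    (\<forall>n. Y n \<in> space N \<rightarrow> topspace X) \<and>
    Z \<in> measurable N' (borel_of X) \<and>
    (\<forall>g. continuous_map X euclideanreal g \<and> bounded (g ` topspace X) \<longrightarrow>
      (\<lambda>n. outer_expectation N (\<lambda>\<omega>. g (Y n \<omega>))) \<longlonglongrightarrow> integral\<^sup>L N' (\<lambda>\<omega>. g (Z \<omega>)))"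

section \<open>Gaussian and empirical processes\<close>

definition normal_law :: "real measure \<Rightarrow> bool" where
  "normal_law \<nu> \<longleftrightarrow>
    (\<exists>m. \<nu> = return borel m) \<or> (\<exists>m s. s > 0 \<and> \<nu> = density lborel (normal_density m s))"

text \<open>
  A law on \<open>\<real>\<^sup>I\<close> is (possibly degenerate) multivariate normal if every linear functional
  of it is (possibly degenerate) normal.
\<close>

definition multivariate_normal :: "'i set \<Rightarrow> ('i \<Rightarrow> real) measure \<Rightarrow> bool" where
  "multivariate_normal I \<nu> \<longleftrightarrow> sets \<nu> = sets (Pi\<^sub>M I (\<lambda>_. borel)) \<and>
    (\<forall>c. normal_law (distr \<nu> borel (\<lambda>x. \<Sum>i\<in>I. c i * x i)))"

definition gaussian_process :: "'w measure \<Rightarrow> 'i set \<Rightarrow> ('w \<Rightarrow> 'i \<Rightarrow> real) \<Rightarrow> bool" where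
  "gaussian_process N S G \<longleftrightarrow> prob_space N \<and>
    (\<forall>x\<in>S. (\<lambda>\<omega>. G \<omega> x) \<in> borel_measurable N) \<and>
    (\<forall>J. finite J \<and> J \<subseteq> S \<longrightarrow>
      multivariate_normal J (distr N (Pi\<^sub>M J (\<lambda>_. borel)) (\<lambda>\<omega>. \<lambda>x\<in>J. G \<omega> x)))"

definition covariance :: "'w measure \<Rightarrow> ('w \<Rightarrow> real) \<Rightarrow> ('w \<Rightarrow> real) \<Rightarrow> real" where
  "covariance N X Y =
    integral\<^sup>L N (\<lambda>\<omega>. (X \<omega> - integral\<^sup>L N X) * (Y \<omega> - integral\<^sup>L N Y))"

definition empirical_process ::
  "'a set \<Rightarrow> ('a \<Rightarrow> real) measure \<Rightarrow> (nat \<Rightarrow> 'w \<Rightarrow> 'a \<Rightarrow> real) \<Rightarrow> nat \<Rightarrow> 'w \<Rightarrow> 'a \<Rightarrow> real" where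
  "empirical_process S P \<Lambda> n \<omega> =
    (\<lambda>x\<in>S. sqrt (real n) * ((\<Sum>i=1..n. \<Lambda> i \<omega> x) / real n - integral\<^sup>L P (\<lambda>f. f x)))"

end

theory Submission
  imports Defs
begin

text \<open>
  Landscapes are 1-Lipschitz and bounded by \<open>T\<close>, so the index set of the empirical process is a
  finite-dimensional cube on which the increments are bounded by the distance; Hoeffding's lemma
  makes them sub-Gaussian, uniformly in the sample size. Chaining along dyadic grids then compares
  the empirical process, up to an error that does not depend on the sample size, with the step
  function given by its values on a fixed finite grid. On a finite grid, convergence is the
  multivariate central limit theorem; it follows from the univariate one because convergence of
  characteristic functions gives pointwise convergence of Gaussian-smoothed densities. The limit
  process is built on the countable dyadic points from independent standard normal variables by a
  Cholesky factorisation of the covariance, and the same chaining bound extends it to the cube.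
\<close>

section \<open>Convergence of characteristic functions in finite dimension\<close>

text \<open>The space of bounded functions is not separable: measurable evaluations do not make a
  process Borel measurable, and a bounded function need not be close to any step function built from
  finitely many of its values. Both obstacles disappear for paths that are uniform limits of their
  own dyadic step functions, since on them every Lipschitz functional is a limit of functions of
  finitely many values. The chaining error is an expected supremum distance, so it controls
  integrals of Lipschitz test functionals; continuous ones are reached afterwards through Lipschitz
  minorants of \<open>g\<close> and of \<open>- g\<close>. In dimension d the grid of level l has
  about \<open>2^(l d)\<close> points, while increments over distance \<open>2^(-l)\<close> have
  moments of order 2d of size \<open>2^(-2 l d)\<close>. This gap leaves room for the summable
  threshold \<open>(3/4)^l\<close>, because \<open>3/4 > 1 / sqrt 2\<close>. The same moment
  condition on increments serves twice: it controls the empirical process uniformly in n, and it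
  makes the step functions of the Gaussian sequence converge uniformly, which produces the limit
  process.\<close>

text \<open>Only the coordinates in \<open>I\<close> enter the bound, so it tends to 0 in the
  product topology; for infinite \<open>I\<close> the sum is 0 and \<open>F\<close> is
  constant.\<close>

lemma continuous_on_finite_lipschitz:
  fixes F :: "('i \<Rightarrow> real) \<Rightarrow> real"
  assumes lip: "\<And>u v. \<bar>F u - F v\<bar> \<le> L * (\<Sum>i\<in>I. \<bar>u i - v i\<bar>)"
  shows "continuous_on UNIV F"
proof -
  have "(F \<longlongrightarrow> F x) (at x)" for x
  proof (rule LIM_zero_cancel, rule Lim_null_comparison)
    show "\<forall>\<^sub>F y in at x. norm (F y - F x) \<le> L * (\<Sum>i\<in>I. \<bar>y i - x i\<bar>)"
      using lip by simp
    have "continuous_on UNIV (\<lambda>y. L * (\<Sum>i\<in>I. \<bar>y i - x i\<bar>))"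
      by (intro continuous_intros continuous_on_product_coordinates)
    then show "((\<lambda>y. L * (\<Sum>i\<in>I. \<bar>y i - x i\<bar>)) \<longlongrightarrow> 0) (at x)"
      by (auto simp: continuous_on_def dest!: spec[of _ x])
  qed
  then show ?thesis by (auto simp: continuous_on_def)
qed

lemma measurable_finite_lipschitz:
  fixes F :: "('i::countable \<Rightarrow> real) \<Rightarrow> real"
  assumes lip: "\<And>u v. \<bar>F u - F v\<bar> \<le> L * (\<Sum>i\<in>I. \<bar>u i - v i\<bar>)"
    and f: "\<And>i. i \<in> I \<Longrightarrow> (\<lambda>\<omega>. f \<omega> i) \<in> borel_measurable M"
  shows "(\<lambda>\<omega>. F (f \<omega>)) \<in> borel_measurable M"
proof -
  \<comment> \<open>Only the coordinates in \<open>I\<close> are assumed measurable. Setting the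
    others to 0 does not change the value of \<open>F\<close>.\<close>
  define f' where "f' = (\<lambda>\<omega> i. if i \<in> I then f \<omega> i else 0)"
  have "F \<in> borel_measurable borel"
    by (rule borel_measurable_continuous_onI[OF continuous_on_finite_lipschitz, OF lip])
  \<comment> \<open>Countability of the index type makes the product sigma-algebra the Borel
    sigma-algebra of the product topology.\<close>
  then have F: "F \<in> borel_measurable (PiM UNIV (\<lambda>_. borel))"
    by (simp cong: measurable_cong_sets add: sets_PiM_equal_borel)
  have f': "f' \<in> measurable M (PiM UNIV (\<lambda>_. borel))"
  proof (rule measurable_PiM_single')
    show "(\<lambda>\<omega>. f' \<omega> i) \<in> borel_measurable M" for i
      using f by (cases "i \<in> I") (auto simp: f'_def)
  qed auto
  have "F (f' \<omega>) = F (f \<omega>)" for \<omega>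
    using lip[of "f' \<omega>" "f \<omega>"] by (simp add: f'_def)
  with measurable_compose[OF f' F] show ?thesis by simp
qed

section \<open>Gaussian smoothing and characteristic functions\<close>

lemma (in prob_space) integrable_iexp_real [intro]:
  "f \<in> borel_measurable M \<Longrightarrow> complex_integrable M (\<lambda>x. iexp (f x))"
  by (intro integrable_iexp) auto

text \<open>The Gaussian is its own Fourier transform: the kernel centred at \<open>x\<close> is a
  mixture of the characters of \<open>x\<close>. Through this identity, characteristic functions
  determine smoothed densities.\<close>

lemma normal_density_eq_char:
  assumes "\<epsilon> > 0"
  shows "complex_of_real (normal_density x \<epsilon> y)
    = complex_of_real (1 / sqrt (2 * pi * \<epsilon>\<^sup>2)) * (CLINT s|std_normal_distribution. iexp ((y - x) / \<epsilon> * s))"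
proof -
  have "(CLINT s|std_normal_distribution. iexp ((y - x) / \<epsilon> * s))
      = complex_of_real (exp (- ((y - x) / \<epsilon>)\<^sup>2 / 2))"
    using fun_cong[OF char_std_normal_distribution, of "(y - x) / \<epsilon>"] unfolding char_def by simp
  moreover have "- ((y - x) / \<epsilon>)\<^sup>2 / 2 = - (y - x)\<^sup>2 / (2 * \<epsilon>\<^sup>2)"
    by (simp add: power_divide)
  ultimately show ?thesis by (simp only: normal_density_def of_real_mult)
qed

lemma prod_normal_density_eq_char:
  assumes "\<epsilon> > 0" "finite I"
  shows "complex_of_real (\<Prod>i\<in>I. normal_density (x i) \<epsilon> (y i))
    = complex_of_real ((1 / sqrt (2 * pi * \<epsilon>\<^sup>2)) ^ card I) *
      (CLINT s|PiM I (\<lambda>_. std_normal_distribution). iexp (\<Sum>i\<in>I. (y i - x i) / \<epsilon> * s i))"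
proof -
  interpret real_distribution std_normal_distribution by (rule real_dist_normal_dist)
  interpret product_sigma_finite "\<lambda>_. std_normal_distribution" ..
  have "(CLINT s|PiM I (\<lambda>_. std_normal_distribution). iexp (\<Sum>i\<in>I. (y i - x i) / \<epsilon> * s i))
    = (CLINT s|PiM I (\<lambda>_. std_normal_distribution). (\<Prod>i\<in>I. iexp ((y i - x i) / \<epsilon> * s i)))"
    using assms by (simp add: sum_distrib_left exp_sum)
  also have "\<dots> = (\<Prod>i\<in>I. CLINT s|std_normal_distribution. iexp ((y i - x i) / \<epsilon> * s))"
    using assms(2) by (intro product_integral_prod integrable_iexp_real) auto
  finally show ?thesis
    by (simp only: of_real_prod normal_density_eq_char[OF assms(1)] prod.distrib prod_constant of_real_power)
qed

lemma integrable_prod_normal_density: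
  assumes "\<epsilon> > 0" "finite I"
  shows "integrable (PiM I (\<lambda>_. lborel)) (\<lambda>y. \<Prod>i\<in>I. normal_density (x i) \<epsilon> (y i))"
    and "(\<integral>y. (\<Prod>i\<in>I. normal_density (x i) \<epsilon> (y i)) \<partial>PiM I (\<lambda>_. lborel)) = 1"
proof -
  interpret product_sigma_finite "\<lambda>_. lborel :: real measure" ..
  show "integrable (PiM I (\<lambda>_. lborel)) (\<lambda>y. \<Prod>i\<in>I. normal_density (x i) \<epsilon> (y i))"
    using assms by (intro product_integrable_prod) auto
  show "(\<integral>y. (\<Prod>i\<in>I. normal_density (x i) \<epsilon> (y i)) \<partial>PiM I (\<lambda>_. lborel)) = 1"
    using assms by (subst product_integral_prod) auto
qed

lemma integral_abs_normal_density_le: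
  assumes "\<epsilon> > 0"
  shows "integrable lborel (\<lambda>y. normal_density x \<epsilon> y * \<bar>y - x\<bar>)"
    and "(\<integral>y. normal_density x \<epsilon> y * \<bar>y - x\<bar> \<partial>lborel) \<le> \<epsilon>"
proof -
  show "integrable lborel (\<lambda>y. normal_density x \<epsilon> y * \<bar>y - x\<bar>)"
    using integrable_normal_moment_abs[OF assms, of x 1] by simp
  have "(\<integral>y. normal_density x \<epsilon> y * \<bar>y - x\<bar> \<partial>lborel) = \<epsilon> * sqrt (2 / pi)"
    using has_bochner_integral_integral_eq[OF normal_moment_abs_odd[of \<epsilon> x 0]] assms by simp
  also have "\<dots> \<le> \<epsilon>"
    using assms pi_gt3 by (simp add: mult_le_cancel_left1)
  finally show "(\<integral>y. normal_density x \<epsilon> y * \<bar>y - x\<bar> \<partial>lborel) \<le> \<epsilon>" .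
qed

lemma abs_integral_le_integral:
  fixes f g :: "'a \<Rightarrow> real"
  assumes "integrable M f" "integrable M g" "\<And>x. x \<in> space M \<Longrightarrow> \<bar>f x\<bar> \<le> g x"
  shows "\<bar>integral\<^sup>L M f\<bar> \<le> integral\<^sup>L M g"
    by (rule order_trans[OF integral_abs_bound integral_mono]) (use assms in auto)

text \<open>Averaging against the kernel perturbs each coordinate in \<open>I\<close> by independent
  noise of mean absolute size at most \<open>\<epsilon>\<close>, and \<open>F\<close> moves by at
  most \<open>L\<close> times the total perturbation. The bound does not depend on
  \<open>x\<close>.\<close>

lemma smoothing_error:
  fixes F :: "('i::countable \<Rightarrow> real) \<Rightarrow> real"
  assumes "\<epsilon> > 0" "finite I" "L \<ge> 0"
    and lip: "\<And>u v. \<bar>F u - F v\<bar> \<le> L * (\<Sum>i\<in>I. \<bar>u i - v i\<bar>)"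
    and bdd: "\<And>u. \<bar>F u\<bar> \<le> B"
  shows "integrable (PiM I (\<lambda>_. lborel)) (\<lambda>y. F y * (\<Prod>i\<in>I. normal_density (x i) \<epsilon> (y i)))"
    and "\<bar>(\<integral>y. F y * (\<Prod>i\<in>I. normal_density (x i) \<epsilon> (y i)) \<partial>PiM I (\<lambda>_. lborel)) - F x\<bar> \<le> L * card I * \<epsilon>"
proof -
  interpret product_sigma_finite "\<lambda>_. lborel :: real measure" ..
  let ?A = "PiM I (\<lambda>_. lborel :: real measure)"
  let ?K = "\<lambda>y. \<Prod>i\<in>I. normal_density (x i) \<epsilon> (y i)"
  note K = integrable_prod_normal_density[OF assms(1,2), of x]
  have K_nonneg: "0 \<le> ?K y" for y by (simp add: prod_nonneg)
  have [measurable]: "F \<in> borel_measurable ?A"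
    using measurable_finite_lipschitz[OF lip, of "\<lambda>y. y" ?A] by simp
  show int: "integrable ?A (\<lambda>y. F y * ?K y)"
  proof (rule Bochner_Integration.integrable_bound)
    show "integrable ?A (\<lambda>y. B * ?K y)" using K(1) by simp
    show "AE y in ?A. norm (F y * ?K y) \<le> norm (B * ?K y)"
      using bdd by (auto simp: abs_mult intro!: mult_right_mono order_trans[OF bdd])
  qed measurable
  \<comment> \<open>The weight is absorbed into the factor with index \<open>j\<close>, so the
    integrand stays a product and every other factor integrates to 1.\<close>
  have *: "?K y * \<bar>y j - x j\<bar> =
      (\<Prod>i\<in>I. normal_density (x i) \<epsilon> (y i) * (if i = j then \<bar>y i - x i\<bar> else 1))" if "j \<in> I" for j y
    using that assms(2) by (simp add: prod.distrib)
  have intj: "integrable ?A (\<lambda>y. ?K y * \<bar>y j - x j\<bar>)" if "j \<in> I" for j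
    unfolding *[OF that]
  proof (intro product_integrable_prod)
    show "integrable lborel (\<lambda>y. normal_density (x i) \<epsilon> y * (if i = j then \<bar>y - x i\<bar> else 1))" for i
      using assms(1) integral_abs_normal_density_le(1)[of \<epsilon> "x j"] by (cases "i = j") auto
  qed fact
  have "(\<integral>y. ?K y * \<bar>y j - x j\<bar> \<partial>?A) \<le> \<epsilon>" if "j \<in> I" for j
  proof -
    have "(\<integral>y. ?K y * \<bar>y j - x j\<bar> \<partial>?A)
      = (\<Prod>i\<in>I. \<integral>y. normal_density (x i) \<epsilon> y * (if i = j then \<bar>y - x i\<bar> else 1) \<partial>lborel)"
      unfolding *[OF that]
    proof (intro product_integral_prod)
      show "integrable lborel (\<lambda>y. normal_density (x i) \<epsilon> y * (if i = j then \<bar>y - x i\<bar> else 1))" for i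
        using assms(1) integral_abs_normal_density_le(1)[of \<epsilon> "x j"] by (cases "i = j") auto
    qed fact
    also have "\<dots> = (\<Prod>i\<in>I. if i = j then \<integral>y. normal_density (x i) \<epsilon> y * \<bar>y - x i\<bar> \<partial>lborel else 1)"
      using assms by (intro prod.cong) auto
    also have "\<dots> = (\<integral>y. normal_density (x j) \<epsilon> y * \<bar>y - x j\<bar> \<partial>lborel)"
      using that assms by simp
    finally show ?thesis using integral_abs_normal_density_le(2)[OF assms(1)] by simp
  qed
  then have sum_le: "(\<Sum>j\<in>I. \<integral>y. ?K y * \<bar>y j - x j\<bar> \<partial>?A) \<le> card I * \<epsilon>"
    by (rule sum_bounded_above)
  have "(\<integral>y. F y * ?K y \<partial>?A) - F x = (\<integral>y. (F y - F x) * ?K y \<partial>?A)"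
    using int K by (simp add: left_diff_distrib)
  also have "\<bar>\<dots>\<bar> \<le> (\<integral>y. L * (\<Sum>j\<in>I. ?K y * \<bar>y j - x j\<bar>) \<partial>?A)"
  proof (rule abs_integral_le_integral)
    show "integrable ?A (\<lambda>y. (F y - F x) * ?K y)"
      using int K by (simp add: left_diff_distrib)
    show "integrable ?A (\<lambda>y. L * (\<Sum>j\<in>I. ?K y * \<bar>y j - x j\<bar>))"
      by (intro Bochner_Integration.integrable_mult_right Bochner_Integration.integrable_sum intj)
    show "\<bar>(F y - F x) * ?K y\<bar> \<le> L * (\<Sum>j\<in>I. ?K y * \<bar>y j - x j\<bar>)" for y
      using mult_right_mono[OF lip[of y x] K_nonneg[of y]] K_nonneg[of y]
      by (simp add: abs_mult sum_distrib_left sum_distrib_right mult_ac)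
  qed
  also have "\<dots> = L * (\<Sum>j\<in>I. \<integral>y. ?K y * \<bar>y j - x j\<bar> \<partial>?A)"
    using intj by (simp add: Bochner_Integration.integral_sum)
  also have "\<dots> \<le> L * (card I * \<epsilon>)"
    using sum_le \<open>L \<ge> 0\<close> by (rule mult_left_mono)
  finally show "\<bar>(\<integral>y. F y * ?K y \<partial>?A) - F x\<bar> \<le> L * card I * \<epsilon>"
    by (simp add: mult_ac)
qed

text \<open>Equal integrals make \<open>f n - g\<close> integrate to 0, so the integral of its
  absolute value is twice that of \<open>max 0 (g - f n)\<close>, and the latter is dominated by
  \<open>g\<close>.\<close>

lemma scheffe:
  fixes f :: "nat \<Rightarrow> 'a \<Rightarrow> real"
  assumes int: "\<And>n. integrable M (f n)" "integrable M g"
    and nonneg: "\<And>n x. 0 \<le> f n x" "\<And>x. 0 \<le> g x"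
    and eq: "\<And>n. integral\<^sup>L M (f n) = integral\<^sup>L M g"
    and lim: "\<And>x. (\<lambda>n. f n x) \<longlonglongrightarrow> g x"
  shows "(\<lambda>n. \<integral>x. \<bar>f n x - g x\<bar> \<partial>M) \<longlonglongrightarrow> 0"
proof -
  have "(\<lambda>n. \<integral>x. max 0 (g x - f n x) \<partial>M) \<longlonglongrightarrow> (\<integral>x. 0 \<partial>M)"
  proof (rule integral_dominated_convergence[where w = g])
    show "AE x in M. (\<lambda>n. max 0 (g x - f n x)) \<longlonglongrightarrow> 0"
    proof (rule AE_I2)
      fix x
      have "(\<lambda>n. max 0 (g x - f n x)) \<longlonglongrightarrow> max 0 (g x - g x)"
        by (intro tendsto_intros lim)
      then show "(\<lambda>n. max 0 (g x - f n x)) \<longlonglongrightarrow> 0" by simp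
    qed
    show "AE x in M. norm (max 0 (g x - f n x)) \<le> g x" for n
      using nonneg by auto
  qed (use int in auto)
  then have "(\<lambda>n. 2 * (\<integral>x. max 0 (g x - f n x) \<partial>M)) \<longlonglongrightarrow> 2 * 0"
    by (intro tendsto_intros) simp
  moreover have "(\<integral>x. \<bar>f n x - g x\<bar> \<partial>M) = 2 * (\<integral>x. max 0 (g x - f n x) \<partial>M)" for n
  proof -
    have "(\<integral>x. \<bar>f n x - g x\<bar> \<partial>M) = (\<integral>x. 2 * max 0 (g x - f n x) + (f n x - g x) \<partial>M)"
      by (rule Bochner_Integration.integral_cong) (auto simp: abs_if max_def)
    also have "\<dots> = 2 * (\<integral>x. max 0 (g x - f n x) \<partial>M)"
      using int eq[of n] by simp
    finally show ?thesis .
  qed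
  ultimately show ?thesis by simp
qed


text \<open>The density of the coordinates of \<open>X\<close> in \<open>I\<close> after adding
  independent centred normal noise of standard deviation \<open>\<epsilon>\<close>.\<close>

definition smoothed_density :: "'w measure \<Rightarrow> 'i set \<Rightarrow> real \<Rightarrow> ('w \<Rightarrow> 'i \<Rightarrow> real) \<Rightarrow> ('i \<Rightarrow> real) \<Rightarrow> real" where
  "smoothed_density M I \<epsilon> X y = (\<integral>\<omega>. (\<Prod>i\<in>I. normal_density (X \<omega> i) \<epsilon> (y i)) \<partial>M)"

lemma smoothed_density_nonneg: "0 \<le> smoothed_density M I \<epsilon> X y"
  unfolding smoothed_density_def by (intro integral_nonneg_AE AE_I2 prod_nonneg) auto

context prob_space
begin

text \<open>Fubini moves the integral over \<open>M\<close> inside: for fixed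
  \<open>\<epsilon>\<close> the density depends on \<open>X\<close> only through its joint
  characteristic function, taken at the arguments \<open>- s / \<epsilon>\<close>.\<close>

lemma smoothed_density_eq_char:
  assumes "\<epsilon> > 0" "finite I" and X[measurable]: "\<And>i. i \<in> I \<Longrightarrow> (\<lambda>\<omega>. X \<omega> i) \<in> borel_measurable M"
  shows "complex_of_real (smoothed_density M I \<epsilon> X y)
    = complex_of_real ((1 / sqrt (2 * pi * \<epsilon>\<^sup>2)) ^ card I) *
      (CLINT s|PiM I (\<lambda>_. std_normal_distribution).
        iexp (\<Sum>i\<in>I. y i * s i / \<epsilon>) * (CLINT \<omega>|M. iexp (\<Sum>i\<in>I. (- s i / \<epsilon>) * X \<omega> i)))"
proof -
  interpret N: real_distribution std_normal_distribution by (rule real_dist_normal_dist)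
  interpret \<gamma>: prob_space "PiM I (\<lambda>_. std_normal_distribution)"
    by (intro prob_space_PiM) unfold_locales
  interpret P: pair_prob_space M "PiM I (\<lambda>_. std_normal_distribution)" ..
  let ?c = "complex_of_real ((1 / sqrt (2 * pi * \<epsilon>\<^sup>2)) ^ card I)"
  let ?\<gamma> = "PiM I (\<lambda>_. std_normal_distribution)"
  have s[measurable]: "(\<lambda>s. s i) \<in> borel_measurable ?\<gamma>" if "i \<in> I" for i
    using measurable_component_singleton[OF that, of "\<lambda>_. std_normal_distribution"] by simp
  have "complex_of_real (smoothed_density M I \<epsilon> X y)
    = (CLINT \<omega>|M. complex_of_real (\<Prod>i\<in>I. normal_density (X \<omega> i) \<epsilon> (y i)))"
    unfolding smoothed_density_def by (rule integral_complex_of_real[symmetric])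
  also have "\<dots> = ?c * (CLINT \<omega>|M. CLINT s|?\<gamma>. iexp (\<Sum>i\<in>I. (y i - X \<omega> i) / \<epsilon> * s i))"
    using assms(1,2) by (subst prod_normal_density_eq_char) auto
  also have "(CLINT \<omega>|M. CLINT s|?\<gamma>. iexp (\<Sum>i\<in>I. (y i - X \<omega> i) / \<epsilon> * s i))
    = (CLINT s|?\<gamma>. CLINT \<omega>|M. iexp (\<Sum>i\<in>I. (y i - X \<omega> i) / \<epsilon> * s i))"
    by (rule P.Fubini_integral[symmetric]) (unfold split_beta', intro P.integrable_iexp_real, measurable)
  also have "\<dots> = (CLINT s|?\<gamma>. CLINT \<omega>|M. iexp (\<Sum>i\<in>I. y i * s i / \<epsilon>) * iexp (\<Sum>i\<in>I. (- s i / \<epsilon>) * X \<omega> i))"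
    unfolding mult_exp_exp distrib_left[symmetric] of_real_add[symmetric] sum.distrib[symmetric]
    by (simp add: diff_divide_distrib algebra_simps)
  finally show ?thesis by simp
qed

lemma
  assumes "\<epsilon> > 0" "finite I" and X[measurable]: "\<And>i. i \<in> I \<Longrightarrow> (\<lambda>\<omega>. X \<omega> i) \<in> borel_measurable M"
  shows integrable_smoothed_density: "integrable (PiM I (\<lambda>_. lborel)) (smoothed_density M I \<epsilon> X)"
    and integral_smoothed_density: "integral\<^sup>L (PiM I (\<lambda>_. lborel)) (smoothed_density M I \<epsilon> X) = 1"
    and integral_mult_smoothed_density: "\<lbrakk>F \<in> borel_measurable (PiM I (\<lambda>_. lborel)); \<And>u. \<bar>F u\<bar> \<le> B\<rbrakk> \<Longrightarrow>
      (\<integral>y. F y * smoothed_density M I \<epsilon> X y \<partial>PiM I (\<lambda>_. lborel))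
      = (\<integral>\<omega>. (\<integral>y. F y * (\<Prod>i\<in>I. normal_density (X \<omega> i) \<epsilon> (y i)) \<partial>PiM I (\<lambda>_. lborel)) \<partial>M)"
proof -
  interpret L: product_sigma_finite "\<lambda>_. lborel :: real measure" ..
  let ?A = "PiM I (\<lambda>_. lborel :: real measure)"
  interpret A: sigma_finite_measure ?A by (rule L.sigma_finite) fact
  interpret P: pair_sigma_finite M ?A ..
  let ?K = "\<lambda>\<omega> y. \<Prod>i\<in>I. normal_density (X \<omega> i) \<epsilon> (y i)"
  have s[measurable]: "(\<lambda>s. s i) \<in> borel_measurable ?A" if "i \<in> I" for i
    using measurable_component_singleton[OF that, of "\<lambda>_. lborel"] by simp
  have meas[measurable]: "case_prod ?K \<in> borel_measurable (M \<Otimes>\<^sub>M ?A)"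
    unfolding normal_density_def by measurable
  have nonneg: "0 \<le> ?K \<omega> y" for \<omega> y by (simp add: prod_nonneg)
  note K = integrable_prod_normal_density[OF assms(1,2)]
  have int: "integrable (M \<Otimes>\<^sub>M ?A) (case_prod ?K)"
    by (subst P.Fubini_integrable) (use K nonneg in \<open>auto simp: abs_prod\<close>)
  show "integrable ?A (smoothed_density M I \<epsilon> X)"
    unfolding smoothed_density_def[abs_def] using P.integrable_snd[OF int] .
  show "integral\<^sup>L ?A (smoothed_density M I \<epsilon> X) = 1"
    unfolding smoothed_density_def[abs_def] using P.Fubini_integral[OF int] K(2)
    by (simp add: prob_space)
  assume F[measurable]: "F \<in> borel_measurable ?A" and B: "\<And>u. \<bar>F u\<bar> \<le> B"
  have "integrable (M \<Otimes>\<^sub>M ?A) (\<lambda>(\<omega>, y). F y * ?K \<omega> y)"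
  proof (rule Bochner_Integration.integrable_bound)
    show "integrable (M \<Otimes>\<^sub>M ?A) (\<lambda>z. B * case_prod ?K z)" using int by simp
    show "AE z in M \<Otimes>\<^sub>M ?A. norm (case z of (\<omega>, y) \<Rightarrow> F y * ?K \<omega> y) \<le> norm (B * case_prod ?K z)"
      using nonneg by (auto simp: abs_mult split: prod.split intro!: mult_right_mono order_trans[OF B])
  qed measurable
  from P.Fubini_integral[OF this]
  show "(\<integral>y. F y * smoothed_density M I \<epsilon> X y \<partial>?A) = (\<integral>\<omega>. (\<integral>y. F y * ?K \<omega> y \<partial>?A) \<partial>M)"
    by (simp add: smoothed_density_def)
qed

lemma smoothed_density_expectation_error:
  fixes F :: "('i::countable \<Rightarrow> real) \<Rightarrow> real"
  assumes "\<epsilon> > 0" "finite I" "L \<ge> 0"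
    and X: "\<And>i. i \<in> I \<Longrightarrow> (\<lambda>\<omega>. X \<omega> i) \<in> borel_measurable M"
    and lip: "\<And>u v. \<bar>F u - F v\<bar> \<le> L * (\<Sum>i\<in>I. \<bar>u i - v i\<bar>)"
    and bdd: "\<And>u. \<bar>F u\<bar> \<le> B"
  shows "\<bar>(\<integral>y. F y * smoothed_density M I \<epsilon> X y \<partial>PiM I (\<lambda>_. lborel)) - (\<integral>\<omega>. F (X \<omega>) \<partial>M)\<bar>
    \<le> L * card I * \<epsilon>"
proof -
  interpret L: product_sigma_finite "\<lambda>_. lborel :: real measure" ..
  let ?A = "PiM I (\<lambda>_. lborel :: real measure)"
  interpret A: sigma_finite_measure ?A by (rule L.sigma_finite) fact
  let ?K = "\<lambda>\<omega> y. \<Prod>i\<in>I. normal_density (X \<omega> i) \<epsilon> (y i)"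
  note [measurable] = X
  have s[measurable]: "(\<lambda>s. s i) \<in> borel_measurable ?A" if "i \<in> I" for i
    using measurable_component_singleton[OF that, of "\<lambda>_. lborel"] by simp
  have F[measurable]: "F \<in> borel_measurable ?A"
    using measurable_finite_lipschitz[OF lip, of "\<lambda>y. y" ?A] by simp
  have FX[measurable]: "(\<lambda>\<omega>. F (X \<omega>)) \<in> borel_measurable M"
    by (rule measurable_finite_lipschitz[OF lip X])
  have err: "\<bar>(\<integral>y. F y * ?K \<omega> y \<partial>?A) - F (X \<omega>)\<bar> \<le> L * card I * \<epsilon>" for \<omega>
    by (rule smoothing_error(2)[OF assms(1-3) lip bdd])
  have meas[measurable]: "(\<lambda>\<omega>. \<integral>y. F y * ?K \<omega> y \<partial>?A) \<in> borel_measurable M"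
    unfolding normal_density_def by measurable
  have 1: "integrable M (\<lambda>\<omega>. F (X \<omega>))"
    using bdd by (intro integrable_const_bound[of _ B]) auto
  have 2: "integrable M (\<lambda>\<omega>. \<integral>y. F y * ?K \<omega> y \<partial>?A)"
  proof (intro integrable_const_bound[of _ "B + L * card I * \<epsilon>"] AE_I2)
    show "norm (\<integral>y. F y * ?K \<omega> y \<partial>?A) \<le> B + L * card I * \<epsilon>" for \<omega>
      using err[of \<omega>] bdd[of "X \<omega>"] by simp
  qed measurable
  have "\<bar>(\<integral>y. F y * smoothed_density M I \<epsilon> X y \<partial>?A) - (\<integral>\<omega>. F (X \<omega>) \<partial>M)\<bar>
    = \<bar>\<integral>\<omega>. (\<integral>y. F y * ?K \<omega> y \<partial>?A) - F (X \<omega>) \<partial>M\<bar>"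
    using 1 2 by (simp add: integral_mult_smoothed_density[OF assms(1,2) X F bdd])
  also have "\<dots> \<le> (\<integral>\<omega>. L * card I * \<epsilon> \<partial>M)"
    by (rule abs_integral_le_integral) (use 1 2 err in auto)
  finally show ?thesis by (simp add: prob_space)
qed

end

text \<open>For fixed \<open>\<epsilon>\<close> the smoothed densities converge pointwise by
  dominated convergence over the frequencies, hence in the mean by \<open>scheffe\<close>, and so do
  their integrals against the bounded \<open>F\<close>. The smoothing error is the same for all
  \<open>n\<close>, so \<open>\<epsilon>\<close> can be fixed before \<open>n\<close>.\<close>

theorem levy_continuity_finite_lipschitz:
  fixes F :: "('i::countable \<Rightarrow> real) \<Rightarrow> real" and X :: "nat \<Rightarrow> 'w \<Rightarrow> 'i \<Rightarrow> real" and Y :: "'u \<Rightarrow> 'i \<Rightarrow> real"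
  assumes M: "prob_space M" and N: "prob_space N" and I: "finite I" and "L \<ge> 0"
    and X: "\<And>n i. i \<in> I \<Longrightarrow> (\<lambda>\<omega>. X n \<omega> i) \<in> borel_measurable M"
    and Y: "\<And>i. i \<in> I \<Longrightarrow> (\<lambda>\<omega>. Y \<omega> i) \<in> borel_measurable N"
    and conv: "\<And>t. (\<lambda>n. CLINT \<omega>|M. iexp (\<Sum>i\<in>I. t i * X n \<omega> i)) \<longlonglongrightarrow> (CLINT \<omega>|N. iexp (\<Sum>i\<in>I. t i * Y \<omega> i))"
    and lip: "\<And>u v. \<bar>F u - F v\<bar> \<le> L * (\<Sum>i\<in>I. \<bar>u i - v i\<bar>)"
    and bdd: "\<And>u. \<bar>F u\<bar> \<le> B"
  shows "(\<lambda>n. \<integral>\<omega>. F (X n \<omega>) \<partial>M) \<longlonglongrightarrow> (\<integral>\<omega>. F (Y \<omega>) \<partial>N)"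
proof -
  interpret M: prob_space M by fact
  interpret N: prob_space N by fact
  interpret S: real_distribution std_normal_distribution by (rule real_dist_normal_dist)
  let ?\<gamma> = "PiM I (\<lambda>_. std_normal_distribution)"
  let ?A = "PiM I (\<lambda>_. lborel :: real measure)"
  interpret \<gamma>: prob_space ?\<gamma>
    by (intro prob_space_PiM) unfold_locales
  note [measurable] = X Y
  have [measurable]: "(\<lambda>s. s i) \<in> borel_measurable ?\<gamma>" if "i \<in> I" for i
    using measurable_component_singleton[OF that, of "\<lambda>_. std_normal_distribution"] by simp
  have F[measurable]: "F \<in> borel_measurable ?A"
    by (rule measurable_finite_lipschitz[OF lip, of "\<lambda>y. y" ?A])
      (use measurable_component_singleton[of _ I "\<lambda>_. lborel"] in auto)
  have dens: "(\<lambda>n. smoothed_density M I \<epsilon> (X n) y) \<longlonglongrightarrow> smoothed_density N I \<epsilon> Y y" if "\<epsilon> > 0" for \<epsilon> y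
  proof -
    have "(\<lambda>n. CLINT s|?\<gamma>. iexp (\<Sum>i\<in>I. y i * s i / \<epsilon>) * (CLINT \<omega>|M. iexp (\<Sum>i\<in>I. (- s i / \<epsilon>) * X n \<omega> i)))
      \<longlonglongrightarrow> (CLINT s|?\<gamma>. iexp (\<Sum>i\<in>I. y i * s i / \<epsilon>) * (CLINT \<omega>|N. iexp (\<Sum>i\<in>I. (- s i / \<epsilon>) * Y \<omega> i)))"
    proof (rule integral_dominated_convergence[where w = "\<lambda>_. 1"])
      show "AE s in ?\<gamma>. (\<lambda>n. iexp (\<Sum>i\<in>I. y i * s i / \<epsilon>) * (CLINT \<omega>|M. iexp (\<Sum>i\<in>I. (- s i / \<epsilon>) * X n \<omega> i)))
        \<longlonglongrightarrow> iexp (\<Sum>i\<in>I. y i * s i / \<epsilon>) * (CLINT \<omega>|N. iexp (\<Sum>i\<in>I. (- s i / \<epsilon>) * Y \<omega> i))"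
        using conv by (intro AE_I2 tendsto_intros)
      show "AE s in ?\<gamma>. norm (iexp (\<Sum>i\<in>I. y i * s i / \<epsilon>) * (CLINT \<omega>|M. iexp (\<Sum>i\<in>I. (- s i / \<epsilon>) * X n \<omega> i))) \<le> 1" for n
      proof (rule AE_I2)
        fix s
        have "norm (CLINT \<omega>|M. iexp (\<Sum>i\<in>I. (- s i / \<epsilon>) * X n \<omega> i))
          \<le> (\<integral>\<omega>. norm (iexp (\<Sum>i\<in>I. (- s i / \<epsilon>) * X n \<omega> i)) \<partial>M)"
          by (rule integral_norm_bound)
        then show "norm (iexp (\<Sum>i\<in>I. y i * s i / \<epsilon>) * (CLINT \<omega>|M. iexp (\<Sum>i\<in>I. (- s i / \<epsilon>) * X n \<omega> i))) \<le> 1"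
          by (simp only: norm_mult norm_exp_i_times M.prob_space mult_1 Bochner_Integration.lebesgue_integral_const) (simp add: M.prob_space)
      qed
    qed measurable
    from tendsto_mult[OF tendsto_const this]
    have "(\<lambda>n. complex_of_real (smoothed_density M I \<epsilon> (X n) y)) \<longlonglongrightarrow> complex_of_real (smoothed_density N I \<epsilon> Y y)"
      by (simp only: M.smoothed_density_eq_char[OF that I X] N.smoothed_density_eq_char[OF that I Y])
    then show ?thesis by (simp only: tendsto_of_real_iff)
  qed
  have smooth: "(\<lambda>n. \<integral>y. F y * smoothed_density M I \<epsilon> (X n) y \<partial>?A) \<longlonglongrightarrow> (\<integral>y. F y * smoothed_density N I \<epsilon> Y y \<partial>?A)"
    if "\<epsilon> > 0" for \<epsilon>
  proof -
    note int = M.integrable_smoothed_density[OF that I X] N.integrable_smoothed_density[OF that I Y]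
    have B: "0 \<le> B" using bdd[of undefined] by linarith
    have intF: "integrable ?A (\<lambda>y. F y * f y)" if "integrable ?A f" for f
    proof (rule Bochner_Integration.integrable_bound)
      show "integrable ?A (\<lambda>y. B * f y)" using that by simp
      show "AE y in ?A. norm (F y * f y) \<le> norm (B * f y)"
        using bdd by (auto simp: abs_mult intro!: mult_right_mono order_trans[OF bdd])
    qed (use that in measurable)
    have "(\<lambda>n. \<integral>y. \<bar>smoothed_density M I \<epsilon> (X n) y - smoothed_density N I \<epsilon> Y y\<bar> \<partial>?A) \<longlonglongrightarrow> 0"
      by (rule scheffe) (use int in \<open>auto simp: smoothed_density_nonneg M.integral_smoothed_density[OF that I X]
        N.integral_smoothed_density[OF that I Y] intro: dens[OF that]\<close>)
    from tendsto_mult_right_zero[OF this, of B]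
    have lim: "(\<lambda>n. B * (\<integral>y. \<bar>smoothed_density M I \<epsilon> (X n) y - smoothed_density N I \<epsilon> Y y\<bar> \<partial>?A)) \<longlonglongrightarrow> 0" .
    show ?thesis
    proof (rule LIM_zero_cancel, rule Lim_null_comparison[OF always_eventually lim], rule allI)
      fix n
      let ?p = "smoothed_density M I \<epsilon> (X n)" and ?q = "smoothed_density N I \<epsilon> Y"
      have "(\<integral>y. F y * ?p y \<partial>?A) - (\<integral>y. F y * ?q y \<partial>?A) = (\<integral>y. F y * (?p y - ?q y) \<partial>?A)"
        using intF[OF int(1)] intF[OF int(2)] by (simp add: right_diff_distrib)
      also have "\<bar>\<dots>\<bar> \<le> (\<integral>y. B * \<bar>?p y - ?q y\<bar> \<partial>?A)"
        using int bdd by (intro abs_integral_le_integral intF)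
          (auto simp: abs_mult intro!: mult_right_mono)
      finally show "norm ((\<integral>y. F y * ?p y \<partial>?A) - (\<integral>y. F y * ?q y \<partial>?A)) \<le> B * (\<integral>y. \<bar>?p y - ?q y\<bar> \<partial>?A)"
        by simp
    qed
  qed
  show ?thesis
  proof (rule LIMSEQ_I)
    fix r :: real assume "r > 0"
    \<comment> \<open>Each of the two smoothing errors becomes at most \<open>r / 3\<close>; the
      summand 1 keeps the denominator positive when \<open>L\<close> or \<open>card I\<close> is
      0.\<close>
    define \<epsilon> where "\<epsilon> = r / 3 / (L * card I + 1)"
    have pos: "L * card I + 1 > 0" using \<open>L \<ge> 0\<close> by (simp add: add_nonneg_pos)
    have cancel: "a * (x / a) = x" if "a > 0" for a x :: real using that by simp
    have "\<epsilon> > 0" using \<open>r > 0\<close> pos by (simp add: \<epsilon>_def)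
    have small: "L * card I * \<epsilon> \<le> r / 3"
    proof -
      have "L * card I * \<epsilon> \<le> (L * card I + 1) * \<epsilon>" using \<open>\<epsilon> > 0\<close> by (intro mult_right_mono) auto
      also have "\<dots> = r / 3" using cancel[OF pos] unfolding \<epsilon>_def .
      finally show ?thesis .
    qed
    obtain n0 where n0: "\<And>n. n \<ge> n0 \<Longrightarrow>
      norm ((\<integral>y. F y * smoothed_density M I \<epsilon> (X n) y \<partial>?A) - (\<integral>y. F y * smoothed_density N I \<epsilon> Y y \<partial>?A)) < r / 3"
      using LIMSEQ_D[OF smooth[OF \<open>\<epsilon> > 0\<close>], of "r / 3"] \<open>r > 0\<close> by auto
    show "\<exists>no. \<forall>n\<ge>no. norm ((\<integral>\<omega>. F (X n \<omega>) \<partial>M) - (\<integral>\<omega>. F (Y \<omega>) \<partial>N)) < r"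
    proof (intro exI[of _ n0] allI impI)
      fix n assume "n \<ge> n0"
      have "\<bar>(\<integral>y. F y * smoothed_density M I \<epsilon> (X n) y \<partial>?A) - (\<integral>\<omega>. F (X n \<omega>) \<partial>M)\<bar> \<le> L * card I * \<epsilon>"
        using \<open>\<epsilon> > 0\<close> I \<open>L \<ge> 0\<close> X lip bdd by (rule M.smoothed_density_expectation_error)
      moreover have "\<bar>(\<integral>y. F y * smoothed_density N I \<epsilon> Y y \<partial>?A) - (\<integral>\<omega>. F (Y \<omega>) \<partial>N)\<bar> \<le> L * card I * \<epsilon>"
        using \<open>\<epsilon> > 0\<close> I \<open>L \<ge> 0\<close> Y lip bdd by (rule N.smoothed_density_expectation_error)
      ultimately show "norm ((\<integral>\<omega>. F (X n \<omega>) \<partial>M) - (\<integral>\<omega>. F (Y \<omega>) \<partial>N)) < r"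
        using n0[OF \<open>n \<ge> n0\<close>] small
        unfolding real_norm_def by linarith
    qed
  qed
qed

section \<open>Cholesky factorisation of infinite positive semidefinite matrices\<close>

definition psd :: "(nat \<Rightarrow> nat \<Rightarrow> real) \<Rightarrow> bool" where
  "psd \<kappa> \<longleftrightarrow> (\<forall>i j. \<kappa> i j = \<kappa> j i) \<and> (\<forall>c n. 0 \<le> (\<Sum>i<n. \<Sum>j<n. c i * c j * \<kappa> i j))"

text \<open>
  If the pivot \<open>\<kappa> m m\<close> is zero, then row \<open>m\<close> of a positive semidefinite matrix vanishes, so the
  convention \<open>x / 0 = 0\<close> gives the right Schur complement.
\<close>

definition schur :: "nat \<Rightarrow> (nat \<Rightarrow> nat \<Rightarrow> real) \<Rightarrow> nat \<Rightarrow> nat \<Rightarrow> real" where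
  "schur m \<kappa> i j = \<kappa> i j - \<kappa> i m * \<kappa> m j / \<kappa> m m"

text \<open>This is the quadratic form at \<open>c + t e_m\<close>, with \<open>e_m\<close> the unit
  vector at \<open>m\<close>, expanded in powers of the free parameter \<open>t\<close>.\<close>

lemma psd_shift:
  assumes "psd \<kappa>" "n > m"
  shows "0 \<le> (\<Sum>i<n. \<Sum>j<n. c i * c j * \<kappa> i j) + 2 * t * (\<Sum>i<n. c i * \<kappa> i m) + t\<^sup>2 * \<kappa> m m"
proof -
  define e where "e i = (if i = m then t else 0)" for i
  have sym: "\<kappa> i j = \<kappa> j i" for i j using assms by (simp add: psd_def)
  have delta: "(\<Sum>i<n. f i * e i * g i) = f m * t * g m" "(\<Sum>i<n. e i * g i) = t * g m" for f g :: "nat \<Rightarrow> real"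
    using assms(2) by (subst sum.remove[of _ m]; force simp: e_def intro!: sum.neutral)+
  have c_e: "(\<Sum>i<n. \<Sum>j<n. c i * e j * \<kappa> i j) = t * (\<Sum>i<n. c i * \<kappa> i m)"
    by (simp add: delta mult.assoc flip: sum_distrib_left) (simp add: sum_distrib_left mult_ac)
  have "0 \<le> (\<Sum>i<n. \<Sum>j<n. (c i + e i) * (c j + e j) * \<kappa> i j)"
    using assms by (simp add: psd_def)
  also have "\<dots> = (\<Sum>i<n. \<Sum>j<n. c i * c j * \<kappa> i j) + (\<Sum>i<n. \<Sum>j<n. c i * e j * \<kappa> i j)
      + (\<Sum>i<n. \<Sum>j<n. e i * c j * \<kappa> i j) + (\<Sum>i<n. \<Sum>j<n. e i * e j * \<kappa> i j)"
    by (simp add: sum.distrib algebra_simps)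
  also note c_e
  also have "(\<Sum>i<n. \<Sum>j<n. e i * c j * \<kappa> i j) = t * (\<Sum>i<n. c i * \<kappa> i m)"
    using c_e by (subst sum.swap) (simp add: sym mult_ac)
  also have "(\<Sum>i<n. \<Sum>j<n. e i * e j * \<kappa> i j) = t\<^sup>2 * \<kappa> m m"
    using assms(2) by (simp add: delta mult.assoc power2_eq_square flip: sum_distrib_left)
  finally show ?thesis by simp
qed

lemma psd_diag_nonneg:
  assumes "psd \<kappa>"
  shows "0 \<le> \<kappa> m m"
  using psd_shift[OF assms, of m "Suc m" "\<lambda>_. 0" 1] by simp

text \<open>If the diagonal entry vanishes, the form at \<open>e_i + t e_m\<close> is affine in
  \<open>t\<close>; it could not stay nonnegative if its slope \<open>2 * \<kappa> i m\<close> were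
  not 0.\<close>

lemma psd_diag_zero:
  assumes "psd \<kappa>" "\<kappa> m m = 0"
  shows "\<kappa> i m = 0"
proof (rule ccontr)
  assume ne: "\<kappa> i m \<noteq> 0"
  \<comment> \<open>Chosen so that the affine function takes the value -1.\<close>
  define t where "t = - (\<kappa> i i + 1) / (2 * \<kappa> i m)"
  define n where "n = Suc (max i m)"
  have "0 \<le> (\<Sum>k<n. \<Sum>j<n. (if k = i then 1 else 0) * (if j = i then 1 else 0) * \<kappa> k j)
      + 2 * t * (\<Sum>k<n. (if k = i then 1 else 0) * \<kappa> k m) + t\<^sup>2 * \<kappa> m m"
    by (rule psd_shift) (auto simp: assms n_def)
  also have "\<dots> = \<kappa> i i + 2 * t * \<kappa> i m"
    using assms by (simp add: n_def of_bool_def[symmetric] sum.remove[of _ i] del: sum.lessThan_Suc)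
  also have "\<dots> = - 1" using ne by (simp add: t_def field_simps)
  finally show False by simp
qed

text \<open>Completing the square: the form of the Schur complement at \<open>c\<close> is the form
  of \<open>\<kappa>\<close> at \<open>c + t e_m\<close> with the minimising
  \<open>t = - b / \<kappa> m m\<close>.\<close>

lemma psd_schur:
  assumes "psd \<kappa>"
  shows "psd (schur m \<kappa>)"
proof (cases "\<kappa> m m = 0")
  case True
  then show ?thesis using assms by (simp add: schur_def[abs_def])
next
  case False
  have sym: "\<kappa> i j = \<kappa> j i" for i j using assms by (simp add: psd_def)
  have "0 \<le> (\<Sum>i<n. \<Sum>j<n. c i * c j * schur m \<kappa> i j)" for c n
  proof -
    \<comment> \<open>The range is enlarged to contain \<open>m\<close>, with \<open>c\<close>
      padded by zeros, so that the shift along \<open>e_m\<close> is admissible.\<close>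
    define n' where "n' = max n (Suc m)"
    define c' where "c' i = (if i < n then c i else 0)" for i
    define b where "b = (\<Sum>i<n'. c' i * \<kappa> i m)"
    have "(\<Sum>i<n. \<Sum>j<n. c i * c j * schur m \<kappa> i j) = (\<Sum>i<n. \<Sum>j<n'. c i * c' j * schur m \<kappa> i j)"
      by (intro sum.cong refl sum.mono_neutral_cong_left) (auto simp: n'_def c'_def)
    also have "\<dots> = (\<Sum>i<n'. \<Sum>j<n'. c' i * c' j * schur m \<kappa> i j)"
      by (intro sum.mono_neutral_cong_left) (auto simp: n'_def c'_def)
    also have "\<dots> = (\<Sum>i<n'. \<Sum>j<n'. c' i * c' j * \<kappa> i j)
        - (\<Sum>i<n'. \<Sum>j<n'. (c' i * \<kappa> i m) * (c' j * \<kappa> j m)) / \<kappa> m m"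
      by (simp add: schur_def right_diff_distrib sum_subtractf sum_divide_distrib sym mult_ac)
    also have "(\<Sum>i<n'. \<Sum>j<n'. (c' i * \<kappa> i m) * (c' j * \<kappa> j m)) = b\<^sup>2"
      by (simp add: b_def power2_eq_square sum_product)
    also have "(\<Sum>i<n'. \<Sum>j<n'. c' i * c' j * \<kappa> i j) - b\<^sup>2 / \<kappa> m m
        = (\<Sum>i<n'. \<Sum>j<n'. c' i * c' j * \<kappa> i j) + 2 * (- b / \<kappa> m m) * b + (- b / \<kappa> m m)\<^sup>2 * \<kappa> m m"
      using False by (simp add: field_simps power2_eq_square)
    also have "\<dots> \<ge> 0"
      unfolding b_def by (rule psd_shift[OF assms]) (simp add: n'_def)
    finally show ?thesis .
  qed
  then show ?thesis by (auto simp: psd_def schur_def sym mult_ac)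
qed

primrec schur_iter :: "(nat \<Rightarrow> nat \<Rightarrow> real) \<Rightarrow> nat \<Rightarrow> nat \<Rightarrow> nat \<Rightarrow> real" where
  "schur_iter \<kappa> 0 = \<kappa>"
| "schur_iter \<kappa> (Suc m) = schur m (schur_iter \<kappa> m)"

lemma psd_schur_iter: "psd \<kappa> \<Longrightarrow> psd (schur_iter \<kappa> m)"
  by (induction m) (auto intro: psd_schur)

text \<open>Step \<open>m\<close> clears row \<open>m\<close>; if the pivot is 0, that row was
  already zero by \<open>psd_diag_zero\<close>. Rows cleared earlier stay zero, since the subtracted
  term contains an entry of the same row as a factor.\<close>

lemma schur_iter_eq_0:
  assumes "psd \<kappa>" "i < m"
  shows "schur_iter \<kappa> m i j = 0"
  using assms(2)
proof (induction m arbitrary: j)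
  case (Suc m)
  let ?k = "schur_iter \<kappa> m"
  have psd: "psd ?k" by (rule psd_schur_iter[OF assms(1)])
  show ?case
  proof (cases "i = m")
    case True
    have "?k m j = ?k j m" using psd by (simp add: psd_def)
    then show ?thesis using True psd_diag_zero[OF psd, of m j] by (auto simp: schur_def)
  qed (use Suc in \<open>simp add: schur_def\<close>)
qed simp

text \<open>Each elimination step splits off a matrix of rank at most one, whose factor is column
  \<open>m\<close> of \<open>a\<close>; a zero pivot contributes nothing. After \<open>n\<close>
  steps the remainder vanishes on indices below \<open>n\<close>. Rows of \<open>a\<close> have
  finite support, so they define finite linear combinations.\<close>

lemma psd_cholesky:
  assumes "psd \<kappa>"
  obtains a :: "nat \<Rightarrow> nat \<Rightarrow> real" where
    "\<And>i m. i < m \<Longrightarrow> a i m = 0"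
    "\<And>i j n. i < n \<Longrightarrow> j < n \<Longrightarrow> \<kappa> i j = (\<Sum>m<n. a i m * a j m)"
proof
  let ?k = "schur_iter \<kappa>"
  let ?a = "\<lambda>i m. ?k m i m / sqrt (?k m m m)"
  show "?a i m = 0" if "i < m" for i m
    using schur_iter_eq_0[OF assms that] by simp
  fix i j n :: nat assume "i < n" "j < n"
  have "\<kappa> i j = (\<Sum>m<n. ?a i m * ?a j m) + ?k n i j"
  proof (induction n)
    case (Suc n)
    have psd: "psd (?k n)" by (rule psd_schur_iter[OF assms])
    have "?k n i j = ?a i n * ?a j n + ?k (Suc n) i j"
      using psd_diag_nonneg[OF psd, of n] psd by (simp add: schur_def psd_def)
    then show ?case using Suc by simp
  qed simp
  then show "\<kappa> i j = (\<Sum>m<n. ?a i m * ?a j m)"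
    using schur_iter_eq_0[OF assms \<open>i < n\<close>] by simp
qed

section \<open>Dyadic grids and bounded functions on the cube\<close>

text \<open>Coordinates are rounded down, not to the nearest multiple: then coarse rounding factors
  through finer rounding (\<open>grid_map_grid_map\<close>) and the cube is mapped to
  itself.\<close>

definition grid_map :: "real \<Rightarrow> nat \<Rightarrow> real ^ 'd \<Rightarrow> real ^ 'd" where
  "grid_map T k x = (\<chi> i. T * of_int \<lfloor>2 ^ k * x $ i / T\<rfloor> / 2 ^ k)"

definition grid :: "real \<Rightarrow> nat \<Rightarrow> (real ^ 'd) set" where
  "grid T k = grid_map T k ` cube T"

lemma infnorm_le_cart_iff:
  fixes x :: "real ^ 'd"
  shows "infnorm x \<le> e \<longleftrightarrow> (\<forall>i. \<bar>x $ i\<bar> \<le> e)"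
proof
  assume "\<forall>i. \<bar>x $ i\<bar> \<le> e"
  then show "infnorm x \<le> e" unfolding infnorm_cart by (intro cSup_least) auto
qed (use component_le_infnorm_cart order_trans in blast)

lemma mem_cube_iff: "x \<in> cube T \<longleftrightarrow> (\<forall>i. 0 \<le> x $ i \<and> x $ i \<le> T)"
  by (auto simp: cube_def less_eq_vec_def)

text \<open>No integer multiple of \<open>n\<close> lies strictly between the floor of
  \<open>y\<close> and \<open>y\<close>. This is the one-dimensional reason why the roundings are
  consistent across levels.\<close>

lemma floor_of_int_floor_divide:
  assumes "n > 0"
  shows "\<lfloor>of_int \<lfloor>y :: real\<rfloor> / real n\<rfloor> = \<lfloor>y / real n\<rfloor>"
proof (rule floor_unique)
  have "\<lfloor>y / real n\<rfloor> * int n \<le> \<lfloor>y\<rfloor>"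
  proof (subst le_floor_iff)
    show "of_int (\<lfloor>y / real n\<rfloor> * int n) \<le> y"
      using pos_le_divide_eq[of "real n" "of_int \<lfloor>y / real n\<rfloor>" y] assms by simp
  qed
  then have "real_of_int (\<lfloor>y / real n\<rfloor> * int n) \<le> real_of_int \<lfloor>y\<rfloor>" by (simp only: of_int_le_iff)
  then show "of_int \<lfloor>y / real n\<rfloor> \<le> of_int \<lfloor>y\<rfloor> / real n" using assms by (simp add: field_simps)
  have "of_int \<lfloor>y\<rfloor> / real n \<le> y / real n" using assms by (simp add: divide_right_mono)
  also have "\<dots> < of_int \<lfloor>y / real n\<rfloor> + 1" by linarith
  finally show "of_int \<lfloor>y\<rfloor> / real n < of_int \<lfloor>y / real n\<rfloor> + 1" .
qed

lemma grid_map_grid_map: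
  assumes "T > 0" "k \<le> l"
  shows "grid_map T k (grid_map T l x) = grid_map T k x"
proof -
  obtain m where l: "l = k + m" using assms(2) le_Suc_ex by blast
  have "\<lfloor>2 ^ k * (T * of_int \<lfloor>2 ^ l * u / T\<rfloor> / 2 ^ l) / T\<rfloor> = \<lfloor>2 ^ k * u / T\<rfloor>" for u :: real
  proof -
    have "\<lfloor>2 ^ k * (T * of_int \<lfloor>2 ^ l * u / T\<rfloor> / 2 ^ l) / T\<rfloor> = \<lfloor>of_int \<lfloor>2 ^ l * u / T\<rfloor> / real (2 ^ m)\<rfloor>"
      using assms by (simp add: l power_add)
    also have "\<dots> = \<lfloor>2 ^ l * u / T / real (2 ^ m)\<rfloor>"
      by (rule floor_of_int_floor_divide) simp
    finally show ?thesis by (simp add: l power_add mult_ac)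
  qed
  then show ?thesis by (simp add: grid_map_def)
qed

lemma grid_map_comp:
  assumes "T > 0"
  shows "grid_map T k x $ i \<le> x $ i" "x $ i \<le> grid_map T k x $ i + T / 2 ^ k"
proof -
  have "of_int \<lfloor>2 ^ k * x $ i / T\<rfloor> \<le> 2 ^ k * x $ i / T" by simp
  from mult_right_mono[OF this, of "T / 2 ^ k"] show "grid_map T k x $ i \<le> x $ i"
    using assms by (simp add: grid_map_def mult_ac)
  have "2 ^ k * x $ i / T \<le> of_int \<lfloor>2 ^ k * x $ i / T\<rfloor> + 1" by linarith
  from mult_right_mono[OF this, of "T / 2 ^ k"] show "x $ i \<le> grid_map T k x $ i + T / 2 ^ k"
    using assms by (simp add: grid_map_def algebra_simps)
qed

lemma grid_map_in_cube:
  assumes "T > 0" "x \<in> cube T"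
  shows "grid_map T k x \<in> cube T"
  unfolding mem_cube_iff
proof (intro allI conjI)
  fix i
  have x: "0 \<le> x $ i" "x $ i \<le> T" using assms(2) by (auto simp: mem_cube_iff)
  then show "0 \<le> grid_map T k x $ i" using assms(1) by (simp add: grid_map_def)
  show "grid_map T k x $ i \<le> T" using grid_map_comp(1)[OF assms(1), where k = k and x = x and i = i] x by simp
qed

lemma grid_subset_cube: "T > 0 \<Longrightarrow> grid T k \<subseteq> cube T"
  using grid_map_in_cube by (auto simp: grid_def)

lemma infnorm_grid_map:
  assumes "T > 0"
  shows "infnorm (x - grid_map T k x) \<le> T / 2 ^ k"
  unfolding infnorm_le_cart_iff
proof
  show "\<bar>(x - grid_map T k x) $ i\<bar> \<le> T / 2 ^ k" for i
    using grid_map_comp[OF assms, where k = k and x = x and i = i] by simp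
qed

lemma grid_map_on_grid: "T > 0 \<Longrightarrow> x \<in> grid T k \<Longrightarrow> k \<le> l \<Longrightarrow> grid_map T l x = x"
proof -
  assume T: "T > 0" and "x \<in> grid T k" and "k \<le> l"
  then obtain y where x: "x = grid_map T k y" by (auto simp: grid_def)
  obtain m where l: "l = k + m" using \<open>k \<le> l\<close> le_Suc_ex by blast
  have "\<lfloor>2 ^ l * x $ i / T\<rfloor> = 2 ^ m * \<lfloor>2 ^ k * y $ i / T\<rfloor>" for i
  proof -
    have "2 ^ l * x $ i / T = of_int (2 ^ m * \<lfloor>2 ^ k * y $ i / T\<rfloor>)"
      using T by (simp add: x grid_map_def l power_add)
    then show ?thesis by (simp only: floor_of_int)
  qed
  then have "grid_map T l x $ i = T * of_int (2 ^ m * \<lfloor>2 ^ k * y $ i / T\<rfloor>) / 2 ^ l" for i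
    by (simp only: grid_map_def[of T l] vec_lambda_beta)
  then have "grid_map T l x $ i = x $ i" for i
    by (simp add: l power_add x grid_map_def[of T k])
  then show "grid_map T l x = x" by (simp add: vec_eq_iff)
qed

text \<open>Coordinates of grid points are \<open>j T / 2^k\<close> with
  \<open>0 \<le> j \<le> 2 ^ k\<close>; both ends of the closed interval occur, hence the
  \<open>+ 1\<close>.\<close>

lemma finite_card_grid:
  assumes "T > 0"
  shows "finite (grid T k :: (real ^ 'd) set)" "card (grid T k :: (real ^ 'd) set) \<le> (2 ^ k + 1) ^ CARD('d)"
proof -
  let ?J = "UNIV \<rightarrow>\<^sub>E {..2 ^ k} :: ('d \<Rightarrow> nat) set"
  let ?f = "\<lambda>j. (\<chi> i. T * real (j i) / 2 ^ k) :: real ^ 'd"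
  have fin: "finite ?J" by (intro finite_PiE) auto
  have sub: "(grid T k :: (real ^ 'd) set) \<subseteq> ?f ` ?J"
  proof
    fix x :: "real ^ 'd" assume "x \<in> grid T k"
    then obtain y where y: "y \<in> cube T" and x: "x = grid_map T k y" by (auto simp: grid_def)
    have "0 \<le> \<lfloor>2 ^ k * y $ i / T\<rfloor> \<and> \<lfloor>2 ^ k * y $ i / T\<rfloor> \<le> 2 ^ k" for i
    proof -
      have "0 \<le> y $ i" "y $ i \<le> T" using y by (auto simp: mem_cube_iff)
      then have "0 \<le> 2 ^ k * y $ i / T" "2 ^ k * y $ i / T \<le> 2 ^ k" using assms by (auto simp: field_simps)
      then show ?thesis by (simp add: floor_le_iff)
    qed
    then show "x \<in> ?f ` ?J"
      by (intro image_eqI[of x ?f "\<lambda>i. nat \<lfloor>2 ^ k * y $ i / T\<rfloor>"]) (auto simp: x grid_map_def vec_eq_iff nat_le_iff)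
  qed
  show "finite (grid T k :: (real ^ 'd) set)" using finite_subset[OF sub] fin by blast
  have "card (grid T k :: (real ^ 'd) set) \<le> card (?f ` ?J)" using sub fin by (intro card_mono) auto
  also have "\<dots> \<le> card ?J" by (rule card_image_le[OF fin])
  also have "\<dots> = (2 ^ k + 1) ^ CARD('d)" by (simp add: card_PiE)
  finally show "card (grid T k :: (real ^ 'd) set) \<le> (2 ^ k + 1) ^ CARD('d)" .
qed

lemma cube_nonempty: "T > 0 \<Longrightarrow> cube T \<noteq> {}"
  by (auto simp: cube_def less_eq_vec_def)

definition dyadic :: "real \<Rightarrow> (real ^ 'd) set" where
  "dyadic T = (\<Union>k. grid T k)"

lemma countable_dyadic: "T > 0 \<Longrightarrow> countable (dyadic T)"
  unfolding dyadic_def using finite_card_grid(1) by (intro countable_UN) (auto intro: countable_finite)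

lemma dyadic_nonempty: "T > 0 \<Longrightarrow> dyadic T \<noteq> {}"
  using cube_nonempty by (auto simp: dyadic_def grid_def)

lemma dyadic_subset_cube: "T > 0 \<Longrightarrow> dyadic T \<subseteq> cube T"
  using grid_subset_cube by (auto simp: dyadic_def)

lemma grid_map_in_grid: "x \<in> cube T \<Longrightarrow> grid_map T k x \<in> grid T k"
  by (auto simp: grid_def)

lemma grid_map_in_dyadic: "x \<in> cube T \<Longrightarrow> grid_map T k x \<in> dyadic T"
  by (auto simp: dyadic_def grid_def)

text \<open>Enumerating the dyadic points turns a process on them into a real sequence, so that
  sampled paths and abstractly constructed Gaussian sequences are handled by the same lemmas over
  the countable index type \<open>nat\<close>.\<close>

abbreviation dyadic_point :: "real \<Rightarrow> nat \<Rightarrow> real ^ 'd" where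
  "dyadic_point T \<equiv> from_nat_into (dyadic T)"

abbreviation dyadic_index :: "real \<Rightarrow> real ^ 'd \<Rightarrow> nat" where
  "dyadic_index T \<equiv> to_nat_on (dyadic T)"

lemma dyadic_point_index: "T > 0 \<Longrightarrow> x \<in> dyadic T \<Longrightarrow> dyadic_point T (dyadic_index T x) = x"
  by (simp add: countable_dyadic)

lemma dyadic_point_in_cube: "T > 0 \<Longrightarrow> dyadic_point T j \<in> cube T"
  using dyadic_subset_cube from_nat_into[OF dyadic_nonempty] by blast

definition stepfun :: "real \<Rightarrow> nat \<Rightarrow> (nat \<Rightarrow> real) \<Rightarrow> real ^ 'd \<Rightarrow> real" where
  "stepfun T k w = (\<lambda>x\<in>cube T. w (dyadic_index T (grid_map T k x)))"

section \<open>Step functions and Lipschitz functionals in the supremum metric\<close>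

lemma linf_dist_upper:
  assumes "f \<in> linf S" "g \<in> linf S" "x \<in> S"
  shows "\<bar>f x - g x\<bar> \<le> linf_dist S f g"
  using assms linf_bdd_above[of f S g] unfolding linf_dist_def by (auto intro: cSUP_upper)

lemma linf_dist_le:
  assumes "S \<noteq> {}" "f \<in> linf S" "g \<in> linf S" "\<And>x. x \<in> S \<Longrightarrow> \<bar>f x - g x\<bar> \<le> e"
  shows "linf_dist S f g \<le> e"
  using assms unfolding linf_dist_def by (auto intro: cSUP_least)

lemma linfI:
  assumes "f \<in> extensional S" "\<And>x. x \<in> S \<Longrightarrow> \<bar>f x\<bar> \<le> B"
  shows "f \<in> linf S"
  using assms by (auto simp: linf_def bounded_iff)

lemma stepfun_in_linf:
  assumes "T > 0"
  shows "stepfun T k w \<in> linf (cube T :: (real ^ 'd) set)"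
proof (rule linfI)
  let ?g = "grid T k :: (real ^ 'd) set"
  show "\<bar>stepfun T k w x\<bar> \<le> (\<Sum>y\<in>?g. \<bar>w (dyadic_index T y)\<bar>)" if "x \<in> cube T" for x :: "real ^ 'd"
    using that finite_card_grid(1)[OF assms] grid_map_in_grid[OF that]
    by (auto simp: stepfun_def intro!: member_le_sum[of _ ?g "\<lambda>y. \<bar>w (dyadic_index T y)\<bar>"])
qed (simp add: stepfun_def)

abbreviation grid_index :: "'d::finite itself \<Rightarrow> real \<Rightarrow> nat \<Rightarrow> nat set" where
  "grid_index _ T k \<equiv> dyadic_index T ` (grid T k :: (real ^ 'd) set)"

lemma linf_dist_stepfun:
  assumes "T > 0"
  shows "linf_dist (cube T :: (real ^ 'd) set) (stepfun T k u) (stepfun T k v)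
    \<le> (\<Sum>i\<in>grid_index TYPE('d) T k. \<bar>u i - v i\<bar>)"
proof (rule linf_dist_le[OF cube_nonempty[OF assms] stepfun_in_linf[OF assms] stepfun_in_linf[OF assms]])
  fix x :: "real ^ 'd" assume x: "x \<in> cube T"
  then show "\<bar>stepfun T k u x - stepfun T k v x\<bar> \<le> (\<Sum>i\<in>grid_index TYPE('d) T k. \<bar>u i - v i\<bar>)"
    using finite_card_grid(1)[OF assms] grid_map_in_grid[OF x]
    by (auto simp: stepfun_def intro!: member_le_sum[of _ _ "\<lambda>i. \<bar>u i - v i\<bar>"])
qed

definition lipschitz_linf :: "real \<Rightarrow> 'a set \<Rightarrow> (('a \<Rightarrow> real) \<Rightarrow> real) \<Rightarrow> bool" where
  "lipschitz_linf L S g \<longleftrightarrow> 0 \<le> L \<and> (\<forall>f\<in>linf S. \<forall>h\<in>linf S. \<bar>g f - g h\<bar> \<le> L * linf_dist S f h)"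

lemma lipschitz_linfD:
  assumes "lipschitz_linf L S g"
  shows "0 \<le> L" "f \<in> linf S \<Longrightarrow> h \<in> linf S \<Longrightarrow> \<bar>g f - g h\<bar> \<le> L * linf_dist S f h"
  using assms by (auto simp: lipschitz_linf_def)

definition sample :: "real \<Rightarrow> (real ^ 'd \<Rightarrow> real) \<Rightarrow> nat \<Rightarrow> real" where
  "sample T f j = f (dyadic_point T j)"

lemma stepfun_sample: "T > 0 \<Longrightarrow> stepfun T k (sample T f) = (\<lambda>x\<in>cube T. f (grid_map T k x))"
  by (auto simp: stepfun_def sample_def dyadic_point_index grid_map_in_dyadic)

text \<open>
  Membership in this set replaces path continuity: it already makes a process with measurable
  evaluations Borel measurable.
\<close>

definition regulated :: "real \<Rightarrow> (real ^ 'd \<Rightarrow> real) set" where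
  "regulated T = {f \<in> linf (cube T). (\<lambda>k. linf_dist (cube T) (stepfun T k (sample T f)) f) \<longlonglongrightarrow> 0}"

lemma lipschitz_linf_tendsto:
  assumes "T > 0" "lipschitz_linf L (cube T) g" "f \<in> regulated T"
  shows "(\<lambda>k. g (stepfun T k (sample T f))) \<longlonglongrightarrow> g f"
proof (rule LIM_zero_cancel, rule Lim_null_comparison)
  show "\<forall>\<^sub>F k in sequentially. norm (g (stepfun T k (sample T f)) - g f)
    \<le> L * linf_dist (cube T) (stepfun T k (sample T f)) f"
    using assms(3) unfolding real_norm_def
    by (intro always_eventually allI lipschitz_linfD(2)[OF assms(2)] stepfun_in_linf assms(1)) (auto simp: regulated_def)
  show "(\<lambda>k. L * linf_dist (cube T) (stepfun T k (sample T f)) f) \<longlonglongrightarrow> 0"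
    using assms(3) by (intro tendsto_mult_right_zero) (auto simp: regulated_def)
qed

lemma lipschitz_linf_stepfun:
  assumes "T > 0" "lipschitz_linf L (cube T :: (real ^ 'd) set) g"
  shows "\<bar>g (stepfun T k u) - g (stepfun T k v)\<bar> \<le> L * (\<Sum>i\<in>grid_index TYPE('d) T k. \<bar>u i - v i\<bar>)"
proof -
  have "\<bar>g (stepfun T k u) - g (stepfun T k v)\<bar> \<le> L * linf_dist (cube T :: (real ^ 'd) set) (stepfun T k u) (stepfun T k v)"
    by (intro lipschitz_linfD(2)[OF assms(2)] stepfun_in_linf assms(1))
  also have "\<dots> \<le> L * (\<Sum>i\<in>grid_index TYPE('d) T k. \<bar>u i - v i\<bar>)"
    by (intro mult_left_mono linf_dist_stepfun assms(1) lipschitz_linfD(1)[OF assms(2)])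
  finally show ?thesis .
qed

lemma measurable_lipschitz_stepfun:
  fixes g :: "(real ^ 'd \<Rightarrow> real) \<Rightarrow> real"
  assumes "T > 0" "lipschitz_linf L (cube T) g"
    and Y: "\<And>x. x \<in> cube T \<Longrightarrow> (\<lambda>\<omega>. Y \<omega> x) \<in> borel_measurable M"
  shows "(\<lambda>\<omega>. g (stepfun T k (sample T (Y \<omega>)))) \<in> borel_measurable M"
  by (rule measurable_finite_lipschitz[OF lipschitz_linf_stepfun[OF assms(1,2)]])
    (simp add: sample_def Y dyadic_point_in_cube assms(1))

text \<open>On regulated paths \<open>g (Y \<omega>)\<close> is the limit of its values at step
  functions, and each of those depends on finitely many evaluations of \<open>Y\<close>.\<close>

lemma measurable_lipschitz_regulated:
  fixes g :: "(real ^ 'd \<Rightarrow> real) \<Rightarrow> real"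
  assumes "T > 0" "lipschitz_linf L (cube T) g"
    and Y: "\<And>x. x \<in> cube T \<Longrightarrow> (\<lambda>\<omega>. Y \<omega> x) \<in> borel_measurable M"
    and reg: "\<And>\<omega>. \<omega> \<in> space M \<Longrightarrow> Y \<omega> \<in> regulated T"
  shows "(\<lambda>\<omega>. g (Y \<omega>)) \<in> borel_measurable M"
  by (rule borel_measurable_LIMSEQ_real[OF lipschitz_linf_tendsto[OF assms(1,2) reg]
    measurable_lipschitz_stepfun[OF assms(1,2) Y]])

text \<open>An open set is the positivity set of the distance to its complement, which is Lipschitz.\<close>

lemma measurable_borel_of_regulated:
  fixes Y :: "'w \<Rightarrow> real ^ 'd \<Rightarrow> real"
  assumes "T > 0"
    and Y: "\<And>x. x \<in> cube T \<Longrightarrow> (\<lambda>\<omega>. Y \<omega> x) \<in> borel_measurable M"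
    and reg: "\<And>\<omega>. \<omega> \<in> space M \<Longrightarrow> Y \<omega> \<in> regulated T"
  shows "Y \<in> measurable M (borel_of (linf_topology (cube T)))"
proof -
  let ?Q = "cube T :: (real ^ 'd) set"
  interpret Metric_space "linf ?Q" "linf_dist ?Q"
    by (rule Metric_space_linf[OF cube_nonempty[OF assms(1)]])
  have linf: "Y \<omega> \<in> linf ?Q" if "\<omega> \<in> space M" for \<omega>
    using reg[OF that] by (simp add: regulated_def)
  show ?thesis
    unfolding borel_of_def
  proof (rule measurable_measure_of)
    show "Y \<in> space M \<rightarrow> topspace (linf_topology ?Q)"
      using linf by (auto simp: topspace_linf_topology cube_nonempty assms(1))
    show "{U. openin (linf_topology ?Q) U} \<subseteq> Pow (topspace (linf_topology ?Q))"
      using openin_subset by auto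
    fix U assume "U \<in> {U. openin (linf_topology ?Q) U}"
    then have U: "U \<subseteq> linf ?Q" "\<And>f. f \<in> U \<Longrightarrow> \<exists>r>0. mball f r \<subseteq> U"
      by (auto simp: linf_topology_def openin_mtopology)
    show "Y -` U \<inter> space M \<in> sets M"
    \<comment> \<open>Split off because the complement is then empty and the infimum defining the
      distance to it would be taken over the empty set.\<close>
    proof (cases "U = linf ?Q")
      case True
      then have "Y -` U \<inter> space M = space M" using linf by auto
      then show ?thesis by simp
    next
      case False
      define C where "C = linf ?Q - U"
      have C: "C \<noteq> {}" "C \<subseteq> linf ?Q" using False U(1) by (auto simp: C_def)
      define g where "g f = (INF h\<in>C. linf_dist ?Q f h)" for f
      have bdd: "bdd_below (linf_dist ?Q f ` C)" for f by (auto intro!: bdd_belowI[of _ 0])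
      have g_le: "g f \<le> linf_dist ?Q f h + g h" if "f \<in> linf ?Q" "h \<in> linf ?Q" for f h
      proof -
        have "g f - linf_dist ?Q f h \<le> linf_dist ?Q h c" if c: "c \<in> C" for c
        proof -
          have "g f \<le> linf_dist ?Q f c" unfolding g_def using c by (intro cINF_lower bdd)
          also have "\<dots> \<le> linf_dist ?Q f h + linf_dist ?Q h c"
            using that \<open>f \<in> linf ?Q\<close> \<open>h \<in> linf ?Q\<close> C by (intro triangle) auto
          finally show ?thesis by simp
        qed
        then have "g f - linf_dist ?Q f h \<le> g h" unfolding g_def[of h] using C by (intro cINF_greatest) auto
        then show ?thesis by simp
      qed
      have "lipschitz_linf 1 ?Q g"
        unfolding lipschitz_linf_def
      proof (intro conjI ballI)
        fix f h assume fh: "f \<in> linf ?Q" "h \<in> linf ?Q"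
        show "\<bar>g f - g h\<bar> \<le> 1 * linf_dist ?Q f h"
          using g_le[OF fh] g_le[OF fh(2,1)] commute[of f h] by simp
      qed simp
      then have [measurable]: "(\<lambda>\<omega>. g (Y \<omega>)) \<in> borel_measurable M"
        by (rule measurable_lipschitz_regulated[OF assms(1) _ Y reg])
      have "f \<in> U \<longleftrightarrow> g f > 0" if f: "f \<in> linf ?Q" for f
      proof
        assume "f \<in> U"
        then obtain r where r: "r > 0" "mball f r \<subseteq> U" using U(2) by auto
        have "r \<le> linf_dist ?Q f c" if "c \<in> C" for c
          using that r f C by (force simp: C_def in_mball)
        then have "r \<le> g f" unfolding g_def using C by (intro cINF_greatest) auto
        then show "g f > 0" using r by simp
      next
        assume pos: "g f > 0"
        show "f \<in> U"
        proof (rule ccontr)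
          assume "f \<notin> U"
          then have "g f \<le> linf_dist ?Q f f" unfolding g_def using f by (intro cINF_lower bdd) (simp add: C_def)
          then show False using pos f by simp
        qed
      qed
      then have "Y -` U \<inter> space M = {\<omega> \<in> space M. g (Y \<omega>) > 0}" using linf by auto
      then show ?thesis by simp
    qed
  qed
qed

section \<open>Lipschitz continuity of landscapes\<close>

text \<open>The dimension is the least size of a finite generating set, and the empty set generates
  exactly the zero space. A space that is not finite-dimensional has value
  \<open>\<infinity>\<close> and is nonzero.\<close>

lemma edim_ge_1_iff:
  assumes "vectorspace K V"
  shows "edim K V \<ge> 1 \<longleftrightarrow> carrier V \<noteq> {\<zero>\<^bsub>V\<^esub>}"
proof -
  interpret vectorspace K V by fact
  have span_empty: "span {} = {\<zero>\<^bsub>V\<^esub>}"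
    by (auto simp: span_def lincomb_def)
  show ?thesis
  proof
    assume ge: "edim K V \<ge> 1"
    show "carrier V \<noteq> {\<zero>\<^bsub>V\<^esub>}"
    proof
      assume c: "carrier V = {\<zero>\<^bsub>V\<^esub>}"
      have fin: "finite {} \<and> card {} = 0 \<and> {} \<subseteq> carrier V \<and> gen_set {}"
        using span_empty c by simp
      then have "fin_dim" unfolding fin_dim_def by blast
      moreover have "dim = 0"
        unfolding dim_def using fin by (intro Least_eq_0) blast
      ultimately show False using ge by (simp add: edim_def zero_enat_def[symmetric])
    qed
  next
    assume ne: "carrier V \<noteq> {\<zero>\<^bsub>V\<^esub>}"
    show "edim K V \<ge> 1"
    proof (cases fin_dim)
      case True
      then obtain A where "finite A" "A \<subseteq> carrier V" "gen_set A" by (auto simp: fin_dim_def)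
      then have "\<exists>n A. finite A \<and> card A = n \<and> A \<subseteq> carrier V \<and> gen_set A" by blast
      from LeastI_ex[OF this] obtain B where B: "finite B" "card B = dim" "gen_set B"
        unfolding dim_def by blast
      have "dim \<noteq> 0"
      proof
        assume "dim = 0"
        then have "B = {}" using B by simp
        then show False using B span_empty ne by simp
      qed
      then show ?thesis using True by (simp add: edim_def one_enat_def)
    qed (simp add: edim_def)
  qed
qed


lemma infnorm_const:
  fixes c :: real
  shows "infnorm ((\<chi> i. c) :: real ^ 'd) = \<bar>c\<bar>"
  using infnorm_le_cart_iff[of "(\<chi> i. c) :: real ^ 'd" "\<bar>c\<bar>"]
    component_le_infnorm_cart[of "(\<chi> i. c) :: real ^ 'd"]
  by (intro antisym) auto

context persistence_module
begin

lemma betti_ge_1_iff: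
  assumes "x \<le> y"
  shows "betti K M \<phi> x y \<ge> 1 \<longleftrightarrow> (\<exists>v\<in>carrier (M x). \<phi> x y v \<noteq> \<zero>\<^bsub>M y\<^esub>)"
proof -
  interpret linear_map K "M x" "M y" "\<phi> x y" by (rule linear_map[OF assms])
  have "vectorspace K ((M y)\<lparr>carrier := \<phi> x y ` carrier (M x)\<rparr>)"
    using W.subspace_is_vs[OF imT_is_subspace] unfolding im_def .
  from edim_ge_1_iff[OF this]
  have "betti K M \<phi> x y \<ge> 1 \<longleftrightarrow> \<phi> x y ` carrier (M x) \<noteq> {\<zero>\<^bsub>M y\<^esub>}"
    unfolding betti_def by simp
  moreover have "\<phi> x y \<zero>\<^bsub>M x\<^esub> = \<zero>\<^bsub>M y\<^esub>" "\<zero>\<^bsub>M x\<^esub> \<in> carrier (M x)" by simp_all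
  then have "\<zero>\<^bsub>M y\<^esub> \<in> \<phi> x y ` carrier (M x)" by (metis image_eqI)
  ultimately show ?thesis by blast
qed

text \<open>The map from \<open>x\<close> to \<open>y\<close> factors through the map from
  \<open>x'\<close> to \<open>y'\<close>; a vector with nonzero image at \<open>y\<close> therefore
  has nonzero image at \<open>y'\<close>.\<close>

lemma betti_mono:
  assumes "betti K M \<phi> x y \<ge> 1" "x \<le> x'" "x' \<le> y'" "y' \<le> y"
  shows "betti K M \<phi> x' y' \<ge> 1"
proof -
  have le: "x \<le> y" "x \<le> y'" using assms by auto
  interpret A: linear_map K "M x" "M x'" "\<phi> x x'" by (rule linear_map) fact
  interpret B: linear_map K "M y'" "M y" "\<phi> y' y" by (rule linear_map) fact
  obtain v where v: "v \<in> carrier (M x)" "\<phi> x y v \<noteq> \<zero>\<^bsub>M y\<^esub>"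
    using assms(1) le by (auto simp: betti_ge_1_iff)
  have "\<phi> x y v = \<phi> y' y (\<phi> x' y' (\<phi> x x' v))"
    using map_comp[OF assms(2,3) v(1)] map_comp[OF le(2) assms(4) v(1)] by simp
  moreover have "\<phi> x x' v \<in> carrier (M x')" using v(1) by simp
  moreover have "\<phi> y' y \<zero>\<^bsub>M y'\<^esub> = \<zero>\<^bsub>M y\<^esub>" by simp
  ultimately have "\<phi> x' y' (\<phi> x x' v) \<noteq> \<zero>\<^bsub>M y'\<^esub>" "\<phi> x x' v \<in> carrier (M x')" using v(2) by auto
  then show ?thesis unfolding betti_ge_1_iff[OF assms(3)] by blast
qed

definition landscape_set :: "real ^ 'd \<Rightarrow> real set" where
  "landscape_set x = {\<epsilon>. \<epsilon> > 0 \<and> (\<forall>h. 0 \<le> h \<and> infnorm h \<le> \<epsilon> \<longrightarrow> betti K M \<phi> (x - h) (x + h) \<ge> 1)}"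

lemma landscape_eq: "landscape K M \<phi> x = (if landscape_set x = {} then 0 else Sup (landscape_set x))"
  unfolding landscape_def landscape_set_def Let_def ..

text \<open>For \<open>\<epsilon> > T\<close> the constant vector \<open>h\<close> with entries
  \<open>\<epsilon>\<close> moves \<open>x - h\<close> out of the cube, where the module is zero, so
  the map from there has rank 0.\<close>

lemma landscape_set_le:
  assumes "parameters_in_cube T M" "x \<in> cube T" "\<epsilon> \<in> landscape_set x"
  shows "\<epsilon> \<le> T"
proof (rule ccontr)
  assume "\<not> \<epsilon> \<le> T"
  have "\<epsilon> > 0" using assms by (simp add: landscape_set_def)
  let ?h = "\<chi> i. \<epsilon>"
  have h: "0 \<le> ?h" "x - ?h \<le> x + ?h" using \<open>\<epsilon> > 0\<close> by (auto simp: less_eq_vec_def)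
  have "x - ?h \<notin> cube T"
  proof
    assume "x - ?h \<in> cube T"
    then have "\<epsilon> \<le> x $ i" for i by (auto simp: cube_def less_eq_vec_def)
    moreover have "x $ i \<le> T" for i using assms(2) by (auto simp: cube_def less_eq_vec_def)
    ultimately show False using \<open>\<not> \<epsilon> \<le> T\<close> order_trans by blast
  qed
  then have "carrier (M (x - ?h)) = {\<zero>\<^bsub>M (x - ?h)\<^esub>}"
    using assms(1) by (auto simp: parameters_in_cube_def)
  moreover interpret linear_map K "M (x - ?h)" "M (x + ?h)" "\<phi> (x - ?h) (x + ?h)"
    by (rule linear_map[OF h(2)])
  have "\<phi> (x - ?h) (x + ?h) \<zero>\<^bsub>M (x - ?h)\<^esub> = \<zero>\<^bsub>M (x + ?h)\<^esub>" by simp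
  ultimately have "\<not> betti K M \<phi> (x - ?h) (x + ?h) \<ge> 1"
    by (simp add: betti_ge_1_iff[OF h(2)])
  moreover have "betti K M \<phi> (x - ?h) (x + ?h) \<ge> 1"
    using assms(3) h(1) \<open>\<epsilon> > 0\<close> by (auto simp: landscape_set_def infnorm_const)
  ultimately show False by simp
qed

lemma bdd_above_landscape_set:
  "parameters_in_cube T M \<Longrightarrow> x \<in> cube T \<Longrightarrow> bdd_above (landscape_set x)"
  using landscape_set_le by (auto simp: bdd_above_def)

lemma landscape_bounds:
  assumes "parameters_in_cube T M" "x \<in> cube T" "T \<ge> 0"
  shows "0 \<le> landscape K M \<phi> x" "landscape K M \<phi> x \<le> T"
proof -
  show "0 \<le> landscape K M \<phi> x"
  proof (cases "landscape_set x = {}")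
    case False
    then obtain \<epsilon> where e: "\<epsilon> \<in> landscape_set x" by auto
    have "0 \<le> \<epsilon>" using e by (simp add: landscape_set_def)
    also have "\<epsilon> \<le> Sup (landscape_set x)"
      using e by (rule cSup_upper) (rule bdd_above_landscape_set[OF assms(1,2)])
    finally show ?thesis using False by (simp add: landscape_eq)
  qed (simp add: landscape_eq)
  show "landscape K M \<phi> x \<le> T"
    using assms landscape_set_le[OF assms(1,2)] by (auto simp: landscape_eq intro!: cSup_least)
qed

text \<open>The map for \<open>h + \<delta>\<close> at \<open>x\<close> factors through the map for \<open>h\<close> at \<open>y\<close>.\<close>

lemma landscape_set_shift:
  assumes "\<epsilon> \<in> landscape_set x" "infnorm (x - y) < \<epsilon>"
  shows "\<epsilon> - infnorm (x - y) \<in> landscape_set y"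
proof -
  define \<delta> where "\<delta> = infnorm (x - y)"
  have comp: "\<bar>x $ i - y $ i\<bar> \<le> \<delta>" for i
    using component_le_infnorm_cart[of "x - y" i] by (simp add: \<delta>_def)
  have "betti K M \<phi> (y - h) (y + h) \<ge> 1" if h: "0 \<le> h" "infnorm h \<le> \<epsilon> - \<delta>" for h
  proof -
    let ?h = "h + (\<chi> i. \<delta>)"
    have "\<delta> \<ge> 0" by (simp add: \<delta>_def infnorm_pos_le)
    have "0 \<le> ?h" using h(1) \<open>\<delta> \<ge> 0\<close> by (auto simp: less_eq_vec_def)
    moreover have "infnorm ?h \<le> \<epsilon>"
      using infnorm_triangle[of h "\<chi> i. \<delta>"] h(2) \<open>\<delta> \<ge> 0\<close> by (simp add: infnorm_const)
    ultimately have "betti K M \<phi> (x - ?h) (x + ?h) \<ge> 1"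
      using assms(1) by (simp add: landscape_set_def)
    then show ?thesis
    proof (rule betti_mono)
      have "x $ i - (h $ i + \<delta>) \<le> y $ i - h $ i" "y $ i + h $ i \<le> x $ i + (h $ i + \<delta>)"
        "y $ i - h $ i \<le> y $ i + h $ i" for i
        using comp[of i] h(1) by (auto simp: less_eq_vec_def)
      then show "x - ?h \<le> y - h" "y - h \<le> y + h" "y + h \<le> x + ?h"
        by (simp_all add: less_eq_vec_def)
    qed
  qed
  then show ?thesis using assms(2) by (simp add: landscape_set_def \<delta>_def)
qed

text \<open>An \<open>\<epsilon>\<close> admissible at \<open>x\<close> either is at most the
  distance, and nonnegativity at \<open>y\<close> suffices, or stays admissible at \<open>y\<close>
  after subtracting the distance. Exchanging \<open>x\<close> and \<open>y\<close> gives the other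
  inequality.\<close>

lemma landscape_lipschitz_aux:
  assumes "parameters_in_cube T M" "x \<in> cube T" "y \<in> cube T" "T \<ge> 0"
  shows "landscape K M \<phi> x \<le> landscape K M \<phi> y + infnorm (x - y)"
proof (cases "landscape_set x = {}")
  case True
  then show ?thesis
    using landscape_bounds(1)[OF assms(1,3,4)] infnorm_pos_le[of "x - y"] by (simp add: landscape_eq[of x])
next
  case False
  have "\<epsilon> \<le> landscape K M \<phi> y + infnorm (x - y)" if e: "\<epsilon> \<in> landscape_set x" for \<epsilon>
  proof (cases "infnorm (x - y) < \<epsilon>")
    case True
    have "\<epsilon> - infnorm (x - y) \<le> Sup (landscape_set y)"
      using landscape_set_shift[OF e True] bdd_above_landscape_set[OF assms(1,3)] by (rule cSup_upper)
    then show ?thesis using landscape_set_shift[OF e True] by (auto simp: landscape_eq)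
  next
    case False
    then show ?thesis using landscape_bounds(1)[OF assms(1,3,4)] by simp
  qed
  then show ?thesis using False by (subst landscape_eq[of x]) (auto intro: cSup_least)
qed

end

lemma landscapes_bounds:
  assumes "f \<in> landscapes TYPE('v) K T" "T \<ge> 0" "x \<in> cube T"
  shows "0 \<le> f x" "f x \<le> T"
proof -
  obtain M \<phi> where M: "persistence_module K (M :: _ \<Rightarrow> (_, 'v) module) \<phi>" "parameters_in_cube T M"
    and f: "f = restrict (landscape K M \<phi>) (cube T)"
    using assms(1) by (auto simp: landscapes_def)
  show "0 \<le> f x" "f x \<le> T"
    using persistence_module.landscape_bounds[OF M assms(3,2)] assms(3) by (simp_all add: f)
qed

lemma landscapes_lipschitz:
  assumes "f \<in> landscapes TYPE('v) K T" "T \<ge> 0" "x \<in> cube T" "y \<in> cube T"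
  shows "\<bar>f x - f y\<bar> \<le> infnorm (x - y)"
proof -
  obtain M \<phi> where M: "persistence_module K (M :: _ \<Rightarrow> (_, 'v) module) \<phi>" "parameters_in_cube T M"
    and f: "f = restrict (landscape K M \<phi>) (cube T)"
    using assms(1) by (auto simp: landscapes_def)
  show ?thesis
    using persistence_module.landscape_lipschitz_aux[OF M assms(3,4,2)]
      persistence_module.landscape_lipschitz_aux[OF M assms(4,3,2)] assms(3,4)
    by (simp add: f infnorm_sub)
qed

section \<open>Chaining\<close>

text \<open>An integrable \<open>f\<close> is its own smallest majorant, so the infimum is
  attained.\<close>

lemma outer_expectation_integrable:
  assumes "integrable N f"
  shows "outer_expectation N f = integral\<^sup>L N f"
  unfolding outer_expectation_def
proof (rule cInf_eq_minimum)
  show "integral\<^sup>L N f \<in> {integral\<^sup>L N U | U. integrable N U \<and> (\<forall>\<omega>\<in>space N. f \<omega> \<le> U \<omega>)}"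
    using assms by auto
qed (use assms in \<open>auto intro!: integral_mono\<close>)

text \<open>If \<open>u > a\<close> then \<open>u / a > 1\<close>, so
  \<open>u \<le> a * (u / a) ^ p\<close>. The threshold \<open>a\<close> takes care of small
  increments, the power of large ones.\<close>

lemma le_add_power_divide:
  fixes u a :: real
  assumes "u \<ge> 0" "a > 0" "p > 0"
  shows "u \<le> a + u ^ p / a ^ (p - 1)"
proof (cases "u \<le> a")
  case True
  have "0 \<le> u ^ p / a ^ (p - 1)" using assms by simp
  then show ?thesis using True by linarith
next
  case False
  have "u * a ^ (p - 1) \<le> u * u ^ (p - 1)"
    using False assms by (intro mult_left_mono power_mono) auto
  also have "\<dots> = u ^ p" using assms(3) by (simp add: power_eq_if)
  finally have "u \<le> u ^ p / a ^ (p - 1)" using assms by (simp add: pos_le_divide_eq)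
  then show ?thesis using assms by linarith
qed

text \<open>
  An integrable majorant of the oscillation between two consecutive grids. It replaces a maximum
  over the finer grid by a sum of high powers.
\<close>

definition chain_bound :: "'d::finite itself \<Rightarrow> real \<Rightarrow> nat \<Rightarrow> (nat \<Rightarrow> real) \<Rightarrow> real" where
  "chain_bound _ T l w = (3 / 4) ^ l + (\<Sum>y\<in>(grid T (Suc l) :: (real ^ 'd) set).
    (w (dyadic_index T y) - w (dyadic_index T (grid_map T l y))) ^ (2 * CARD('d)) / ((3 / 4) ^ l) ^ (2 * CARD('d) - 1))"

lemma chain_bound_pos: "0 < chain_bound TYPE('d::finite) T l w"
  unfolding chain_bound_def by (intro add_pos_nonneg sum_nonneg) auto

text \<open>Both values at \<open>x\<close> are read at a grid point of level \<open>Suc l\<close>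
  and at its own rounding to level \<open>l\<close>, so their difference is one of the increments
  summed in \<open>chain_bound\<close>.\<close>

lemma stepfun_chain:
  fixes x :: "real ^ 'd"
  assumes "T > 0" "x \<in> cube T"
  shows "\<bar>stepfun T (Suc l) w x - stepfun T l w x\<bar> \<le> chain_bound TYPE('d) T l w"
proof -
  let ?y = "grid_map T (Suc l) x" and ?p = "2 * CARD('d)" and ?a = "(3 / 4 :: real) ^ l"
  let ?u = "\<lambda>y :: real ^ 'd. w (dyadic_index T y) - w (dyadic_index T (grid_map T l y))"
  have eq: "stepfun T (Suc l) w x - stepfun T l w x = ?u ?y"
    using assms by (simp add: stepfun_def grid_map_grid_map)
  have "\<bar>?u ?y\<bar> \<le> ?a + ?u ?y ^ ?p / ?a ^ (?p - 1)"
    using le_add_power_divide[of "\<bar>?u ?y\<bar>" ?a ?p] by (simp add: power_even_abs)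
  also have "?a + ?u ?y ^ ?p / ?a ^ (?p - 1) \<le> chain_bound TYPE('d) T l w"
    unfolding chain_bound_def
    using finite_card_grid(1)[OF assms(1)] grid_map_in_grid[OF assms(2)]
    by (intro add_left_mono member_le_sum[of ?y _ "\<lambda>y. ?u y ^ ?p / ?a ^ (?p - 1)"]) auto
  finally show ?thesis by (simp only: eq)
qed

text \<open>The moment condition of Kolmogorov's continuity criterion, restricted to dyadic points.
  In this form the criterion asks for an order above the dimension; \<open>2 * CARD('d)\<close> is
  also even, so the powers need no absolute value.\<close>

definition increment_moments :: "'d::finite itself \<Rightarrow> real \<Rightarrow> real \<Rightarrow> 'w measure \<Rightarrow> ('w \<Rightarrow> nat \<Rightarrow> real) \<Rightarrow> bool" where
  "increment_moments _ T C M W \<longleftrightarrow> (\<forall>x\<in>dyadic T. \<forall>y\<in>(dyadic T :: (real ^ 'd) set).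
    integrable M (\<lambda>\<omega>. (W \<omega> (dyadic_index T x) - W \<omega> (dyadic_index T y)) ^ (2 * CARD('d))) \<and>
    (\<integral>\<omega>. (W \<omega> (dyadic_index T x) - W \<omega> (dyadic_index T y)) ^ (2 * CARD('d)) \<partial>M) \<le> C * infnorm (x - y) ^ (2 * CARD('d)))"

lemma grid_in_dyadic: "x \<in> grid T k \<Longrightarrow> x \<in> dyadic T"
  by (auto simp: dyadic_def)

text \<open>Let \<open>a = (3/4)^l\<close> and let d be the dimension. There are at most
  \<open>2^((l+2) d)\<close> summands, each of expectation at most
  \<open>C (T / 2^l)^(2d) / a^(2d-1)\<close>; in total this is
  \<open>a C 4^d T^(2d) (8/9)^(l d)\<close>. The base \<open>8/9 = 2 * 1/4 * 16/9\<close> collects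
  the growth of the grid, the decay of the moments and the division by the threshold.\<close>

lemma (in prob_space) chain_bound_expectation:
  assumes "T > 0" "C \<ge> 0" and mom: "increment_moments TYPE('d::finite) T C M W"
  shows "integrable M (\<lambda>\<omega>. chain_bound TYPE('d) T l (W \<omega>))"
    and "(\<integral>\<omega>. chain_bound TYPE('d) T l (W \<omega>) \<partial>M) \<le> (1 + C * 4 ^ CARD('d) * T ^ (2 * CARD('d))) * (3 / 4) ^ l"
proof -
  let ?p = "2 * CARD('d)" and ?a = "(3 / 4 :: real) ^ l" and ?G = "grid T (Suc l) :: (real ^ 'd) set"
  let ?u = "\<lambda>(y :: real ^ 'd) \<omega>. W \<omega> (dyadic_index T y) - W \<omega> (dyadic_index T (grid_map T l y))"
  have y: "y \<in> dyadic T" "grid_map T l y \<in> dyadic T" if "y \<in> ?G" for y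
    using that grid_subset_cube[OF assms(1)] by (auto intro!: grid_in_dyadic grid_map_in_dyadic)
  have int: "integrable M (\<lambda>\<omega>. ?u y \<omega> ^ ?p)" if "y \<in> ?G" for y
    using mom y[OF that] unfolding increment_moments_def by blast
  have le: "(\<integral>\<omega>. ?u y \<omega> ^ ?p \<partial>M) \<le> C * (T / 2 ^ l) ^ ?p" if "y \<in> ?G" for y
  proof -
    have "(\<integral>\<omega>. ?u y \<omega> ^ ?p \<partial>M) \<le> C * infnorm (y - grid_map T l y) ^ ?p"
      using mom y[OF that] unfolding increment_moments_def by blast
    also have "\<dots> \<le> C * (T / 2 ^ l) ^ ?p"
      using assms infnorm_grid_map[OF assms(1)] by (intro mult_left_mono power_mono infnorm_pos_le)
    finally show ?thesis .
  qed
  show "integrable M (\<lambda>\<omega>. chain_bound TYPE('d) T l (W \<omega>))"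
    unfolding chain_bound_def using int by auto
  have "(\<integral>\<omega>. chain_bound TYPE('d) T l (W \<omega>) \<partial>M) = ?a + (\<Sum>y\<in>?G. (\<integral>\<omega>. ?u y \<omega> ^ ?p \<partial>M) / ?a ^ (?p - 1))"
    unfolding chain_bound_def using int by (simp add: prob_space)
  also have "\<dots> \<le> ?a + (\<Sum>y\<in>?G. C * (T / 2 ^ l) ^ ?p / ?a ^ (?p - 1))"
    using le by (intro add_left_mono sum_mono divide_right_mono) auto
  also have "(\<Sum>y\<in>?G. C * (T / 2 ^ l) ^ ?p / ?a ^ (?p - 1)) = card ?G * (C * (T / 2 ^ l) ^ ?p / ?a ^ (?p - 1))"
    by simp
  also have "\<dots> \<le> (2 ^ (l + 2)) ^ CARD('d) * (C * (T / 2 ^ l) ^ ?p / ?a ^ (?p - 1))"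
  proof (rule mult_right_mono)
    have "real (card ?G) \<le> real ((2 ^ Suc l + 1) ^ CARD('d))"
      using finite_card_grid(2)[OF assms(1), of "Suc l"] by (simp only: of_nat_le_iff)
    also have "\<dots> = (2 ^ Suc l + 1) ^ CARD('d)" by (simp add: add.commute)
    also have "\<dots> \<le> (2 ^ (l + 2)) ^ CARD('d)"
    proof (rule power_mono)
      have "1 \<le> (2 :: real) ^ l" by simp
      then show "(2 :: real) ^ Suc l + 1 \<le> 2 ^ (l + 2)" by (simp del: one_le_power)
    qed simp
    finally show "real (card ?G) \<le> (2 ^ (l + 2)) ^ CARD('d)" .
  qed (use assms in simp)
  also have "\<dots> = ?a * (C * 4 ^ CARD('d) * T ^ ?p) * ((8 / 9) ^ l) ^ CARD('d)"
  proof -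
    have sq: "(b ^ l) ^ ?p = ((b\<^sup>2) ^ l) ^ CARD('d)" for b :: real
      by (simp only: power_mult[symmetric] mult_ac)
    have e1: "(2 ^ (l + 2)) ^ CARD('d) = 4 ^ CARD('d) * ((2 :: real) ^ l) ^ CARD('d)"
      by (simp add: power_add power_mult_distrib mult.commute)
    have e2: "(T / 2 ^ l) ^ ?p = T ^ ?p * (((1 / 4) ^ l) ^ CARD('d))"
    proof -
      have "((2 :: real) ^ l) ^ ?p = (4 ^ l) ^ CARD('d)"
        using sq[of 2] by simp
      then show ?thesis by (simp add: power_divide)
    qed
    have e3: "b / ?a ^ (?p - 1) = b * (?a * ((16 / 9) ^ l) ^ CARD('d))" for b
    proof -
      have "?a ^ (?p - 1) * ?a = ?a ^ ?p"
        using zero_less_card_finite[where 'a = 'd] by (simp add: power_eq_if)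
      also have "\<dots> = ((9 / 16) ^ l) ^ CARD('d)"
        using sq[of "3 / 4"] by (simp add: power_divide)
      finally have "?a ^ (?p - 1) * (?a * ((16 / 9) ^ l) ^ CARD('d)) = (((9 / 16) * (16 / 9)) ^ l) ^ CARD('d)"
        by (simp only: power_mult_distrib mult.assoc[symmetric])
      then have "1 / ?a ^ (?p - 1) = ?a * ((16 / 9) ^ l) ^ CARD('d)"
        by (simp add: divide_eq_eq mult.commute)
      then show ?thesis by (metis mult.right_neutral times_divide_eq_right)
    qed
    have e4: "((8 / 9) ^ l) ^ CARD('d) = (2 ^ l) ^ CARD('d) * ((1 / 4) ^ l) ^ CARD('d) * ((16 / 9 :: real) ^ l) ^ CARD('d)"
      by (simp add: power_mult_distrib[symmetric])
    show ?thesis by (simp only: e1 e2 e3 e4) (simp only: mult_ac)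
  qed
  also have "?a * (C * 4 ^ CARD('d) * T ^ ?p) * ((8 / 9) ^ l) ^ CARD('d) \<le> ?a * (C * 4 ^ CARD('d) * T ^ ?p) * 1"
  proof (rule mult_left_mono)
    have "(8 / 9 :: real) ^ l \<le> 1" by (rule power_le_one) auto
    then show "((8 / 9 :: real) ^ l) ^ CARD('d) \<le> 1" by (rule power_le_one[rotated]) simp
    show "0 \<le> ?a * (C * 4 ^ CARD('d) * T ^ ?p)" using assms by simp
  qed
  finally show "(\<integral>\<omega>. chain_bound TYPE('d) T l (W \<omega>) \<partial>M) \<le> (1 + C * 4 ^ CARD('d) * T ^ (2 * CARD('d))) * (3 / 4) ^ l"
    by (simp only: distrib_right mult_1_left mult_1_right mult.commute[of ?a] add_left_mono)
qed

definition chain_const :: "'d::finite itself \<Rightarrow> real \<Rightarrow> real \<Rightarrow> real" where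
  "chain_const _ T C = 1 + C * 4 ^ CARD('d) * T ^ (2 * CARD('d))"

lemma (in prob_space) chaining_step:
  fixes g :: "(real ^ 'd \<Rightarrow> real) \<Rightarrow> real"
  assumes "T > 0" "C \<ge> 0" "increment_moments TYPE('d) T C M W"
    and W: "\<And>j. (\<lambda>\<omega>. W \<omega> j) \<in> borel_measurable M"
    and g: "lipschitz_linf L (cube T) g" "\<And>f. f \<in> linf (cube T) \<Longrightarrow> \<bar>g f\<bar> \<le> B"
  shows "\<bar>(\<integral>\<omega>. g (stepfun T (Suc l) (W \<omega>)) \<partial>M) - (\<integral>\<omega>. g (stepfun T l (W \<omega>)) \<partial>M)\<bar>
    \<le> L * chain_const TYPE('d) T C * (3 / 4) ^ l"
proof -
  have int: "integrable M (\<lambda>\<omega>. g (stepfun T k (W \<omega>)))" for k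
  proof (rule integrable_const_bound[of _ B])
    show "(\<lambda>\<omega>. g (stepfun T k (W \<omega>))) \<in> borel_measurable M"
      by (rule measurable_finite_lipschitz[OF lipschitz_linf_stepfun[OF assms(1) g(1)] W])
  qed (use g(2) stepfun_in_linf[OF assms(1)] in auto)
  note cb = chain_bound_expectation[OF assms(1-3), of l]
  have "(\<integral>\<omega>. g (stepfun T (Suc l) (W \<omega>)) \<partial>M) - (\<integral>\<omega>. g (stepfun T l (W \<omega>)) \<partial>M)
    = (\<integral>\<omega>. g (stepfun T (Suc l) (W \<omega>)) - g (stepfun T l (W \<omega>)) \<partial>M)"
    using int by simp
  also have "\<bar>\<dots>\<bar> \<le> (\<integral>\<omega>. L * chain_bound TYPE('d) T l (W \<omega>) \<partial>M)"
  proof (rule abs_integral_le_integral)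
    fix \<omega>
    have "\<bar>g (stepfun T (Suc l) (W \<omega>)) - g (stepfun T l (W \<omega>))\<bar>
      \<le> L * linf_dist (cube T :: (real ^ 'd) set) (stepfun T (Suc l) (W \<omega>)) (stepfun T l (W \<omega>))"
      by (intro lipschitz_linfD(2)[OF g(1)] stepfun_in_linf assms(1))
    also have "\<dots> \<le> L * chain_bound TYPE('d) T l (W \<omega>)"
      by (intro mult_left_mono linf_dist_le cube_nonempty stepfun_in_linf stepfun_chain assms(1) lipschitz_linfD(1)[OF g(1)])
    finally show "\<bar>g (stepfun T (Suc l) (W \<omega>)) - g (stepfun T l (W \<omega>))\<bar> \<le> L * chain_bound TYPE('d) T l (W \<omega>)" .
  qed (use int cb in auto)
  also have "\<dots> \<le> L * ((1 + C * 4 ^ CARD('d) * T ^ (2 * CARD('d))) * (3 / 4) ^ l)"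
    using cb lipschitz_linfD(1)[OF g(1)] by (simp add: mult_left_mono)
  finally show ?thesis by (simp add: chain_const_def mult_ac)
qed

text \<open>The one-level errors form a geometric series with tail \<open>4 * (3/4)^k\<close>;
  dominated convergence along the step functions of a regulated path then replaces the finest level
  by the path itself.\<close>

lemma (in prob_space) chaining_expectation:
  fixes g :: "(real ^ 'd \<Rightarrow> real) \<Rightarrow> real"
  assumes "T > 0" "C \<ge> 0" "increment_moments TYPE('d) T C M (\<lambda>\<omega>. sample T (Y \<omega>))"
    and Y: "\<And>x. x \<in> cube T \<Longrightarrow> (\<lambda>\<omega>. Y \<omega> x) \<in> borel_measurable M"
    and reg: "\<And>\<omega>. \<omega> \<in> space M \<Longrightarrow> Y \<omega> \<in> regulated T"
    and g: "lipschitz_linf L (cube T) g" "\<And>f. f \<in> linf (cube T) \<Longrightarrow> \<bar>g f\<bar> \<le> B"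
  shows "\<bar>(\<integral>\<omega>. g (Y \<omega>) \<partial>M) - (\<integral>\<omega>. g (stepfun T k (sample T (Y \<omega>))) \<partial>M)\<bar>
    \<le> 4 * L * chain_const TYPE('d) T C * (3 / 4) ^ k"
proof -
  let ?E = "\<lambda>k. \<integral>\<omega>. g (stepfun T k (sample T (Y \<omega>))) \<partial>M" and ?c = "L * chain_const TYPE('d) T C"
  have c: "0 \<le> ?c" using assms(1,2) lipschitz_linfD(1)[OF g(1)] by (simp add: chain_const_def)
  have W: "(\<lambda>\<omega>. sample T (Y \<omega>) j) \<in> borel_measurable M" for j
    by (simp add: sample_def Y dyadic_point_in_cube assms(1))
  \<comment> \<open>The right-hand side is the exact partial sum of the geometric series, which lets
    the induction close.\<close>
  have "\<bar>?E (m + k) - ?E k\<bar> \<le> 4 * ?c * ((3 / 4) ^ k - (3 / 4) ^ (m + k))" for m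
  proof (induction m)
    case (Suc m)
    have "\<bar>?E (Suc (m + k)) - ?E (m + k)\<bar> \<le> ?c * (3 / 4) ^ (m + k)"
      by (rule chaining_step[OF assms(1-3) W g])
    also have "\<dots> = 4 * ?c * ((3 / 4) ^ (m + k) - (3 / 4) ^ (Suc m + k))" by simp
    finally show ?case using Suc.IH by (simp add: right_diff_distrib)
  qed simp
  moreover have "4 * ?c * ((3 / 4) ^ k - (3 / 4) ^ (m + k)) \<le> 4 * ?c * (3 / 4) ^ k" for m
    using c by (intro mult_left_mono) auto
  ultimately have bound: "\<bar>?E (m + k) - ?E k\<bar> \<le> 4 * ?c * (3 / 4) ^ k" for m by (rule order_trans)
  have "(\<lambda>m. ?E m) \<longlonglongrightarrow> (\<integral>\<omega>. g (Y \<omega>) \<partial>M)"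
  proof (rule integral_dominated_convergence[where w = "\<lambda>_. B"])
    show "(\<lambda>\<omega>. g (Y \<omega>)) \<in> borel_measurable M"
      by (rule measurable_lipschitz_regulated[OF assms(1) g(1) Y reg])
    show "(\<lambda>\<omega>. g (stepfun T m (sample T (Y \<omega>)))) \<in> borel_measurable M" for m
      by (rule measurable_lipschitz_stepfun[OF assms(1) g(1) Y])
    show "AE \<omega> in M. (\<lambda>m. g (stepfun T m (sample T (Y \<omega>)))) \<longlonglongrightarrow> g (Y \<omega>)"
      using reg by (intro AE_I2 lipschitz_linf_tendsto[OF assms(1) g(1)])
    show "AE \<omega> in M. norm (g (stepfun T m (sample T (Y \<omega>)))) \<le> B" for m
      using g(2) stepfun_in_linf[OF assms(1)] by (intro AE_I2) auto
  qed simp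
  then have "(\<lambda>m. ?E (m + k)) \<longlonglongrightarrow> (\<integral>\<omega>. g (Y \<omega>) \<partial>M)" by (rule LIMSEQ_ignore_initial_segment)
  then have "(\<lambda>m. \<bar>?E (m + k) - ?E k\<bar>) \<longlonglongrightarrow> \<bar>(\<integral>\<omega>. g (Y \<omega>) \<partial>M) - ?E k\<bar>" by (intro tendsto_intros)
  then have "\<bar>(\<integral>\<omega>. g (Y \<omega>) \<partial>M) - ?E k\<bar> \<le> 4 * ?c * (3 / 4) ^ k"
    by (rule Lim_bounded) (use bound in auto)
  then show ?thesis by (simp add: mult_ac)
qed

text \<open>The level \<open>k\<close> is fixed first, with an error common to all
  \<open>Y n\<close> and to \<open>Z\<close>. At that level the functional depends on finitely many
  values, and \<open>levy_continuity_finite_lipschitz\<close> supplies the limit in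
  \<open>n\<close>.\<close>

theorem lipschitz_functional_convergence:
  fixes g :: "(real ^ 'd \<Rightarrow> real) \<Rightarrow> real" and Y :: "nat \<Rightarrow> 'w \<Rightarrow> real ^ 'd \<Rightarrow> real" and Z :: "'u \<Rightarrow> real ^ 'd \<Rightarrow> real"
  assumes "T > 0" "C \<ge> 0" and M: "prob_space M" and N: "prob_space N"
    and Ymom: "\<And>n. increment_moments TYPE('d) T C M (\<lambda>\<omega>. sample T (Y n \<omega>))"
    and Y: "\<And>n x. x \<in> cube T \<Longrightarrow> (\<lambda>\<omega>. Y n \<omega> x) \<in> borel_measurable M"
    and Yreg: "\<And>n \<omega>. \<omega> \<in> space M \<Longrightarrow> Y n \<omega> \<in> regulated T"
    and Zmom: "increment_moments TYPE('d) T C N (\<lambda>\<omega>. sample T (Z \<omega>))"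
    and Z: "\<And>x. x \<in> cube T \<Longrightarrow> (\<lambda>\<omega>. Z \<omega> x) \<in> borel_measurable N"
    and Zreg: "\<And>\<omega>. \<omega> \<in> space N \<Longrightarrow> Z \<omega> \<in> regulated T"
    and conv: "\<And>I t. finite I \<Longrightarrow> (\<lambda>n. CLINT \<omega>|M. iexp (\<Sum>i\<in>I. t i * sample T (Y n \<omega>) i))
      \<longlonglongrightarrow> (CLINT \<omega>|N. iexp (\<Sum>i\<in>I. t i * sample T (Z \<omega>) i))"
    and g: "lipschitz_linf L (cube T) g" "\<And>f. f \<in> linf (cube T) \<Longrightarrow> \<bar>g f\<bar> \<le> B"
  shows "(\<lambda>n. \<integral>\<omega>. g (Y n \<omega>) \<partial>M) \<longlonglongrightarrow> (\<integral>\<omega>. g (Z \<omega>) \<partial>N)"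
proof (rule LIMSEQ_I)
  fix r :: real assume "r > 0"
  let ?c = "4 * L * chain_const TYPE('d) T C"
  have "(\<lambda>k. ?c * (3 / 4) ^ k) \<longlonglongrightarrow> 0" by (intro tendsto_mult_right_zero LIMSEQ_realpow_zero) auto
  then have "\<forall>\<^sub>F k in sequentially. ?c * (3 / 4) ^ k < r / 3"
    using \<open>r > 0\<close> by (intro order_tendstoD(2)) auto
  then obtain k where k: "?c * (3 / 4) ^ k < r / 3" by (auto simp: eventually_sequentially)
  have fin: "finite (grid_index TYPE('d) T k)" by (intro finite_imageI finite_card_grid(1) assms(1))
  have "(\<lambda>n. \<integral>\<omega>. g (stepfun T k (sample T (Y n \<omega>))) \<partial>M) \<longlonglongrightarrow> (\<integral>\<omega>. g (stepfun T k (sample T (Z \<omega>))) \<partial>N)"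
  proof (rule levy_continuity_finite_lipschitz[OF M N fin lipschitz_linfD(1)[OF g(1)] _ _ conv[OF fin] lipschitz_linf_stepfun[OF assms(1) g(1)]])
    show "(\<lambda>\<omega>. sample T (Y n \<omega>) i) \<in> borel_measurable M" for n i
      by (simp add: sample_def Y dyadic_point_in_cube assms(1))
    show "(\<lambda>\<omega>. sample T (Z \<omega>) i) \<in> borel_measurable N" for i
      by (simp add: sample_def Z dyadic_point_in_cube assms(1))
    show "\<bar>g (stepfun T k u)\<bar> \<le> B" for u by (intro g(2) stepfun_in_linf assms(1))
  qed
  from LIMSEQ_D[OF this, of "r / 3"] \<open>r > 0\<close> obtain n0 where n0: "\<And>n. n \<ge> n0 \<Longrightarrow>
    \<bar>(\<integral>\<omega>. g (stepfun T k (sample T (Y n \<omega>))) \<partial>M) - (\<integral>\<omega>. g (stepfun T k (sample T (Z \<omega>))) \<partial>N)\<bar> < r / 3" by auto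
  show "\<exists>no. \<forall>n\<ge>no. norm ((\<integral>\<omega>. g (Y n \<omega>) \<partial>M) - (\<integral>\<omega>. g (Z \<omega>) \<partial>N)) < r"
  proof (intro exI[of _ n0] allI impI)
    fix n assume "n \<ge> n0"
    have "\<bar>(\<integral>\<omega>. g (Y n \<omega>) \<partial>M) - (\<integral>\<omega>. g (stepfun T k (sample T (Y n \<omega>))) \<partial>M)\<bar> \<le> ?c * (3 / 4) ^ k"
      by (rule prob_space.chaining_expectation[OF M assms(1,2) Ymom Y Yreg g])
    moreover have "\<bar>(\<integral>\<omega>. g (Z \<omega>) \<partial>N) - (\<integral>\<omega>. g (stepfun T k (sample T (Z \<omega>))) \<partial>N)\<bar> \<le> ?c * (3 / 4) ^ k"
      by (rule prob_space.chaining_expectation[OF N assms(1,2) Zmom Z Zreg g])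
    ultimately show "norm ((\<integral>\<omega>. g (Y n \<omega>) \<partial>M) - (\<integral>\<omega>. g (Z \<omega>) \<partial>N)) < r"
      using n0[OF \<open>n \<ge> n0\<close>] k unfolding real_norm_def by linarith
  qed
qed

section \<open>Gaussian sequences\<close>

lemma char_finite_linear_std_normal:
  fixes b :: "nat \<Rightarrow> real"
  shows "(CLINT \<omega>|PiM UNIV (\<lambda>_. std_normal_distribution). iexp (\<Sum>m<n. b m * \<omega> m))
    = complex_of_real (exp (- (\<Sum>m<n. (b m)\<^sup>2) / 2))"
proof -
  interpret S: real_distribution std_normal_distribution by (rule real_dist_normal_dist)
  interpret product_prob_space "\<lambda>_ :: nat. std_normal_distribution" UNIV ..
  let ?J = "{..<n}"
  let ?\<gamma> = "PiM UNIV (\<lambda>_. std_normal_distribution) :: (nat \<Rightarrow> real) measure"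
  let ?\<gamma>J = "PiM ?J (\<lambda>_. std_normal_distribution)"
  have [measurable]: "(\<lambda>s. s i) \<in> borel_measurable ?\<gamma>J" if "i \<in> ?J" for i
    using measurable_component_singleton[OF that, of "\<lambda>_. std_normal_distribution"] by simp
  have f: "(\<lambda>\<omega>. iexp (\<Sum>m<n. b m * \<omega> m)) \<in> borel_measurable ?\<gamma>J" by measurable
  have r: "(\<lambda>x. restrict x ?J) \<in> measurable ?\<gamma> ?\<gamma>J" by (rule measurable_restrict_subset) simp
  have "(CLINT \<omega>|?\<gamma>. iexp (\<Sum>m<n. b m * \<omega> m)) = (CLINT \<omega>|distr ?\<gamma> ?\<gamma>J (\<lambda>x. restrict x ?J). iexp (\<Sum>m<n. b m * \<omega> m))"
    by (subst integral_distr[OF r f]) simp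
  also have "\<dots> = (CLINT \<omega>|?\<gamma>J. iexp (\<Sum>m<n. b m * \<omega> m))"
    by (subst distr_PiM_restrict_finite) auto
  also have "\<dots> = (CLINT \<omega>|?\<gamma>J. (\<Prod>m<n. iexp (b m * \<omega> m)))"
    by (simp add: sum_distrib_left exp_sum)
  also have "\<dots> = (\<Prod>m<n. CLINT s|std_normal_distribution. iexp (b m * s))"
    by (intro product_integral_prod S.integrable_iexp_real) auto
  also have "\<dots> = (\<Prod>m<n. complex_of_real (exp (- (b m)\<^sup>2 / 2)))"
    using fun_cong[OF char_std_normal_distribution] unfolding char_def by simp
  also have "\<dots> = complex_of_real (exp (- (\<Sum>m<n. (b m)\<^sup>2) / 2))"
    by (simp add: exp_sum[symmetric] sum_negf sum_divide_distrib flip: of_real_prod)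
  finally show ?thesis .
qed

text \<open>Joint characteristic functions cover degenerate laws and pass to pointwise limits by
  dominated convergence. The points are given as a sequence with repetitions allowed, because
  distinct points of the cube may round to the same grid point.\<close>

definition gaussian_field :: "'w measure \<Rightarrow> ('w \<Rightarrow> 'p \<Rightarrow> real) \<Rightarrow> 'p set \<Rightarrow> ('p \<Rightarrow> 'p \<Rightarrow> real) \<Rightarrow> bool" where
  "gaussian_field M V A \<kappa> \<longleftrightarrow> (\<forall>p\<in>A. (\<lambda>\<omega>. V \<omega> p) \<in> borel_measurable M) \<and>
    (\<forall>(n :: nat) c x. (\<forall>i<n. x i \<in> A) \<longrightarrow> (CLINT \<omega>|M. iexp (\<Sum>i<n. c i * V \<omega> (x i)))
      = complex_of_real (exp (- (\<Sum>i<n. \<Sum>j<n. c i * c j * \<kappa> (x i) (x j)) / 2)))"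

lemma gaussian_fieldD:
  fixes n :: nat
  assumes "gaussian_field M V A \<kappa>"
  shows "p \<in> A \<Longrightarrow> (\<lambda>\<omega>. V \<omega> p) \<in> borel_measurable M"
    and "(\<And>i. i < n \<Longrightarrow> x i \<in> A) \<Longrightarrow> (CLINT \<omega>|M. iexp (\<Sum>i<n. c i * V \<omega> (x i)))
      = complex_of_real (exp (- (\<Sum>i<n. \<Sum>j<n. c i * c j * \<kappa> (x i) (x j)) / 2))"
proof -
  show "p \<in> A \<Longrightarrow> (\<lambda>\<omega>. V \<omega> p) \<in> borel_measurable M"
    using assms by (simp add: gaussian_field_def)
qed (rule assms[unfolded gaussian_field_def, THEN conjunct2, rule_format])

lemma gaussian_sequence:
  assumes "psd \<kappa>"
  obtains W where "gaussian_field (PiM (UNIV :: nat set) (\<lambda>_. std_normal_distribution)) W UNIV \<kappa>"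
proof -
  obtain a :: "nat \<Rightarrow> nat \<Rightarrow> real" where a0: "\<And>i m. i < m \<Longrightarrow> a i m = 0"
    and a: "\<And>i j n. i < n \<Longrightarrow> j < n \<Longrightarrow> \<kappa> i j = (\<Sum>m<n. a i m * a j m)"
    using psd_cholesky[OF assms] by blast
  define W where "W \<omega> j = (\<Sum>m<Suc j. a j m * \<omega> m)" for \<omega> :: "nat \<Rightarrow> real" and j
  let ?\<gamma> = "PiM UNIV (\<lambda>_. std_normal_distribution) :: (nat \<Rightarrow> real) measure"
  have [measurable]: "(\<lambda>s. s i) \<in> borel_measurable ?\<gamma>" for i
    using measurable_component_singleton[of i UNIV "\<lambda>_. std_normal_distribution"] by simp
  have "(CLINT \<omega>|?\<gamma>. iexp (\<Sum>i<n. c i * W \<omega> (x i)))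
      = complex_of_real (exp (- (\<Sum>i<n. \<Sum>j<n. c i * c j * \<kappa> (x i) (x j)) / 2))" for n :: nat and c x
  proof -
    \<comment> \<open>A common bound on the indices: all the \<open>W \<omega> (x i)\<close> become
      linear combinations of the same \<open>N\<close> independent normals.\<close>
    define N where "N = Suc (Max (x ` {..<n}))"
    have N: "x i < N" if "i < n" for i using that by (auto simp: N_def less_Suc_eq_le intro!: Max_ge)
    define b where "b m = (\<Sum>i<n. c i * a (x i) m)" for m
    have "W \<omega> (x i) = (\<Sum>m<N. a (x i) m * \<omega> m)" if "i < n" for \<omega> i
      unfolding W_def using N[OF that] a0 by (intro sum.mono_neutral_left) auto
    then have "(\<Sum>i<n. c i * W \<omega> (x i)) = (\<Sum>i<n. \<Sum>m<N. c i * a (x i) m * \<omega> m)" for \<omega>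
      by (simp add: sum_distrib_left mult.assoc)
    also have "(\<Sum>i<n. \<Sum>m<N. c i * a (x i) m * \<omega> m) = (\<Sum>m<N. b m * \<omega> m)" for \<omega>
      unfolding b_def sum_distrib_right by (rule sum.swap)
    finally have lin: "(\<Sum>i<n. c i * W \<omega> (x i)) = (\<Sum>m<N. b m * \<omega> m)" for \<omega> .
    have "(\<Sum>i<n. \<Sum>j<n. c i * c j * \<kappa> (x i) (x j))
        = (\<Sum>i<n. \<Sum>j<n. \<Sum>m<N. (c i * a (x i) m) * (c j * a (x j) m))"
      using N by (intro sum.cong refl) (simp add: a[of _ N] sum_distrib_left mult_ac)
    also have "\<dots> = (\<Sum>i<n. \<Sum>m<N. \<Sum>j<n. (c i * a (x i) m) * (c j * a (x j) m))"
      by (intro sum.cong refl sum.swap)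
    also have "\<dots> = (\<Sum>m<N. \<Sum>i<n. \<Sum>j<n. (c i * a (x i) m) * (c j * a (x j) m))"
      by (rule sum.swap)
    also have "\<dots> = (\<Sum>m<N. (b m)\<^sup>2)"
      by (simp add: b_def power2_eq_square sum_product)
    finally show ?thesis
      unfolding lin by (simp only: char_finite_linear_std_normal)
  qed
  moreover have "(\<lambda>\<omega>. W \<omega> j) \<in> borel_measurable ?\<gamma>" for j
    unfolding W_def by measurable
  ultimately have "gaussian_field ?\<gamma> W UNIV \<kappa>"
    by (simp add: gaussian_field_def)
  then show thesis by (rule that)
qed

section \<open>Laws and moments of linear combinations in a Gaussian field\<close>

lemma normal_law_scaled_std_normal:
  "normal_law (distr std_normal_distribution borel (\<lambda>z. \<sigma> * z))" if "\<sigma> \<ge> 0"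
proof (cases "\<sigma> = 0")
  interpret S: real_distribution std_normal_distribution by (rule real_dist_normal_dist)
  case True
  have "distr std_normal_distribution borel (\<lambda>z. 0 :: real) = return borel 0"
  proof (rule measure_eqI)
    fix A assume "A \<in> sets (distr std_normal_distribution borel (\<lambda>z. 0 :: real))"
    then show "emeasure (distr std_normal_distribution borel (\<lambda>z. 0 :: real)) A = emeasure (return borel 0) A"
      using S.emeasure_space_1 by (subst emeasure_distr) (auto split: split_indicator)
  qed simp
  with True show ?thesis by (auto simp: normal_law_def)
next
  interpret S: real_distribution std_normal_distribution by (rule real_dist_normal_dist)
  case False
  with that have pos: "\<sigma> > 0" by simp
  have "distributed std_normal_distribution lborel (\<lambda>z. z) std_normal_density"
    by (auto simp: distributed_def distr_id2)
  then have "distributed std_normal_distribution lborel (\<lambda>z. (\<sigma> * z - 0) / \<sigma>) std_normal_density"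
    using pos by simp
  then have "distributed std_normal_distribution lborel (\<lambda>z. \<sigma> * z) (normal_density 0 \<sigma>)"
    using S.normal_standard_normal_convert[OF pos, of "\<lambda>z. \<sigma> * z" 0] by simp
  then have "distr std_normal_distribution lborel (\<lambda>z. \<sigma> * z) = density lborel (normal_density 0 \<sigma>)"
    by (simp add: distributed_def)
  then show ?thesis
    using pos by (auto simp: normal_law_def cong: distr_cong)
qed

lemma (in prob_space) distr_eq_scaled_std_normal:
  assumes X[measurable]: "X \<in> borel_measurable M" and "\<sigma> \<ge> 0"
    and char: "\<And>t. (CLINT \<omega>|M. iexp (t * X \<omega>)) = complex_of_real (exp (- (t\<^sup>2 * \<sigma>\<^sup>2) / 2))"
  shows "distr M borel X = distr std_normal_distribution borel (\<lambda>z. \<sigma> * z)"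
proof (rule Levy_uniqueness)
  interpret S: real_distribution std_normal_distribution by (rule real_dist_normal_dist)
  show "real_distribution (distr M borel X)" by (rule real_distribution_distr) measurable
  show "real_distribution (distr std_normal_distribution borel (\<lambda>z. \<sigma> * z))"
    by (rule S.real_distribution_distr) measurable
  show "char (distr M borel X) = char (distr std_normal_distribution borel (\<lambda>z. \<sigma> * z))"
  proof
    fix t
    have "char (distr M borel X) t = complex_of_real (exp (- (t * \<sigma>)\<^sup>2 / 2))"
      unfolding char_def by (subst integral_distr) (use char[of t] in \<open>simp_all add: power_mult_distrib\<close>)
    also have "\<dots> = char std_normal_distribution (t * \<sigma>)"
      by (simp add: char_std_normal_distribution)
    also have "\<dots> = char (distr std_normal_distribution borel (\<lambda>z. \<sigma> * z)) t"
      unfolding char_def by (subst integral_distr) (auto simp: mult.assoc)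
    finally show "char (distr M borel X) t = char (distr std_normal_distribution borel (\<lambda>z. \<sigma> * z)) t" .
  qed
qed

lemma (in prob_space) scaled_std_normal_moments:
  assumes X[measurable]: "X \<in> borel_measurable M" and "\<sigma> \<ge> 0"
    and distr: "distr M borel X = distr std_normal_distribution borel (\<lambda>z. \<sigma> * z)"
  shows "integrable M (\<lambda>\<omega>. X \<omega> ^ k)" and "expectation X = 0" and "expectation (\<lambda>\<omega>. (X \<omega>)\<^sup>2) = \<sigma>\<^sup>2"
    and "expectation (\<lambda>\<omega>. X \<omega> ^ (2 * k)) \<le> fact (2 * k) * (\<sigma>\<^sup>2) ^ k"
proof -
  have int: "integrable M (\<lambda>\<omega>. X \<omega> ^ m)" for m
  proof -
    have "integrable (distr std_normal_distribution borel (\<lambda>z. \<sigma> * z)) (\<lambda>x. x ^ m)"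
      using integrable_std_normal_distribution_moment[of m]
      by (subst integrable_distr_eq) (auto simp: power_mult_distrib)
    then show ?thesis unfolding distr[symmetric] by (subst (asm) integrable_distr_eq) auto
  qed
  have mom: "expectation (\<lambda>\<omega>. X \<omega> ^ m) = \<sigma> ^ m * (\<integral>z. z ^ m \<partial>std_normal_distribution)" for m
  proof -
    have "expectation (\<lambda>\<omega>. X \<omega> ^ m) = (\<integral>x. x ^ m \<partial>distr M borel X)"
      by (subst integral_distr) auto
    also have "\<dots> = (\<integral>z. (\<sigma> * z) ^ m \<partial>std_normal_distribution)"
      unfolding distr by (subst integral_distr) auto
    finally show ?thesis by (simp add: power_mult_distrib)
  qed
  show "integrable M (\<lambda>\<omega>. X \<omega> ^ k)" by (rule int)
  show "expectation X = 0"
    using mom[of 1] integral_std_normal_distribution_moment_odd[of 1] by simp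
  show "expectation (\<lambda>\<omega>. (X \<omega>)\<^sup>2) = \<sigma>\<^sup>2"
    using mom[of 2] std_normal_distribution_even_moments[of 1] by simp
  have "(\<integral>z. z ^ (2 * k) \<partial>std_normal_distribution) = fact (2 * k) / (2 ^ k * fact k)"
    by (rule std_normal_distribution_even_moments)
  \<comment> \<open>The exact moment has the denominator \<open>2 ^ k * fact k\<close>; replacing it
    by 1 leaves the simpler constant used in the increment condition.\<close>
  also have "\<dots> \<le> fact (2 * k) / 1"
    using mult_mono[of 1 "2 ^ k" 1 "fact k :: real"] by (intro divide_left_mono) auto
  finally have "\<sigma> ^ (2 * k) * (\<integral>z. z ^ (2 * k) \<partial>std_normal_distribution) \<le> \<sigma> ^ (2 * k) * fact (2 * k)"
    using \<open>\<sigma> \<ge> 0\<close> by (intro mult_left_mono) auto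
  then show "expectation (\<lambda>\<omega>. X \<omega> ^ (2 * k)) \<le> fact (2 * k) * (\<sigma>\<^sup>2) ^ k"
    by (simp only: mom power_mult[symmetric] mult.commute)
qed

lemma (in prob_space) gaussian_field_linear:
  fixes c :: "nat \<Rightarrow> real"
  assumes V: "gaussian_field M V A \<kappa>" and x: "\<And>i. i < n \<Longrightarrow> x i \<in> A"
  defines "X \<equiv> \<lambda>\<omega>. \<Sum>i<n. c i * V \<omega> (x i)"
    and "s \<equiv> \<Sum>i<n. \<Sum>j<n. c i * c j * \<kappa> (x i) (x j)"
  shows "X \<in> borel_measurable M" and "0 \<le> s"
    and "distr M borel X = distr std_normal_distribution borel (\<lambda>z. sqrt s * z)"
proof -
  have [measurable]: "(\<lambda>\<omega>. V \<omega> (x i)) \<in> borel_measurable M" if "i < n" for i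
    using V x[OF that] by (simp add: gaussian_field_def)
  show X[measurable]: "X \<in> borel_measurable M" unfolding X_def by measurable
  have char: "(CLINT \<omega>|M. iexp (t * X \<omega>)) = complex_of_real (exp (- (t\<^sup>2 * s) / 2))" for t
  proof -
    have "(CLINT \<omega>|M. iexp (\<Sum>i<n. (t * c i) * V \<omega> (x i)))
      = complex_of_real (exp (- (\<Sum>i<n. \<Sum>j<n. (t * c i) * (t * c j) * \<kappa> (x i) (x j)) / 2))"
      by (rule gaussian_fieldD(2)[OF V x])
    moreover have "(\<Sum>i<n. (t * c i) * V \<omega> (x i)) = t * X \<omega>" for \<omega>
      by (simp add: X_def sum_distrib_left mult.assoc)
    moreover have "(\<Sum>i<n. \<Sum>j<n. (t * c i) * (t * c j) * \<kappa> (x i) (x j)) = t\<^sup>2 * s"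
      by (simp add: s_def sum_distrib_left power2_eq_square mult_ac)
    ultimately show ?thesis by (simp only:)
  qed
  \<comment> \<open>Nonnegativity of the variance is read off the characteristic function, whose
    modulus \<open>exp (- s / 2)\<close> is at most 1.\<close>
  have "norm (CLINT \<omega>|M. iexp (1 * X \<omega>)) \<le> (\<integral>\<omega>. norm (iexp (1 * X \<omega>)) \<partial>M)"
    by (rule integral_norm_bound)
  also have "\<dots> = 1" by (simp only: norm_exp_i_times) (simp add: prob_space)
  finally show s: "0 \<le> s" unfolding char by simp
  show "distr M borel X = distr std_normal_distribution borel (\<lambda>z. sqrt s * z)"
    using s char by (intro distr_eq_scaled_std_normal) auto
qed

text \<open>The coefficients 1 and -1 yield increments, 1 and 1 yield the sum needed for
  polarisation, and 1 and 0 with \<open>p = q\<close> a single variable.\<close>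

lemma (in prob_space) gaussian_field_linear2:
  fixes a b :: real
  assumes V: "gaussian_field M V A \<kappa>" and "p \<in> A" "q \<in> A" and sym: "\<kappa> p q = \<kappa> q p"
  shows "integrable M (\<lambda>\<omega>. (a * V \<omega> p + b * V \<omega> q) ^ k)"
    and "expectation (\<lambda>\<omega>. a * V \<omega> p + b * V \<omega> q) = 0"
    and "expectation (\<lambda>\<omega>. (a * V \<omega> p + b * V \<omega> q)\<^sup>2) = a\<^sup>2 * \<kappa> p p + 2 * a * b * \<kappa> p q + b\<^sup>2 * \<kappa> q q"
    and "expectation (\<lambda>\<omega>. (a * V \<omega> p + b * V \<omega> q) ^ (2 * k))
      \<le> fact (2 * k) * (a\<^sup>2 * \<kappa> p p + 2 * a * b * \<kappa> p q + b\<^sup>2 * \<kappa> q q) ^ k"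
proof -
  let ?c = "\<lambda>i :: nat. if i = 0 then a else b" and ?x = "\<lambda>i :: nat. if i = 0 then p else q"
  let ?s = "\<Sum>i<2. \<Sum>j<2. ?c i * ?c j * \<kappa> (?x i) (?x j)"
  have X: "(\<Sum>i<2. ?c i * V \<omega> (?x i)) = a * V \<omega> p + b * V \<omega> q" for \<omega>
    by (simp add: numeral_2_eq_2)
  have s: "?s = a\<^sup>2 * \<kappa> p p + 2 * a * b * \<kappa> p q + b\<^sup>2 * \<kappa> q q"
    using sym by (simp add: numeral_2_eq_2 power2_eq_square algebra_simps)
  have "?x i \<in> A" if "i < 2" for i using assms by simp
  note lin = gaussian_field_linear[where n = 2 and c = ?c and x = ?x, OF V this, unfolded X s]
  have "0 \<le> sqrt (a\<^sup>2 * \<kappa> p p + 2 * a * b * \<kappa> p q + b\<^sup>2 * \<kappa> q q)" using lin(2) by simp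
  note mom = scaled_std_normal_moments[OF lin(1) this lin(3)]
  show "integrable M (\<lambda>\<omega>. (a * V \<omega> p + b * V \<omega> q) ^ k)"
    by (rule mom(1))
  show "expectation (\<lambda>\<omega>. a * V \<omega> p + b * V \<omega> q) = 0"
    by (rule mom(2))
  show "expectation (\<lambda>\<omega>. (a * V \<omega> p + b * V \<omega> q)\<^sup>2) = a\<^sup>2 * \<kappa> p p + 2 * a * b * \<kappa> p q + b\<^sup>2 * \<kappa> q q"
    by (simp only: mom(3) real_sqrt_pow2[OF lin(2)])
  show "expectation (\<lambda>\<omega>. (a * V \<omega> p + b * V \<omega> q) ^ (2 * k))
      \<le> fact (2 * k) * (a\<^sup>2 * \<kappa> p p + 2 * a * b * \<kappa> p q + b\<^sup>2 * \<kappa> q q) ^ k"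
    using mom(4)[of k] by (simp only: real_sqrt_pow2[OF lin(2)])
qed

section \<open>The limiting Gaussian field\<close>

text \<open>Consecutive step functions differ by at most the summable chain bounds, uniformly on the
  cube, so they converge uniformly and the limit differs from level \<open>k\<close> by at most the
  tail of the series.\<close>

lemma
  fixes w :: "nat \<Rightarrow> real"
  assumes T: "T > 0" and sum: "summable (\<lambda>l. chain_bound TYPE('d::finite) T l w)"
  defines "f \<equiv> \<lambda>x\<in>cube T. lim (\<lambda>k. w (dyadic_index T (grid_map T k (x :: real ^ 'd))))"
  shows stepfun_limit_tendsto: "x \<in> cube T \<Longrightarrow> (\<lambda>k. w (dyadic_index T (grid_map T k x))) \<longlonglongrightarrow> f x"
    and stepfun_limit_regulated: "f \<in> regulated T"
proof -
  let ?V = "\<lambda>l. chain_bound TYPE('d) T l w" and ?s = "\<lambda>k x. w (dyadic_index T (grid_map T k (x :: real ^ 'd)))"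
  have step: "\<bar>?s (Suc l) x - ?s l x\<bar> \<le> ?V l" if "x \<in> cube T" for l x
    using stepfun_chain[OF T that, of l w] that by (simp add: stepfun_def)
  show lim: "(\<lambda>k. ?s k x) \<longlonglongrightarrow> f x" if x: "x \<in> cube T" for x
  proof -
    have "summable (\<lambda>l. ?s (Suc l) x - ?s l x)"
      by (rule summable_comparison_test'[OF sum]) (use step[OF x] in auto)
    then have "convergent (\<lambda>k. \<Sum>l<k. ?s (Suc l) x - ?s l x)"
      using summable_LIMSEQ convergentI by blast
    then have "convergent (\<lambda>k. ?s k x - ?s 0 x)" by (simp only: sum_lessThan_telescope[of "\<lambda>l. ?s l x"])
    from convergent_add[OF this convergent_const[of "?s 0 x"]] have "convergent (\<lambda>k. ?s k x)" by simp
    then show ?thesis using x by (simp add: f_def convergent_LIMSEQ_iff)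
  qed
  \<comment> \<open>A dyadic point is fixed by all sufficiently fine roundings, so the sequence is
    eventually constant there.\<close>
  have dy: "f x = w (dyadic_index T x)" if "x \<in> dyadic T" for x
  proof -
    obtain k where k: "x \<in> grid T k" using \<open>x \<in> dyadic T\<close> by (auto simp: dyadic_def)
    have "\<forall>\<^sub>F l in sequentially. ?s l x = w (dyadic_index T x)"
      using eventually_ge_at_top[of k] by eventually_elim (simp add: grid_map_on_grid[OF T k])
    then have "(\<lambda>l. ?s l x) \<longlonglongrightarrow> w (dyadic_index T x)" by (rule tendsto_eventually)
    then show ?thesis
      using lim[of x] dyadic_subset_cube[OF T] that LIMSEQ_unique by blast
  qed
  have summable_shift: "summable (\<lambda>l. ?V (l + k))" for k
    using sum by (rule summable_ignore_initial_segment)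
  have tail: "\<bar>?s k x - f x\<bar> \<le> (\<Sum>l. ?V (l + k))" if x: "x \<in> cube T" for k x
  proof -
    have "\<bar>?s k x - ?s (m + k) x\<bar> \<le> (\<Sum>l<m. ?V (l + k))" for m
    proof (induction m)
      case (Suc m)
      then show ?case using step[OF x, of "m + k"] by simp
    qed simp
    also have "(\<Sum>l<m. ?V (l + k)) \<le> (\<Sum>l. ?V (l + k))" for m
      by (rule sum_le_suminf[OF summable_shift]) (auto intro: less_imp_le chain_bound_pos)
    finally have "\<bar>?s k x - ?s (m + k) x\<bar> \<le> (\<Sum>l. ?V (l + k))" for m .
    moreover have "(\<lambda>m. \<bar>?s k x - ?s (m + k) x\<bar>) \<longlonglongrightarrow> \<bar>?s k x - f x\<bar>"
      using LIMSEQ_ignore_initial_segment[OF lim[OF x], of k] by (intro tendsto_intros)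
    ultimately show ?thesis by (intro Lim_bounded[of _ _ 0]) auto
  qed
  have ex: "f \<in> extensional (cube T)" by (simp add: f_def)
  have "stepfun T 0 w \<in> linf (cube T :: (real ^ 'd) set)" by (rule stepfun_in_linf[OF T])
  then have "bounded (stepfun T 0 w ` (cube T :: (real ^ 'd) set))" by (simp add: linf_def)
  then obtain B where B: "\<And>x :: real ^ 'd. x \<in> cube T \<Longrightarrow> \<bar>?s 0 x\<bar> \<le> B"
    by (auto simp: bounded_iff stepfun_def)
  have f: "f \<in> linf (cube T)"
  proof (rule linfI[OF ex])
    show "\<bar>f x\<bar> \<le> B + (\<Sum>l. ?V (l + 0))" if "x \<in> cube T" for x
      using tail[OF that, of 0] B[OF that] by linarith
  qed
  \<comment> \<open>\<open>regulated\<close> refers to the samples of \<open>f\<close> itself; by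
    \<open>dy\<close> these reproduce \<open>w\<close> at all grid points.\<close>
  have sample: "stepfun T k (sample T f) = (stepfun T k w :: real ^ 'd \<Rightarrow> real)" for k
    unfolding stepfun_sample[OF T] by (auto simp: stepfun_def dy grid_map_in_dyadic)
  have "(\<lambda>k. linf_dist (cube T) (stepfun T k w) f) \<longlonglongrightarrow> 0"
  proof (rule Lim_null_comparison[OF always_eventually])
    show "\<forall>k. norm (linf_dist (cube T) (stepfun T k w) f) \<le> (\<Sum>l. ?V (l + k))"
    proof
      fix k
      have "linf_dist (cube T) (stepfun T k w) f \<le> (\<Sum>l. ?V (l + k))"
        using tail by (intro linf_dist_le cube_nonempty T stepfun_in_linf f) (simp add: stepfun_def)
      moreover have "0 \<le> linf_dist (cube T) (stepfun T k w) f"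
        by (rule Metric_space.nonneg[OF Metric_space_linf[OF cube_nonempty[OF T]]])
      ultimately show "norm (linf_dist (cube T) (stepfun T k w) f) \<le> (\<Sum>l. ?V (l + k))" by simp
    qed
    have "(\<lambda>k. suminf ?V - (\<Sum>l<k. ?V l)) \<longlonglongrightarrow> suminf ?V - suminf ?V"
      by (intro tendsto_intros summable_LIMSEQ sum)
    then show "(\<lambda>k. \<Sum>l. ?V (l + k)) \<longlonglongrightarrow> 0"
      by (simp add: suminf_minus_initial_segment[OF sum])
  qed
  then show "f \<in> regulated T" using f by (simp add: regulated_def sample)
qed

text \<open>\<open>incr\<close> bounds the variance of an increment by the squared distance, so its
  moments of order 2d meet the chaining condition with the factor
  \<open>fact (2 * CARD('d))\<close>. \<open>cont\<close> carries the finite-dimensional laws from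
  dyadic points to the whole cube.\<close>

theorem regulated_gaussian_field:
  fixes \<kappa> :: "real ^ 'd \<Rightarrow> real ^ 'd \<Rightarrow> real"
  assumes T: "T > 0"
    and psd: "psd (\<lambda>i j. \<kappa> (dyadic_point T i) (dyadic_point T j))"
    and sym: "\<And>x y. \<kappa> x y = \<kappa> y x"
    and incr: "\<And>x y. x \<in> cube T \<Longrightarrow> y \<in> cube T \<Longrightarrow> \<kappa> x x - 2 * \<kappa> x y + \<kappa> y y \<le> (infnorm (x - y))\<^sup>2"
    and cont: "\<And>x y. x \<in> cube T \<Longrightarrow> y \<in> cube T \<Longrightarrow> (\<lambda>k. \<kappa> (grid_map T k x) (grid_map T k y)) \<longlonglongrightarrow> \<kappa> x y"
  obtains Z where
    "gaussian_field (PiM (UNIV :: nat set) (\<lambda>_. std_normal_distribution)) Z (cube T) \<kappa>"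
    "\<And>\<omega>. Z \<omega> \<in> regulated T"
    "increment_moments TYPE('d) T (fact (2 * CARD('d))) (PiM (UNIV :: nat set) (\<lambda>_. std_normal_distribution)) (\<lambda>\<omega>. sample T (Z \<omega>))"
proof -
  let ?\<gamma> = "PiM (UNIV :: nat set) (\<lambda>_. std_normal_distribution)"
  let ?C = "fact (2 * CARD('d)) :: real"
  interpret S: real_distribution std_normal_distribution by (rule real_dist_normal_dist)
  interpret \<gamma>: prob_space ?\<gamma> by (intro prob_space_PiM) unfold_locales
  obtain W where W: "gaussian_field ?\<gamma> W UNIV (\<lambda>i j. \<kappa> (dyadic_point T i) (dyadic_point T j))"
    using gaussian_sequence[OF psd] .
  have [measurable]: "(\<lambda>\<omega>. W \<omega> j) \<in> borel_measurable ?\<gamma>" for j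
    by (rule gaussian_fieldD(1)[OF W]) simp
  \<comment> \<open>Stated for arbitrary \<open>U\<close> because it is used twice: for
    \<open>W\<close>, to obtain summability before \<open>Z\<close> exists, and finally for the
    samples of \<open>Z\<close>.\<close>
  have moments: "increment_moments TYPE('d) T ?C ?\<gamma> U"
    if U: "gaussian_field ?\<gamma> U UNIV (\<lambda>i j. \<kappa> (dyadic_point T i) (dyadic_point T j))" for U
    unfolding increment_moments_def
  proof (intro ballI conjI)
    fix x y :: "real ^ 'd" assume xy: "x \<in> dyadic T" "y \<in> dyadic T"
    let ?s = "\<kappa> x x - 2 * \<kappa> x y + \<kappa> y y"
    have cube: "x \<in> cube T" "y \<in> cube T" using xy dyadic_subset_cube[OF T] by auto
    note lin = \<gamma>.gaussian_field_linear2[OF U UNIV_I UNIV_I sym, of 1 "dyadic_index T x" "-1" "dyadic_index T y"]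
    note lin = lin[unfolded dyadic_point_index[OF T xy(1)] dyadic_point_index[OF T xy(2)]]
    show "integrable ?\<gamma> (\<lambda>\<omega>. (U \<omega> (dyadic_index T x) - U \<omega> (dyadic_index T y)) ^ (2 * CARD('d)))"
      using lin(1)[of "2 * CARD('d)"] by simp
    have "0 \<le> (\<integral>\<omega>. (1 * U \<omega> (dyadic_index T x) + -1 * U \<omega> (dyadic_index T y))\<^sup>2 \<partial>?\<gamma>)" by simp
    then have "0 \<le> ?s" unfolding lin(3) by simp
    have "(\<integral>\<omega>. (U \<omega> (dyadic_index T x) - U \<omega> (dyadic_index T y)) ^ (2 * CARD('d)) \<partial>?\<gamma>) \<le> ?C * ?s ^ CARD('d)"
      using lin(4)[of "CARD('d)"] by simp
    also have "\<dots> \<le> ?C * ((infnorm (x - y))\<^sup>2) ^ CARD('d)"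
      using incr[OF cube] \<open>0 \<le> ?s\<close> by (intro mult_left_mono power_mono) auto
    finally show "(\<integral>\<omega>. (U \<omega> (dyadic_index T x) - U \<omega> (dyadic_index T y)) ^ (2 * CARD('d)) \<partial>?\<gamma>)
      \<le> ?C * infnorm (x - y) ^ (2 * CARD('d))"
      by (simp only: power_mult)
  qed
  let ?V = "\<lambda>l \<omega>. chain_bound TYPE('d) T l (W \<omega>)"
  have V_meas[measurable]: "?V l \<in> borel_measurable ?\<gamma>" for l
    unfolding chain_bound_def by measurable
  \<comment> \<open>The event that the chain bounds are summable. It has probability 1, since their
    expectations are dominated by a geometric series.\<close>
  define A where "A \<omega> \<longleftrightarrow> (\<Sum>l. ennreal (?V l \<omega>)) \<noteq> \<infinity>" for \<omega>
  have A_meas[measurable]: "Measurable.pred ?\<gamma> A" unfolding A_def by measurable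
  have AE_A: "AE \<omega> in ?\<gamma>. A \<omega>"
    unfolding A_def
  proof (rule nn_integral_PInf_AE)
    let ?c = "chain_const TYPE('d) T ?C"
    have c: "0 \<le> ?c" using T by (simp add: chain_const_def)
    have "(\<integral>\<^sup>+\<omega>. (\<Sum>l. ennreal (?V l \<omega>)) \<partial>?\<gamma>) = (\<Sum>l. \<integral>\<^sup>+\<omega>. ennreal (?V l \<omega>) \<partial>?\<gamma>)"
      by (rule nn_integral_suminf) measurable
    also have "\<dots> \<le> (\<Sum>l. ennreal (?c * (3 / 4) ^ l))"
    proof (intro suminf_le summableI)
      fix l
      note cb = \<gamma>.chain_bound_expectation[OF T _ moments[OF W], of l]
      have "(\<integral>\<^sup>+\<omega>. ennreal (?V l \<omega>) \<partial>?\<gamma>) = ennreal (\<integral>\<omega>. ?V l \<omega> \<partial>?\<gamma>)"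
        using cb by (intro nn_integral_eq_integral) (auto intro: less_imp_le chain_bound_pos)
      also have "\<dots> \<le> ennreal (?c * (3 / 4) ^ l)"
        using cb by (intro ennreal_leI) (simp add: chain_const_def)
      finally show "(\<integral>\<^sup>+\<omega>. ennreal (?V l \<omega>) \<partial>?\<gamma>) \<le> ennreal (?c * (3 / 4) ^ l)" .
    qed
    also have "\<dots> = ennreal (\<Sum>l. ?c * (3 / 4) ^ l)"
      using c by (intro suminf_ennreal2) (auto intro: summable_mult summable_geometric)
    also have "\<dots> < \<infinity>" by simp
    finally show "(\<integral>\<^sup>+\<omega>. (\<Sum>l. ennreal (?V l \<omega>)) \<partial>?\<gamma>) \<noteq> \<infinity>" by simp
  qed measurable
  have summ: "summable (\<lambda>l. ?V l \<omega>)" if "A \<omega>" for \<omega>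
    using that by (intro summable_suminf_not_top) (auto simp: A_def less_imp_le chain_bound_pos)
  \<comment> \<open>Off the exceptional event the path is set to zero, so that every path is
    regulated and Borel measurability holds without completing the measure.\<close>
  define Z where "Z \<omega> = (if A \<omega>
      then (\<lambda>x\<in>cube T. lim (\<lambda>k. W \<omega> (dyadic_index T (grid_map T k (x :: real ^ 'd)))))
      else (\<lambda>x\<in>cube T. 0))" for \<omega>
  have reg: "Z \<omega> \<in> regulated T" for \<omega>
  proof (cases "A \<omega>")
    case True
    then show ?thesis using stepfun_limit_regulated[OF T summ[OF True]] by (simp add: Z_def)
  next
    case False
    have "(\<lambda>x\<in>cube T. 0) \<in> linf (cube T :: (real ^ 'd) set)" by (rule linfI[of _ _ 0]) auto
    moreover have "stepfun T k (sample T (\<lambda>x\<in>(cube T :: (real ^ 'd) set). 0)) = ((\<lambda>x\<in>cube T. 0) :: real ^ 'd \<Rightarrow> real)" for k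
      unfolding stepfun_sample[OF T] using grid_map_in_cube[OF T] by (auto simp: fun_eq_iff restrict_def)
    ultimately show ?thesis using False
      by (simp add: Z_def regulated_def Metric_space.mdist_zero[OF Metric_space_linf[OF cube_nonempty[OF T]]])
  qed
  have Z_meas[measurable]: "(\<lambda>\<omega>. Z \<omega> x) \<in> borel_measurable ?\<gamma>" if "x \<in> cube T" for x
  proof -
    have "(\<lambda>\<omega>. Z \<omega> x) = (\<lambda>\<omega>. if A \<omega> then lim (\<lambda>k. W \<omega> (dyadic_index T (grid_map T k x))) else 0)"
      using that by (auto simp: Z_def)
    also have "\<dots> \<in> borel_measurable ?\<gamma>" by measurable
    finally show ?thesis .
  qed
  have Z_lim: "(\<lambda>k. W \<omega> (dyadic_index T (grid_map T k x))) \<longlonglongrightarrow> Z \<omega> x" if "A \<omega>" "x \<in> cube T" for \<omega> x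
    using stepfun_limit_tendsto[OF T summ[OF that(1)] that(2)] that by (simp add: Z_def)
  have Z: "gaussian_field ?\<gamma> Z (cube T) \<kappa>"
    unfolding gaussian_field_def
  proof (intro conjI ballI allI impI Z_meas)
    fix n :: nat and c :: "nat \<Rightarrow> real" and x :: "nat \<Rightarrow> real ^ 'd"
    assume x: "\<forall>i<n. x i \<in> cube T"
    have x_meas: "(\<lambda>\<omega>. Z \<omega> (x i)) \<in> borel_measurable ?\<gamma>" if "i < n" for i
      using x that by (intro Z_meas) auto
    note [measurable] = x_meas
    let ?y = "\<lambda>k i. dyadic_index T (grid_map T k (x i))"
    let ?K = "\<lambda>k. \<Sum>i<n. \<Sum>j<n. c i * c j * \<kappa> (grid_map T k (x i)) (grid_map T k (x j))"
    \<comment> \<open>At level \<open>k\<close> the characteristic function is known from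
      \<open>W\<close>; both sides are passed to the limit in \<open>k\<close>.\<close>
    have "(\<lambda>k. CLINT \<omega>|?\<gamma>. iexp (\<Sum>i<n. c i * W \<omega> (?y k i))) \<longlonglongrightarrow> (CLINT \<omega>|?\<gamma>. iexp (\<Sum>i<n. c i * Z \<omega> (x i)))"
    proof (rule integral_dominated_convergence[where w = "\<lambda>_. 1"])
      show "AE \<omega> in ?\<gamma>. (\<lambda>k. iexp (\<Sum>i<n. c i * W \<omega> (?y k i))) \<longlonglongrightarrow> iexp (\<Sum>i<n. c i * Z \<omega> (x i))"
        using AE_A
      proof eventually_elim
        case (elim \<omega>)
        show ?case using x by (intro tendsto_intros Z_lim elim) auto
      qed
      show "AE \<omega> in ?\<gamma>. norm (iexp (\<Sum>i<n. c i * W \<omega> (?y k i))) \<le> 1" for k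
        by (simp only: norm_exp_i_times) simp
      show "(\<lambda>\<omega>. iexp (\<Sum>i<n. c i * Z \<omega> (x i))) \<in> borel_measurable ?\<gamma>"
        by measurable (use x in auto)
    qed auto
    moreover have "(CLINT \<omega>|?\<gamma>. iexp (\<Sum>i<n. c i * W \<omega> (?y k i))) = complex_of_real (exp (- ?K k / 2))" for k
    proof -
      have "dyadic_point T (?y k i) = grid_map T k (x i)" if "i < n" for i
        using x that by (intro dyadic_point_index T grid_map_in_dyadic) auto
      then show ?thesis
        by (subst gaussian_fieldD(2)[OF W]) simp_all
    qed
    moreover have "(\<lambda>k. complex_of_real (exp (- ?K k / 2))) \<longlonglongrightarrow> complex_of_real (exp (- (\<Sum>i<n. \<Sum>j<n. c i * c j * \<kappa> (x i) (x j)) / 2))"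
      using x by (intro tendsto_intros cont) auto
    ultimately show "(CLINT \<omega>|?\<gamma>. iexp (\<Sum>i<n. c i * Z \<omega> (x i)))
      = complex_of_real (exp (- (\<Sum>i<n. \<Sum>j<n. c i * c j * \<kappa> (x i) (x j)) / 2))"
      using LIMSEQ_unique by fastforce
  qed
  have "gaussian_field ?\<gamma> (\<lambda>\<omega>. sample T (Z \<omega>)) UNIV (\<lambda>i j. \<kappa> (dyadic_point T i) (dyadic_point T j))"
    unfolding gaussian_field_def sample_def
    by (intro conjI ballI allI impI Z_meas dyadic_point_in_cube T gaussian_fieldD(2)[OF Z, of _ "\<lambda>i. dyadic_point T (_ i)"])
  from that[OF Z reg moments[OF this]] show thesis .
qed

section \<open>Weak convergence from Lipschitz test functions\<close>

text \<open>The functions \<open>h m\<close> are the Lipschitz envelopes (infimal convolutions) of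
  \<open>g\<close> with the penalty \<open>m\<close> times the distance. Continuity of
  \<open>g\<close> at \<open>f\<close> makes them converge there.\<close>

lemma (in Metric_space) lipschitz_approximation_from_below:
  assumes g: "continuous_map mtopology euclideanreal g" and bdd: "\<And>f. f \<in> M \<Longrightarrow> \<bar>g f\<bar> \<le> B"
    and M: "M \<noteq> {}"
  obtains h :: "nat \<Rightarrow> 'a \<Rightarrow> real" where
    "\<And>m f. f \<in> M \<Longrightarrow> - B \<le> h m f" "\<And>m f. f \<in> M \<Longrightarrow> h m f \<le> g f"
    "\<And>m f f'. f \<in> M \<Longrightarrow> f' \<in> M \<Longrightarrow> \<bar>h m f - h m f'\<bar> \<le> real m * d f f'"
    "\<And>f. f \<in> M \<Longrightarrow> (\<lambda>m. h m f) \<longlonglongrightarrow> g f"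
proof -
  define h where "h m f = (INF y\<in>M. g y + real m * d f y)" for m f
  have lower: "- B \<le> g y + real m * d f y" if "y \<in> M" for y m f
    using bdd[OF that] by (simp add: abs_le_iff add_increasing2)
  have bdd_below: "bdd_below ((\<lambda>y. g y + real m * d f y) ` M)" for m f
    using lower by (auto intro!: bdd_belowI[of _ "- B"])
  have h_le: "h m f \<le> g y + real m * d f y" if "y \<in> M" for m f y
    unfolding h_def using that by (intro cINF_lower bdd_below)
  have h1: "- B \<le> h m f" for m f
    unfolding h_def using M lower by (intro cINF_greatest) auto
  have h2: "h m f \<le> g f" if "f \<in> M" for m f
    using h_le[OF that, of m f] that by simp
  have h3: "h m f \<le> h m f' + real m * d f f'" if "f \<in> M" "f' \<in> M" for m f f'
  proof -
    have "h m f - real m * d f f' \<le> g y + real m * d f' y" if y: "y \<in> M" for y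
    proof -
      have "h m f \<le> g y + real m * d f y" by (rule h_le[OF y])
      also have "\<dots> \<le> g y + real m * (d f f' + d f' y)"
        using triangle[of f f' y] \<open>f \<in> M\<close> \<open>f' \<in> M\<close> y by (intro add_left_mono mult_left_mono) auto
      finally show ?thesis by (simp add: algebra_simps)
    qed
    then have "h m f - real m * d f f' \<le> h m f'" unfolding h_def[of m f'] using M by (intro cINF_greatest) auto
    then show ?thesis by simp
  qed
  have h4: "(\<lambda>m. h m f) \<longlonglongrightarrow> g f" if f: "f \<in> M" for f
  proof (rule LIMSEQ_I)
    fix e :: real assume "e > 0"
    have "openin mtopology {y \<in> topspace mtopology. g y \<in> {g f - e / 2<..}}"
      using g by (rule openin_continuous_map_preimage) simp
    then obtain r where r: "r > 0" "mball f r \<subseteq> {y \<in> M. g y > g f - e / 2}"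
      using f \<open>e > 0\<close> by (auto simp: openin_mtopology)
    \<comment> \<open>From \<open>m0\<close> on, the penalty outside the ball of radius
      \<open>r\<close> is at least \<open>2 * B\<close>, which exceeds any possible gain in
      \<open>g\<close>.\<close>
    obtain m0 :: nat where m0: "2 * B / r \<le> real m0" using real_arch_simple by blast
    show "\<exists>no. \<forall>n\<ge>no. norm (h n f - g f) < e"
    proof (intro exI[of _ m0] allI impI)
      fix m assume "m0 \<le> m"
      have "g f - e / 2 \<le> g y + real m * d f y" if y: "y \<in> M" for y
      proof (cases "d f y < r")
        case True
        then have "g y > g f - e / 2" using r(2) f y by auto
        then show ?thesis by (smt (verit) mult_nonneg_nonneg nonneg of_nat_0_le_iff)
      next
        case False
        have "2 * B \<le> real m0 * r" using m0 r(1) by (simp add: pos_divide_le_eq)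
        also have "\<dots> \<le> real m * d f y" using \<open>m0 \<le> m\<close> False r(1) by (intro mult_mono) auto
        finally show ?thesis using bdd[OF y] bdd[OF f] \<open>e > 0\<close> by linarith
      qed
      then have "g f - e / 2 \<le> h m f" unfolding h_def using M by (intro cINF_greatest) auto
      then show "norm (h m f - g f) < e" using h2[OF f, of m] \<open>e > 0\<close> by simp
    qed
  qed
  show thesis
  proof (rule that[OF h1 h2 _ h4])
    show "\<bar>h m f - h m f'\<bar> \<le> real m * d f f'" if "f \<in> M" "f' \<in> M" for m f f'
      using h3[OF that, of m] h3[OF that(2,1), of m] commute[of f f'] by simp
  qed
qed

lemma (in Metric_space) lipschitz_imp_continuous_map:
  fixes g :: "'a \<Rightarrow> real"
  assumes "\<And>x y. x \<in> M \<Longrightarrow> y \<in> M \<Longrightarrow> \<bar>g x - g y\<bar> \<le> L * d x y"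
  shows "continuous_map mtopology euclideanreal g"
proof -
  have "Lipschitz_continuous_map Self euclidean_metric g"
    using assms by (auto simp: Lipschitz_continuous_map_def dist_real_def)
  from Lipschitz_continuous_imp_continuous_map[OF this] show ?thesis by (simp add: mtopology_of_def)
qed

lemma measurable_continuous_borel_of:
  assumes "continuous_map X euclideanreal g"
  shows "g \<in> borel_measurable (borel_of X)"
proof (rule borel_measurableI)
  fix U :: "real set" assume "open U"
  have "{U. openin X U} \<subseteq> Pow (topspace X)" using openin_subset by auto
  note sp = space_measure_of[OF this] sets_measure_of[OF this]
  have "openin X {x \<in> topspace X. g x \<in> U}"
    using assms \<open>open U\<close> by (intro openin_continuous_map_preimage) auto
  moreover have "g -` U \<inter> space (borel_of X) = {x \<in> topspace X. g x \<in> U}"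
    by (auto simp: borel_of_def sp)
  ultimately show "g -` U \<inter> space (borel_of X) \<in> sets (borel_of X)"
    by (auto simp: borel_of_def sp)
qed

lemma space_borel_of: "space (borel_of X) = topspace X"
  unfolding borel_of_def by (rule space_measure_of) (use openin_subset in auto)

text \<open>A Lipschitz minorant \<open>h m\<close> loses less than \<open>e / 2\<close> in
  expectation at \<open>Z\<close>; convergence for this one function costs another
  \<open>e / 2\<close>, and \<open>h m \<le> g\<close> passes the bound on to
  \<open>g\<close>.\<close>

lemma expectation_lower_bound_of_lipschitz:
  assumes S: "S \<noteq> {}" and M: "prob_space M" and N: "prob_space N"
    and Y: "\<And>n. Y n \<in> measurable M (borel_of (linf_topology S))"
    and Z: "Z \<in> measurable N (borel_of (linf_topology S))"
    and conv: "\<And>h L. lipschitz_linf L S h \<Longrightarrow> (\<And>f. f \<in> linf S \<Longrightarrow> \<bar>h f\<bar> \<le> B) \<Longrightarrow>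
      (\<lambda>n. \<integral>\<omega>. h (Y n \<omega>) \<partial>M) \<longlonglongrightarrow> (\<integral>\<omega>. h (Z \<omega>) \<partial>N)"
    and g: "continuous_map (linf_topology S) euclideanreal g" "\<And>f. f \<in> linf S \<Longrightarrow> \<bar>g f\<bar> \<le> B"
    and "e > 0"
  shows "\<forall>\<^sub>F n in sequentially. (\<integral>\<omega>. g (Z \<omega>) \<partial>N) - e < (\<integral>\<omega>. g (Y n \<omega>) \<partial>M)"
proof -
  interpret M: prob_space M by fact
  interpret N: prob_space N by fact
  interpret Metric_space "linf S" "linf_dist S" by (rule Metric_space_linf[OF S])
  have ne: "linf S \<noteq> {}" using linfI[of "\<lambda>x\<in>S. 0" S 0] by auto
  have Yin: "Y n \<omega> \<in> linf S" if "\<omega> \<in> space M" for n \<omega>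
    using measurable_space[OF Y that] by (simp add: space_borel_of topspace_linf_topology[OF S])
  have Zin: "Z \<omega> \<in> linf S" if "\<omega> \<in> space N" for \<omega>
    using measurable_space[OF Z that] by (simp add: space_borel_of topspace_linf_topology[OF S])
  obtain h where h: "\<And>m f. f \<in> linf S \<Longrightarrow> - B \<le> h m f" "\<And>m f. f \<in> linf S \<Longrightarrow> h m f \<le> g f"
    "\<And>m f f'. f \<in> linf S \<Longrightarrow> f' \<in> linf S \<Longrightarrow> \<bar>h m f - h m f'\<bar> \<le> real m * linf_dist S f f'"
    "\<And>f. f \<in> linf S \<Longrightarrow> (\<lambda>m. h m f) \<longlonglongrightarrow> g f"
    using lipschitz_approximation_from_below[of g B] g ne unfolding linf_topology_def by blast
  have h_bdd: "\<bar>h m f\<bar> \<le> B" if "f \<in> linf S" for m f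
    using h(1,2)[OF that, of m] g(2)[OF that] by linarith
  have lip: "lipschitz_linf (real m) S (h m)" for m
    using h(3) by (simp add: lipschitz_linf_def)
  have h_cont: "continuous_map (linf_topology S) euclideanreal (h m)" for m
    unfolding linf_topology_def by (rule lipschitz_imp_continuous_map[OF h(3)])
  have meas: "(\<lambda>\<omega>. k (Y n \<omega>)) \<in> borel_measurable M" "(\<lambda>\<omega>. k (Z \<omega>)) \<in> borel_measurable N"
    if "continuous_map (linf_topology S) euclideanreal k" for k n
    using measurable_compose[OF Y measurable_continuous_borel_of[OF that]]
      measurable_compose[OF Z measurable_continuous_borel_of[OF that]] by auto
  have intM: "integrable M (\<lambda>\<omega>. k (Y n \<omega>))"
    if "continuous_map (linf_topology S) euclideanreal k" "\<And>f. f \<in> linf S \<Longrightarrow> \<bar>k f\<bar> \<le> B" for k n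
    using that Yin by (intro M.integrable_const_bound[of _ B] meas) auto
  have "(\<lambda>m. \<integral>\<omega>. h m (Z \<omega>) \<partial>N) \<longlonglongrightarrow> (\<integral>\<omega>. g (Z \<omega>) \<partial>N)"
  proof (rule integral_dominated_convergence[where w = "\<lambda>_. B"])
    show "AE \<omega> in N. (\<lambda>m. h m (Z \<omega>)) \<longlonglongrightarrow> g (Z \<omega>)" using h(4) Zin by (intro AE_I2) auto
    show "AE \<omega> in N. norm (h m (Z \<omega>)) \<le> B" for m using h_bdd Zin by (intro AE_I2) auto
  qed (use meas g(1) h_cont in auto)
  then have "\<forall>\<^sub>F m in sequentially. (\<integral>\<omega>. g (Z \<omega>) \<partial>N) - e / 2 < (\<integral>\<omega>. h m (Z \<omega>) \<partial>N)"
    using \<open>e > 0\<close> by (intro order_tendstoD(1)) auto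
  then obtain m where m: "(\<integral>\<omega>. g (Z \<omega>) \<partial>N) - e / 2 < (\<integral>\<omega>. h m (Z \<omega>) \<partial>N)"
    by (auto simp: eventually_sequentially)
  have "\<forall>\<^sub>F n in sequentially. (\<integral>\<omega>. h m (Z \<omega>) \<partial>N) - e / 2 < (\<integral>\<omega>. h m (Y n \<omega>) \<partial>M)"
    using conv[OF lip[of m] h_bdd] \<open>e > 0\<close> by (intro order_tendstoD(1)) auto
  then show ?thesis
  proof eventually_elim
    case (elim n)
    have "(\<integral>\<omega>. h m (Y n \<omega>) \<partial>M) \<le> (\<integral>\<omega>. g (Y n \<omega>) \<partial>M)"
      using h(2) Yin by (intro integral_mono intM h_cont h_bdd g) auto
    then show ?case using elim m by linarith
  qed
qed

text \<open>The lower bound applied to \<open>g\<close> and to \<open>- g\<close> encloses the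
  limit. Borel measurability of \<open>Y n\<close> turns outer expectations into ordinary
  integrals.\<close>

theorem weakly_convergesI_lipschitz:
  assumes S: "S \<noteq> {}" and M: "prob_space M" and N: "prob_space N"
    and Y: "\<And>n. Y n \<in> measurable M (borel_of (linf_topology S))"
    and Z: "Z \<in> measurable N (borel_of (linf_topology S))"
    and conv: "\<And>h L B. lipschitz_linf L S h \<Longrightarrow> (\<And>f. f \<in> linf S \<Longrightarrow> \<bar>h f\<bar> \<le> B) \<Longrightarrow>
      (\<lambda>n. \<integral>\<omega>. h (Y n \<omega>) \<partial>M) \<longlonglongrightarrow> (\<integral>\<omega>. h (Z \<omega>) \<partial>N)"
  shows "weakly_converges (linf_topology S) M Y N Z"
  unfolding weakly_converges_def
proof (intro conjI allI impI Z)
  interpret M: prob_space M by fact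
  interpret N: prob_space N by fact
  show "Y n \<in> space M \<rightarrow> topspace (linf_topology S)" for n
    using measurable_space[OF Y] by (auto simp: space_borel_of)
  fix g assume g: "continuous_map (linf_topology S) euclideanreal g \<and> bounded (g ` topspace (linf_topology S))"
  then obtain B where B: "\<And>f. f \<in> linf S \<Longrightarrow> \<bar>g f\<bar> \<le> B"
    by (auto simp: bounded_iff topspace_linf_topology[OF S])
  have cont: "continuous_map (linf_topology S) euclideanreal g" "continuous_map (linf_topology S) euclideanreal (\<lambda>f. - g f)"
    using g by auto
  have "integrable M (\<lambda>\<omega>. g (Y n \<omega>))" for n
  proof (rule M.integrable_const_bound[of _ B])
    show "AE \<omega> in M. norm (g (Y n \<omega>)) \<le> B"
      using B measurable_space[OF Y] by (intro AE_I2) (auto simp: space_borel_of topspace_linf_topology[OF S])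
  qed (rule measurable_compose[OF Y measurable_continuous_borel_of[OF cont(1)]])
  then have outer: "outer_expectation M (\<lambda>\<omega>. g (Y n \<omega>)) = (\<integral>\<omega>. g (Y n \<omega>) \<partial>M)" for n
    by (rule outer_expectation_integrable)
  have convB: "(\<lambda>n. \<integral>\<omega>. h (Y n \<omega>) \<partial>M) \<longlonglongrightarrow> (\<integral>\<omega>. h (Z \<omega>) \<partial>N)"
    if "lipschitz_linf L S h" "\<And>f. f \<in> linf S \<Longrightarrow> \<bar>h f\<bar> \<le> B" for h L
    using that by (rule conv)
  show "(\<lambda>n. outer_expectation M (\<lambda>\<omega>. g (Y n \<omega>))) \<longlonglongrightarrow> (\<integral>\<omega>. g (Z \<omega>) \<partial>N)"
    unfolding outer
  proof (rule order_tendstoI)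
    fix a assume "a < (\<integral>\<omega>. g (Z \<omega>) \<partial>N)"
    then show "\<forall>\<^sub>F n in sequentially. a < (\<integral>\<omega>. g (Y n \<omega>) \<partial>M)"
      using expectation_lower_bound_of_lipschitz[where e = "(\<integral>\<omega>. g (Z \<omega>) \<partial>N) - a", OF S M N Y Z convB cont(1) B] by simp
  next
    fix a assume "(\<integral>\<omega>. g (Z \<omega>) \<partial>N) < a"
    then show "\<forall>\<^sub>F n in sequentially. (\<integral>\<omega>. g (Y n \<omega>) \<partial>M) < a"
      using expectation_lower_bound_of_lipschitz[where e = "a - (\<integral>\<omega>. g (Z \<omega>) \<partial>N)" and B = B, OF S M N Y Z convB cont(2)] B by simp
  qed
qed

section \<open>Normalised sums\<close>

text \<open>Serves to renumber the sample, which starts at index 1, as a sequence indexed by all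
  naturals.\<close>

lemma (in prob_space) indep_vars_compose_inj:
  assumes "indep_vars (\<lambda>_. N) X I" "inj_on h J" "h ` J \<subseteq> I"
  shows "indep_vars (\<lambda>_. N) (\<lambda>j. X (h j)) J"
proof -
  let ?F = "\<lambda>i. {X i -` A \<inter> space M |A. A \<in> sets N}"
  have X: "\<And>i. i \<in> I \<Longrightarrow> random_variable N (X i)" and ind: "indep_sets ?F I"
    using assms(1) by (auto simp: indep_vars_def2)
  have "indep_sets (\<lambda>j. ?F (h j)) J"
  proof (rule indep_setsI)
    show "?F (h j) \<subseteq> events" if "j \<in> J" for j
      using X[of "h j"] that assms(3) by (auto intro: measurable_sets)
    fix A J' assume J': "J' \<noteq> {}" "J' \<subseteq> J" "finite J'" and A: "\<forall>j\<in>J'. A j \<in> ?F (h j)"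
    have inj: "inj_on h J'" using assms(2) J'(2) by (rule inj_on_subset)
    define A' where "A' i = A (the_inv_into J' h i)" for i
    have A': "A' (h j) = A j" if "j \<in> J'" for j
      using the_inv_into_f_f[OF inj that] by (simp add: A'_def)
    have "prob (\<Inter>i\<in>h ` J'. A' i) = (\<Prod>i\<in>h ` J'. prob (A' i))"
    proof (rule indep_setsD[OF ind])
      show "\<forall>i\<in>h ` J'. A' i \<in> ?F i" using A by (auto simp: A')
    qed (use J' assms(3) in auto)
    then show "prob (\<Inter>j\<in>J'. A j) = (\<Prod>j\<in>J'. prob (A j))"
      by (simp add: prod.reindex[OF inj] A' cong: prod.cong INF_cong)
  qed
  then show ?thesis
    using X assms(3) by (auto simp: indep_vars_def2)
qed

lemma (in prob_space) central_limit_char: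
  assumes ind: "indep_vars (\<lambda>_. borel) X (UNIV :: nat set)" and distr: "\<And>n. distr M borel (X n) = \<nu>"
    and bdd: "\<And>n \<omega>. \<omega> \<in> space M \<Longrightarrow> \<bar>X n \<omega>\<bar> \<le> B"
    and mean: "\<And>n. expectation (X n) = 0" and var: "\<And>n. expectation (\<lambda>\<omega>. (X n \<omega>)\<^sup>2) = s"
  shows "(\<lambda>n. CLINT \<omega>|M. iexp ((\<Sum>i<n. X i \<omega>) / sqrt (real n))) \<longlonglongrightarrow> complex_of_real (exp (- s / 2))"
proof -
  have X[measurable]: "X n \<in> borel_measurable M" for n using ind by (auto simp: indep_vars_def2)
  have sq: "integrable M (\<lambda>\<omega>. (X n \<omega>)\<^sup>2)" for n
    using bdd power_mono[of "\<bar>X n _\<bar>" B 2] by (intro integrable_const_bound[of _ "B\<^sup>2"] AE_I2) auto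
  have s: "0 \<le> s" unfolding var[of 0, symmetric] by simp
  show ?thesis
  proof (cases "s = 0")
    \<comment> \<open>The central limit theorem requires positive variance. If \<open>s = 0\<close>,
      all \<open>X n\<close> vanish almost surely and the characteristic functions are constantly
      1.\<close>
    case True
    have "AE \<omega> in M. \<forall>n. X n \<omega> = 0"
      unfolding AE_all_countable
    proof
      fix n
      have "AE \<omega> in M. (X n \<omega>)\<^sup>2 = 0"
        using integral_nonneg_eq_0_iff_AE[OF sq[of n]] var[of n] True by simp
      then show "AE \<omega> in M. X n \<omega> = 0" by simp
    qed
    then have "(CLINT \<omega>|M. iexp ((\<Sum>i<n. X i \<omega>) / sqrt (real n))) = (CLINT \<omega>|M. 1)" for n
      by (intro integral_cong_AE) auto
    then show ?thesis using True by (simp add: prob_space)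
  next
    case False
    define \<sigma> where "\<sigma> = sqrt s"
    have \<sigma>: "\<sigma> > 0" "\<sigma>\<^sup>2 = s" using False s by (auto simp: \<sigma>_def)
    let ?S = "\<lambda>n \<omega>. (\<Sum>i<n. X i \<omega>) / sqrt (real n * \<sigma>\<^sup>2)"
    have "weak_conv_m (\<lambda>n. distr M borel (?S n)) std_normal_distribution"
    proof (rule central_limit_theorem_zero_mean[OF ind mean \<sigma>(1) sq _ distr])
      show "variance (X n) = \<sigma>\<^sup>2" for n using var \<sigma>(2) mean by simp
    qed
    \<comment> \<open>Evaluating at frequency \<open>\<sigma>\<close> undoes the division by the
      standard deviation.\<close>
    then have "(\<lambda>n. char (distr M borel (?S n)) \<sigma>) \<longlonglongrightarrow> char std_normal_distribution \<sigma>"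
      by (intro levy_continuity1 real_dist_normal_dist) (simp_all add: real_distribution_distr)
    moreover have "char (distr M borel (?S n)) \<sigma> = (CLINT \<omega>|M. iexp ((\<Sum>i<n. X i \<omega>) / sqrt (real n)))" for n
    proof -
      have "\<sigma> * ?S n \<omega> = (\<Sum>i<n. X i \<omega>) / sqrt (real n)" for \<omega>
        using \<sigma>(1) by (simp add: real_sqrt_mult)
      then show ?thesis
        unfolding char_def by (subst integral_distr) (simp_all only: measurable_lborel1, measurable)
    qed
    ultimately show ?thesis by (simp add: char_std_normal_distribution \<sigma>(2))
  qed
qed

text \<open>A single term of the series of \<open>exp \<bar>x\<bar>\<close> is below the whole
  sum.\<close>

lemma even_power_le_exp:
  fixes x :: real
  shows "x ^ (2 * k) \<le> fact (2 * k) * (exp x + exp (- x))"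
proof -
  have "\<bar>x\<bar> ^ (2 * k) / fact (2 * k) \<le> exp \<bar>x\<bar>"
    using sum_le_suminf[OF summable_exp[of "\<bar>x\<bar>"], of "{2 * k}"]
    by (simp add: exp_def divide_inverse mult.commute)
  also have "\<dots> \<le> exp x + exp (- x)" by (cases "x \<ge> 0") auto
  finally show ?thesis by (simp add: divide_le_eq power_even_abs mult.commute)
qed

text \<open>\<open>even_power_le_exp\<close> is applied to \<open>S / \<delta>\<close>; the factor 4
  is the sum of the two bounds 2. Nonnegative integrals are used because integrability is part of
  the claim.\<close>

lemma (in prob_space) even_moment_le_of_nn_integral_exp:
  assumes S[measurable]: "S \<in> borel_measurable M" and "\<delta> > 0"
    and "(\<integral>\<^sup>+\<omega>. exp (S \<omega> / \<delta>) \<partial>M) \<le> ennreal 2" "(\<integral>\<^sup>+\<omega>. exp (- S \<omega> / \<delta>) \<partial>M) \<le> ennreal 2"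
  shows "integrable M (\<lambda>\<omega>. S \<omega> ^ (2 * k))"
    and "expectation (\<lambda>\<omega>. S \<omega> ^ (2 * k)) \<le> 4 * fact (2 * k) * \<delta> ^ (2 * k)"
proof -
  let ?c = "fact (2 * k) * \<delta> ^ (2 * k)"
  have le: "S \<omega> ^ (2 * k) \<le> ?c * (exp (S \<omega> / \<delta>) + exp (- S \<omega> / \<delta>))" for \<omega>
    using even_power_le_exp[of "S \<omega> / \<delta>" k] \<open>\<delta> > 0\<close> by (simp add: power_divide divide_le_eq mult_ac)
  have "(\<integral>\<^sup>+\<omega>. ennreal (S \<omega> ^ (2 * k)) \<partial>M) \<le> (\<integral>\<^sup>+\<omega>. ennreal ?c * (ennreal (exp (S \<omega> / \<delta>)) + ennreal (exp (- S \<omega> / \<delta>))) \<partial>M)"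
    using le \<open>\<delta> > 0\<close> by (intro nn_integral_mono) (auto simp flip: ennreal_plus ennreal_mult intro!: ennreal_leI)
  also have "\<dots> = ennreal ?c * ((\<integral>\<^sup>+\<omega>. exp (S \<omega> / \<delta>) \<partial>M) + (\<integral>\<^sup>+\<omega>. exp (- S \<omega> / \<delta>) \<partial>M))"
    by (simp add: nn_integral_cmult nn_integral_add)
  also have "\<dots> \<le> ennreal ?c * (ennreal 2 + ennreal 2)"
    using assms(3,4) by (intro mult_left_mono add_mono) auto
  also have "\<dots> = ennreal (4 * ?c)"
  proof -
    have "ennreal 2 + ennreal 2 = ennreal 4" by (simp flip: ennreal_plus)
    then show ?thesis using ennreal_mult[of ?c 4] \<open>\<delta> > 0\<close> by (simp only: mult.commute) simp
  qed
  finally have nn: "(\<integral>\<^sup>+\<omega>. ennreal (S \<omega> ^ (2 * k)) \<partial>M) \<le> ennreal (4 * ?c)" .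
  show int: "integrable M (\<lambda>\<omega>. S \<omega> ^ (2 * k))"
    using nn by (intro integrableI_nonneg) (auto simp: power_mult intro: le_less_trans)
  have "ennreal (expectation (\<lambda>\<omega>. S \<omega> ^ (2 * k))) \<le> ennreal (4 * ?c)"
    using nn nn_integral_eq_integral[OF int] by (simp add: power_mult)
  then show "expectation (\<lambda>\<omega>. S \<omega> ^ (2 * k)) \<le> 4 * fact (2 * k) * \<delta> ^ (2 * k)"
    using \<open>\<delta> > 0\<close> by (simp add: ennreal_le_iff mult.assoc)
qed

text \<open>Independence factorises the integral. With n the number of variables, Hoeffding's lemma
  on \<open>[-\<delta>, \<delta>]\<close> at the parameter \<open>1 / (sqrt n * \<delta>)\<close>
  bounds each factor by \<open>exp (1 / (2 * n))\<close>, so the product is at most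
  \<open>exp (1 / 2)\<close>, whatever n is.\<close>

lemma (in prob_space) nn_integral_exp_normalized_sum:
  assumes ind: "indep_vars (\<lambda>_. borel) X I" and I: "finite I" "I \<noteq> {}" and "\<delta> > 0"
    and bdd: "\<And>i \<omega>. i \<in> I \<Longrightarrow> \<omega> \<in> space M \<Longrightarrow> \<bar>X i \<omega>\<bar> \<le> \<delta>"
    and mean: "\<And>i. i \<in> I \<Longrightarrow> expectation (X i) = m"
  shows "(\<integral>\<^sup>+\<omega>. exp ((\<Sum>i\<in>I. X i \<omega> - m) / sqrt (card I) / \<delta>) \<partial>M) \<le> ennreal 2"
proof -
  let ?l = "1 / (sqrt (card I) * \<delta>)"
  have card: "card I > 0" using I by (simp add: card_gt_0_iff)
  have l: "?l > 0" using card \<open>\<delta> > 0\<close> by simp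
  have X[measurable]: "X i \<in> borel_measurable M" if "i \<in> I" for i using ind that by (auto simp: indep_vars_def2)
  have "(\<integral>\<^sup>+\<omega>. exp ((\<Sum>i\<in>I. X i \<omega> - m) / sqrt (card I) / \<delta>) \<partial>M) = (\<integral>\<^sup>+\<omega>. (\<Prod>i\<in>I. ennreal (exp (?l * (X i \<omega> - m)))) \<partial>M)"
    using I by (intro nn_integral_cong) (simp add: prod_ennreal exp_sum[symmetric] sum_divide_distrib)
  also have "\<dots> = (\<Prod>i\<in>I. \<integral>\<^sup>+\<omega>. ennreal (exp (?l * (X i \<omega> - m))) \<partial>M)"
    by (intro indep_vars_nn_integral I indep_vars_compose2[OF ind]) auto
  also have "\<dots> \<le> (\<Prod>i\<in>I. ennreal (exp (?l\<^sup>2 * (\<delta> - - \<delta>)\<^sup>2 / 8)))"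
  proof (intro prod_mono_ennreal)
    fix i assume i: "i \<in> I"
    interpret interval_bounded_random_variable M "X i" "- \<delta>" \<delta>
      using X[OF i] bdd[OF i] by unfold_locales (auto simp: abs_le_iff minus_le_iff)
    show "(\<integral>\<^sup>+\<omega>. ennreal (exp (?l * (X i \<omega> - m))) \<partial>M) \<le> ennreal (exp (?l\<^sup>2 * (\<delta> - - \<delta>)\<^sup>2 / 8))"
      using Hoeffdings_lemma_nn_integral[OF l] unfolding mean[OF i] .
  qed
  also have "\<dots> = ennreal (exp (real (card I) * (?l\<^sup>2 * (\<delta> - - \<delta>)\<^sup>2 / 8)))"
    by (simp only: prod_constant exp_of_nat_mult ennreal_power[OF exp_ge_zero])
  also have "real (card I) * (?l\<^sup>2 * (\<delta> - - \<delta>)\<^sup>2 / 8) = 1 / 2"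
    using card \<open>\<delta> > 0\<close> by (simp add: power_divide power_mult_distrib field_simps power2_eq_square)
  also have "ennreal (exp (1 / 2)) \<le> ennreal 2" by (intro ennreal_leI exp_half_le2)
  finally show ?thesis .
qed

section \<open>Laws on Lipschitz functions\<close>

lemma infnorm_le_on_cube:
  assumes "x \<in> cube T" "y \<in> cube T"
  shows "infnorm (x - y) \<le> T"
  unfolding infnorm_le_cart_iff
proof
  fix i
  have "0 \<le> x $ i" "x $ i \<le> T" "0 \<le> y $ i" "y $ i \<le> T" using assms by (auto simp: mem_cube_iff)
  then show "\<bar>(x - y) $ i\<bar> \<le> T" by simp
qed

lemma lipschitz_regulated:
  fixes f :: "real ^ 'd \<Rightarrow> real"
  assumes T: "T > 0" and L: "L \<ge> 0" and ex: "f \<in> extensional (cube T)"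
    and lip: "\<And>x y. x \<in> cube T \<Longrightarrow> y \<in> cube T \<Longrightarrow> \<bar>f x - f y\<bar> \<le> L * infnorm (x - y)"
  shows "f \<in> regulated T"
proof -
  obtain z :: "real ^ 'd" where z: "z \<in> cube T" using cube_nonempty[OF T] by blast
  have f: "f \<in> linf (cube T)"
  proof (rule linfI[OF ex])
    fix x :: "real ^ 'd" assume x: "x \<in> cube T"
    have "\<bar>f x - f z\<bar> \<le> L * T"
      using lip[OF x z] mult_left_mono[OF infnorm_le_on_cube[OF x z] L] by linarith
    then show "\<bar>f x\<bar> \<le> \<bar>f z\<bar> + L * T" by linarith
  qed
  have "(\<lambda>k. linf_dist (cube T) (stepfun T k (sample T f)) f) \<longlonglongrightarrow> 0"
  proof (rule Lim_null_comparison[OF always_eventually])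
    show "\<forall>k. norm (linf_dist (cube T) (stepfun T k (sample T f)) f) \<le> L * (T / 2 ^ k)"
    proof
      fix k
      have "linf_dist (cube T) (stepfun T k (sample T f)) f \<le> L * (T / 2 ^ k)"
      proof (intro linf_dist_le cube_nonempty T stepfun_in_linf f)
        fix x :: "real ^ 'd" assume x: "x \<in> cube T"
        have "\<bar>f x - f (grid_map T k x)\<bar> \<le> L * (T / 2 ^ k)"
          using lip[OF x grid_map_in_cube[OF T x], of k] mult_left_mono[OF infnorm_grid_map[OF T, of x k] L]
          by linarith
        then show "\<bar>stepfun T k (sample T f) x - f x\<bar> \<le> L * (T / 2 ^ k)"
          unfolding stepfun_sample[OF T] using x by (simp add: abs_minus_commute)
      qed
      moreover have "0 \<le> linf_dist (cube T) (stepfun T k (sample T f)) f"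
        by (rule Metric_space.nonneg[OF Metric_space_linf[OF cube_nonempty[OF T]]])
      ultimately show "norm (linf_dist (cube T) (stepfun T k (sample T f)) f) \<le> L * (T / 2 ^ k)" by simp
    qed
    have "(\<lambda>k. L * T * (1 / 2) ^ k) \<longlonglongrightarrow> 0"
      by (intro tendsto_mult_right_zero LIMSEQ_realpow_zero) auto
    then show "(\<lambda>k. L * (T / 2 ^ k)) \<longlonglongrightarrow> 0" by (simp add: power_divide)
  qed
  then show ?thesis using f by (simp add: regulated_def)
qed

text \<open>Isolates the analytic properties of landscapes from their algebraic origin; the
  covariance estimates and the limit theorem are developed from these alone.\<close>

locale lipschitz_law = prob_space P for P :: "(real ^ 'd \<Rightarrow> real) measure" +
  fixes T :: real
  assumes T: "T > 0"
    and eval [measurable]: "x \<in> cube T \<Longrightarrow> (\<lambda>f. f x) \<in> borel_measurable P"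
    and bound: "f \<in> space P \<Longrightarrow> x \<in> cube T \<Longrightarrow> \<bar>f x\<bar> \<le> T"
    and lip: "f \<in> space P \<Longrightarrow> x \<in> cube T \<Longrightarrow> y \<in> cube T \<Longrightarrow> \<bar>f x - f y\<bar> \<le> infnorm (x - y)"
begin

definition mean :: "real ^ 'd \<Rightarrow> real" where
  "mean x = (\<integral>f. f x \<partial>P)"

definition kern :: "real ^ 'd \<Rightarrow> real ^ 'd \<Rightarrow> real" where
  "kern x y = (\<integral>f. f x * f y \<partial>P) - mean x * mean y"

lemma integrable_eval: "x \<in> cube T \<Longrightarrow> integrable P (\<lambda>f. f x)"
  using bound by (intro integrable_const_bound[of _ T] AE_I2) auto

lemma integrable_eval_mult:
  assumes "x \<in> cube T" "y \<in> cube T"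
  shows "integrable P (\<lambda>f. f x * f y)"
proof (rule integrable_const_bound[of _ "T * T"])
  show "AE f in P. norm (f x * f y) \<le> T * T"
    using bound assms T by (intro AE_I2) (auto simp: abs_mult intro!: mult_mono)
qed (use assms in measurable)

lemma mean_bound: "x \<in> cube T \<Longrightarrow> \<bar>mean x\<bar> \<le> T"
  using abs_integral_le_integral[OF integrable_eval, of x "\<lambda>_. T"] bound by (simp add: mean_def prob_space)

lemma mean_lip:
  assumes "x \<in> cube T" "y \<in> cube T"
  shows "\<bar>mean x - mean y\<bar> \<le> infnorm (x - y)"
proof -
  have "mean x - mean y = (\<integral>f. f x - f y \<partial>P)"
    using assms integrable_eval by (simp add: mean_def)
  also have "\<bar>\<dots>\<bar> \<le> (\<integral>f. infnorm (x - y) \<partial>P)"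
    using assms integrable_eval lip by (intro abs_integral_le_integral) auto
  finally show ?thesis by (simp add: prob_space)
qed

lemma kern_sym: "kern x y = kern y x"
  by (simp add: kern_def mult.commute)

lemma kern_eq_expectation:
  assumes "x \<in> cube T" "y \<in> cube T"
  shows "integrable P (\<lambda>f. (f x - mean x) * (f y - mean y))"
    and "kern x y = (\<integral>f. (f x - mean x) * (f y - mean y) \<partial>P)"
proof -
  have *: "(\<lambda>f. (f x - mean x) * (f y - mean y)) = (\<lambda>f. f x * f y - mean x * f y - mean y * f x + mean x * mean y)"
    by (simp add: algebra_simps)
  note int = integrable_eval_mult[OF assms] integrable_eval[OF assms(1)] integrable_eval[OF assms(2)]
  show "integrable P (\<lambda>f. (f x - mean x) * (f y - mean y))"
    unfolding * using int by simp
  have "(\<integral>f. (f x - mean x) * (f y - mean y) \<partial>P) = (\<integral>f. f x * f y \<partial>P) - mean x * mean y - mean y * mean x + mean x * mean y"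
    unfolding * using int by (simp add: mean_def prob_space)
  then show "kern x y = (\<integral>f. (f x - mean x) * (f y - mean y) \<partial>P)"
    by (simp add: kern_def)
qed

text \<open>The quadratic form is the variance of a linear functional of the path. This gives
  positive semidefiniteness for the Cholesky factorisation and also identifies the variance in the
  central limit theorem.\<close>

lemma kern_quadratic:
  assumes x: "\<And>i. i \<in> I \<Longrightarrow> x i \<in> cube T"
  shows "(\<Sum>i\<in>I. \<Sum>j\<in>I. c i * c j * kern (x i) (x j)) = (\<integral>f. (\<Sum>i\<in>I. c i * (f (x i) - mean (x i)))\<^sup>2 \<partial>P)"
proof -
  have "(\<integral>f. (\<Sum>i\<in>I. c i * (f (x i) - mean (x i)))\<^sup>2 \<partial>P)
    = (\<integral>f. (\<Sum>i\<in>I. \<Sum>j\<in>I. c i * c j * ((f (x i) - mean (x i)) * (f (x j) - mean (x j)))) \<partial>P)"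
    by (simp add: power2_eq_square sum_product mult_ac)
  also have "\<dots> = (\<Sum>i\<in>I. \<Sum>j\<in>I. c i * c j * (\<integral>f. (f (x i) - mean (x i)) * (f (x j) - mean (x j)) \<partial>P))"
    using x by (simp add: kern_eq_expectation(1))
  also have "\<dots> = (\<Sum>i\<in>I. \<Sum>j\<in>I. c i * c j * kern (x i) (x j))"
    using x by (intro sum.cong refl) (simp add: kern_eq_expectation(2))
  finally show ?thesis by simp
qed

lemma psd_kern: "psd (\<lambda>i j. kern (dyadic_point T i) (dyadic_point T j))"
  unfolding psd_def
proof (intro conjI allI)
  fix c :: "nat \<Rightarrow> real" and n :: nat
  show "0 \<le> (\<Sum>i<n. \<Sum>j<n. c i * c j * kern (dyadic_point T i) (dyadic_point T j))"
    by (subst kern_quadratic) (simp_all add: dyadic_point_in_cube T)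
qed (rule kern_sym)

text \<open>The left-hand side is the variance of \<open>f x - f y\<close>, hence at most its second
  moment, which the Lipschitz bound controls.\<close>

lemma kern_increment:
  assumes "x \<in> cube T" "y \<in> cube T"
  shows "kern x x - 2 * kern x y + kern y y \<le> (infnorm (x - y))\<^sup>2"
proof -
  note int = integrable_eval_mult[OF assms(1,1)] integrable_eval_mult[OF assms] integrable_eval_mult[OF assms(2,2)]
  have sq: "(\<lambda>f :: real ^ 'd \<Rightarrow> real. (f x - f y)\<^sup>2) = (\<lambda>f. f x * f x - 2 * (f x * f y) + f y * f y)"
    by (auto simp: power2_eq_square algebra_simps)
  have "(\<integral>f. (f x - f y)\<^sup>2 \<partial>P) = (\<integral>f. f x * f x - 2 * (f x * f y) + f y * f y \<partial>P)"
    by (simp only: sq)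
  also have "\<dots> = (\<integral>f. f x * f x \<partial>P) - 2 * (\<integral>f. f x * f y \<partial>P) + (\<integral>f. f y * f y \<partial>P)"
    using int by simp
  finally have "kern x x - 2 * kern x y + kern y y = (\<integral>f. (f x - f y)\<^sup>2 \<partial>P) - (mean x - mean y)\<^sup>2"
    by (simp add: kern_def power2_eq_square algebra_simps)
  also have "\<dots> \<le> (\<integral>f. (f x - f y)\<^sup>2 \<partial>P)" by simp
  also have "\<dots> \<le> (\<integral>f. (infnorm (x - y))\<^sup>2 \<partial>P)"
  proof (rule integral_mono)
    show "integrable P (\<lambda>f. (f x - f y)\<^sup>2)"
      unfolding sq using int by simp
    show "(f x - f y)\<^sup>2 \<le> (infnorm (x - y))\<^sup>2" if "f \<in> space P" for f
      using power_mono[OF lip[OF that assms], of 2] by simp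
  qed simp
  finally show ?thesis by (simp add: prob_space)
qed

lemma grid_map_tendsto:
  assumes "f \<in> space P" "x \<in> cube T"
  shows "(\<lambda>k. f (grid_map T k x)) \<longlonglongrightarrow> f x"
proof (rule LIM_zero_cancel, rule Lim_null_comparison[OF always_eventually])
  show "\<forall>k. norm (f (grid_map T k x) - f x) \<le> T * (1 / 2) ^ k"
  proof
    fix k
    show "norm (f (grid_map T k x) - f x) \<le> T * (1 / 2) ^ k"
      using lip[OF assms(1) assms(2) grid_map_in_cube[OF T assms(2)], of k] infnorm_grid_map[OF T, of x k]
      by (simp add: abs_minus_commute power_divide)
  qed
  show "(\<lambda>k. T * (1 / 2) ^ k) \<longlonglongrightarrow> 0"
    by (intro tendsto_mult_right_zero LIMSEQ_realpow_zero) auto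
qed

lemma kern_grid_map_tendsto:
  assumes "x \<in> cube T" "y \<in> cube T"
  shows "(\<lambda>k. kern (grid_map T k x) (grid_map T k y)) \<longlonglongrightarrow> kern x y"
proof -
  note g = grid_map_in_cube[OF T assms(1)] grid_map_in_cube[OF T assms(2)]
  have mean: "(\<lambda>k. mean (grid_map T k z)) \<longlonglongrightarrow> mean z" if z: "z \<in> cube T" for z
    unfolding mean_def
  proof (rule integral_dominated_convergence[where w = "\<lambda>_. T"])
    show "AE f in P. (\<lambda>k. f (grid_map T k z)) \<longlonglongrightarrow> f z"
      using grid_map_tendsto z by (intro AE_I2) auto
    show "AE f in P. norm (f (grid_map T k z)) \<le> T" for k
      using bound grid_map_in_cube[OF T z] by (intro AE_I2) auto
  qed (use z grid_map_in_cube[OF T z] in auto)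
  have "(\<lambda>k. \<integral>f. f (grid_map T k x) * f (grid_map T k y) \<partial>P) \<longlonglongrightarrow> (\<integral>f. f x * f y \<partial>P)"
  proof (rule integral_dominated_convergence[where w = "\<lambda>_. T * T"])
    show "AE f in P. (\<lambda>k. f (grid_map T k x) * f (grid_map T k y)) \<longlonglongrightarrow> f x * f y"
      using grid_map_tendsto assms by (intro AE_I2 tendsto_mult) auto
    show "AE f in P. norm (f (grid_map T k x) * f (grid_map T k y)) \<le> T * T" for k
      using bound g T by (intro AE_I2) (auto simp: abs_mult intro!: mult_mono)
  qed (use assms g in auto)
  then show ?thesis unfolding kern_def by (intro tendsto_intros mean assms)
qed

end

section \<open>The empirical process\<close>

lemma (in prob_space) gaussian_field_finite_linear:
  fixes c :: "'i \<Rightarrow> real"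
  assumes V: "gaussian_field M V A \<kappa>" and I: "finite I" and x: "\<And>i. i \<in> I \<Longrightarrow> x i \<in> A"
  defines "s \<equiv> \<Sum>i\<in>I. \<Sum>j\<in>I. c i * c j * \<kappa> (x i) (x j)"
  shows "(CLINT \<omega>|M. iexp (\<Sum>i\<in>I. c i * V \<omega> (x i))) = complex_of_real (exp (- s / 2))"
    and "0 \<le> s"
    and "distr M borel (\<lambda>\<omega>. \<Sum>i\<in>I. c i * V \<omega> (x i)) = distr std_normal_distribution borel (\<lambda>z. sqrt s * z)"
proof -
  obtain h where "bij_betw h {0..<card I} I" using ex_bij_betw_nat_finite[OF I] by blast
  then have h: "bij_betw h {..<card I} I" by (simp add: atLeast0LessThan)
  have re: "(\<Sum>i\<in>I. f i) = (\<Sum>i<card I. f (h i))" for f :: "'i \<Rightarrow> real"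
    by (rule sum.reindex_bij_betw[OF h, symmetric])
  have A: "x (h i) \<in> A" if "i < card I" for i
    using x bij_betwE[OF h] that by auto
  show "(CLINT \<omega>|M. iexp (\<Sum>i\<in>I. c i * V \<omega> (x i))) = complex_of_real (exp (- s / 2))"
    unfolding s_def re by (rule gaussian_fieldD(2)[OF V A])
  show "0 \<le> s" "distr M borel (\<lambda>\<omega>. \<Sum>i\<in>I. c i * V \<omega> (x i)) = distr std_normal_distribution borel (\<lambda>z. sqrt s * z)"
    using gaussian_field_linear(2,3)[where c = "\<lambda>i. c (h i)" and x = "\<lambda>i. x (h i)", OF V A] unfolding s_def re by simp_all
qed

lemma continuous_map_linf_eval:
  assumes "x \<in> S"
  shows "continuous_map (linf_topology S) euclideanreal (\<lambda>f. f x)"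
proof -
  interpret Metric_space "linf S" "linf_dist S" by (rule Metric_space_linf) (use assms in auto)
  show ?thesis
    unfolding linf_topology_def
    by (rule lipschitz_imp_continuous_map[where L = 1]) (use linf_dist_upper assms in auto)
qed

locale lipschitz_sample = lipschitz_law P T + \<Omega>: prob_space \<Omega>
  for P :: "(real ^ 'd \<Rightarrow> real) measure" and T :: real and \<Omega> :: "'w measure" +
  fixes \<Lambda> :: "nat \<Rightarrow> 'w \<Rightarrow> real ^ 'd \<Rightarrow> real"
  assumes \<Lambda>_meas [measurable]: "i \<ge> 1 \<Longrightarrow> \<Lambda> i \<in> measurable \<Omega> P"
    and \<Lambda>_distr: "i \<ge> 1 \<Longrightarrow> distr \<Omega> P (\<Lambda> i) = P"
    and \<Lambda>_indep: "\<Omega>.indep_vars (\<lambda>_. P) \<Lambda> {1..}"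
begin

abbreviation "emp \<equiv> empirical_process (cube T) P \<Lambda>"

lemma \<Lambda>_space: "i \<ge> 1 \<Longrightarrow> \<omega> \<in> space \<Omega> \<Longrightarrow> \<Lambda> i \<omega> \<in> space P"
  using measurable_space[OF \<Lambda>_meas] .

lemma \<Lambda>_expectation:
  fixes u :: "(real ^ 'd \<Rightarrow> real) \<Rightarrow> real"
  assumes "i \<ge> 1" "u \<in> borel_measurable P"
  shows "(\<integral>\<omega>. u (\<Lambda> i \<omega>) \<partial>\<Omega>) = (\<integral>f. u f \<partial>P)"
  using integral_distr[OF \<Lambda>_meas[OF assms(1)] assms(2)] \<Lambda>_distr[OF assms(1)] by simp

lemma emp_eq:
  assumes "x \<in> cube T"
  shows "emp n \<omega> x = (\<Sum>i=1..n. \<Lambda> i \<omega> x - mean x) / sqrt (real n)"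
\<comment> \<open>The sequence includes \<open>n = 0\<close>; there both sides are 0 because
  \<open>sqrt 0 = 0\<close> and division by zero gives 0.\<close>
proof (cases "n = 0")
  case False
  have "sqrt (real n) * (a / real n - b) = (a - real n * b) / sqrt (real n)" for a b
  proof -
    define r where "r = sqrt (real n)"
    have r: "real n = r * r" "r \<noteq> 0" using False by (auto simp: r_def)
    have "r * (a / (r * r) - b) = (a - r * r * b) / r"
      using r(2) by (simp add: right_diff_distrib diff_divide_distrib)
    then have "r * (a / real n - b) = (a - real n * b) / r" unfolding r(1) .
    then show ?thesis unfolding r_def .
  qed
  then show ?thesis using assms by (simp add: empirical_process_def mean_def sum_subtractf)
qed (use assms in \<open>simp add: empirical_process_def\<close>)

lemma measurable_emp:
  assumes "x \<in> cube T"
  shows "(\<lambda>\<omega>. emp n \<omega> x) \<in> borel_measurable \<Omega>"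
proof -
  have "(\<lambda>\<omega>. \<Lambda> i \<omega> x) \<in> borel_measurable \<Omega>" if "i \<in> {1..n}" for i
    using that by (intro measurable_compose[OF \<Lambda>_meas eval[OF assms]]) simp
  then show ?thesis
    unfolding emp_eq[OF assms]
    by (intro borel_measurable_divide borel_measurable_sum borel_measurable_diff borel_measurable_const)
qed

lemma emp_regulated:
  assumes \<omega>: "\<omega> \<in> space \<Omega>"
  shows "emp n \<omega> \<in> regulated T"
proof (rule lipschitz_regulated[OF T])
  \<comment> \<open>This Lipschitz constant grows with \<open>n\<close>. It only makes each single
    path regulated; uniformity in \<open>n\<close> comes from the moment bounds.\<close>
  show "0 \<le> real n * 2 / sqrt (real n)" by simp
  show "emp n \<omega> \<in> extensional (cube T)" by (simp add: empirical_process_def)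
  fix x y :: "real ^ 'd" assume xy: "x \<in> cube T" "y \<in> cube T"
  have "emp n \<omega> x - emp n \<omega> y = (\<Sum>i=1..n. (\<Lambda> i \<omega> x - \<Lambda> i \<omega> y) - (mean x - mean y)) / sqrt (real n)"
    unfolding emp_eq[OF xy(1)] emp_eq[OF xy(2)] diff_divide_distrib[symmetric] sum_subtractf[symmetric]
    by (simp add: algebra_simps)
  also have "\<bar>\<dots>\<bar> \<le> (\<Sum>i=1..n. \<bar>(\<Lambda> i \<omega> x - \<Lambda> i \<omega> y) - (mean x - mean y)\<bar>) / sqrt (real n)"
    by (simp add: divide_right_mono sum_abs)
  also have "\<dots> \<le> (\<Sum>i=1..n. 2 * infnorm (x - y)) / sqrt (real n)"
  proof (intro divide_right_mono sum_mono)
    fix i assume "i \<in> {1..n}"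
    then have "\<bar>\<Lambda> i \<omega> x - \<Lambda> i \<omega> y\<bar> \<le> infnorm (x - y)" using \<Lambda>_space[OF _ \<omega>] xy by (intro lip) auto
    then show "\<bar>(\<Lambda> i \<omega> x - \<Lambda> i \<omega> y) - (mean x - mean y)\<bar> \<le> 2 * infnorm (x - y)"
      using mean_lip[OF xy] by linarith
  qed simp
  finally show "\<bar>emp n \<omega> x - emp n \<omega> y\<bar> \<le> real n * 2 / sqrt (real n) * infnorm (x - y)" by simp
qed

text \<open>The differences \<open>\<Lambda> i \<omega> x - \<Lambda> i \<omega> y\<close> are
  independent and bounded by the distance, which is therefore the natural scale
  \<open>\<delta>\<close> in the Hoeffding bound. For \<open>n = 0\<close> the integrand is
  1.\<close>

lemma emp_increment_exp:
  assumes xy: "x \<in> cube T" "y \<in> cube T" and pos: "0 < infnorm (x - y)"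
  shows "(\<integral>\<^sup>+\<omega>. exp ((emp n \<omega> x - emp n \<omega> y) / infnorm (x - y)) \<partial>\<Omega>) \<le> ennreal 2"
proof (cases "n = 0")
  case True
  then show ?thesis
    using ennreal_leI[of 1 2] by (simp add: emp_eq[OF xy(1)] emp_eq[OF xy(2)] \<Omega>.emeasure_space_1)
next
  case False
  let ?X = "\<lambda>i \<omega>. \<Lambda> i \<omega> x - \<Lambda> i \<omega> y" and ?\<delta> = "infnorm (x - y)"
  have u: "(\<lambda>f. f x - f y) \<in> borel_measurable P" using xy by measurable
  have ind: "\<Omega>.indep_vars (\<lambda>_. borel) ?X {1..n}"
    by (rule \<Omega>.indep_vars_subset[OF \<Omega>.indep_vars_compose2[OF \<Lambda>_indep, of "\<lambda>_ f. f x - f y"]]) (use u in auto)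
  have "(\<integral>\<^sup>+\<omega>. exp ((\<Sum>i\<in>{1..n}. ?X i \<omega> - (mean x - mean y)) / sqrt (card {1..n}) / ?\<delta>) \<partial>\<Omega>) \<le> ennreal 2"
  proof (rule \<Omega>.nn_integral_exp_normalized_sum[OF ind _ _ pos])
    show "\<bar>?X i \<omega>\<bar> \<le> ?\<delta>" if "i \<in> {1..n}" "\<omega> \<in> space \<Omega>" for i \<omega>
      using that xy by (intro lip \<Lambda>_space) auto
    show "\<Omega>.expectation (?X i) = mean x - mean y" if "i \<in> {1..n}" for i
      using \<Lambda>_expectation[OF _ u, of i] that integrable_eval xy by (simp add: mean_def)
  qed (use False in auto)
  moreover have "emp n \<omega> x - emp n \<omega> y = (\<Sum>i\<in>{1..n}. ?X i \<omega> - (mean x - mean y)) / sqrt (card {1..n})" for \<omega>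
    unfolding emp_eq[OF xy(1)] emp_eq[OF xy(2)] diff_divide_distrib[symmetric] sum_subtractf[symmetric]
    by (simp add: algebra_simps)
  ultimately show ?thesis by (simp only:)
qed

lemma emp_increment_moments:
  "increment_moments TYPE('d) T (4 * fact (2 * CARD('d))) \<Omega> (\<lambda>\<omega>. sample T (emp n \<omega>))"
  unfolding increment_moments_def
proof (intro ballI)
  fix x y :: "real ^ 'd" assume "x \<in> dyadic T" "y \<in> dyadic T"
  then have xy: "x \<in> cube T" "y \<in> cube T" using dyadic_subset_cube[OF T] by auto
  have sample: "sample T (emp n \<omega>) (dyadic_index T x) - sample T (emp n \<omega>) (dyadic_index T y) = emp n \<omega> x - emp n \<omega> y" for \<omega>
    using \<open>x \<in> dyadic T\<close> \<open>y \<in> dyadic T\<close> by (simp add: sample_def dyadic_point_index T)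
  show "integrable \<Omega> (\<lambda>\<omega>. (sample T (emp n \<omega>) (dyadic_index T x) - sample T (emp n \<omega>) (dyadic_index T y)) ^ (2 * CARD('d))) \<and>
    (\<integral>\<omega>. (sample T (emp n \<omega>) (dyadic_index T x) - sample T (emp n \<omega>) (dyadic_index T y)) ^ (2 * CARD('d)) \<partial>\<Omega>)
      \<le> 4 * fact (2 * CARD('d)) * infnorm (x - y) ^ (2 * CARD('d))"
    unfolding sample
  proof (cases "x = y")
    case False
    then have pos: "0 < infnorm (x - y)" "0 < infnorm (y - x)" by (simp_all add: infnorm_pos_lt)
    note m = \<Omega>.even_moment_le_of_nn_integral_exp[of "\<lambda>\<omega>. emp n \<omega> x - emp n \<omega> y", OF borel_measurable_diff[OF measurable_emp[OF xy(1)] measurable_emp[OF xy(2)]] pos(1) emp_increment_exp[OF xy pos(1)]]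
    \<comment> \<open>The exponential with the opposite sign is the previous bound with
      \<open>x\<close> and \<open>y\<close> exchanged.\<close>
    have "(\<integral>\<^sup>+\<omega>. exp (- (emp n \<omega> x - emp n \<omega> y) / infnorm (x - y)) \<partial>\<Omega>) \<le> ennreal 2"
      using emp_increment_exp[OF xy(2,1) pos(2)] by (simp add: infnorm_sub)
    with m xy show "integrable \<Omega> (\<lambda>\<omega>. (emp n \<omega> x - emp n \<omega> y) ^ (2 * CARD('d))) \<and>
      (\<integral>\<omega>. (emp n \<omega> x - emp n \<omega> y) ^ (2 * CARD('d)) \<partial>\<Omega>) \<le> 4 * fact (2 * CARD('d)) * infnorm (x - y) ^ (2 * CARD('d))"
      by simp
  qed (simp add: infnorm_0 zero_power)
qed

text \<open>The Cramer-Wold device: a linear combination of values of the empirical process is a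
  normalised sum of the independent, bounded, centred variables
  \<open>u (\<Lambda> j \<omega>)\<close>, to which the one-dimensional limit theorem
  applies.\<close>

lemma emp_char_tendsto:
  assumes I: "finite (I :: 'i set)" and x: "\<And>i. i \<in> I \<Longrightarrow> x i \<in> cube T"
  shows "(\<lambda>n. CLINT \<omega>|\<Omega>. iexp (\<Sum>i\<in>I. t i * emp n \<omega> (x i)))
    \<longlonglongrightarrow> complex_of_real (exp (- (\<Sum>i\<in>I. \<Sum>j\<in>I. t i * t j * kern (x i) (x j)) / 2))"
proof -
  define u where "u f = (\<Sum>i\<in>I. t i * (f (x i) - mean (x i)))" for f
  have u[measurable]: "u \<in> borel_measurable P"
    unfolding u_def using x by measurable
  let ?X = "\<lambda>j \<omega>. u (\<Lambda> (Suc j) \<omega>)"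
  have meas: "?X j \<in> borel_measurable \<Omega>" for j
    by (rule measurable_compose[OF \<Lambda>_meas u]) simp
  have "(\<lambda>n. CLINT \<omega>|\<Omega>. iexp ((\<Sum>j<n. ?X j \<omega>) / sqrt (real n)))
    \<longlonglongrightarrow> complex_of_real (exp (- (\<Sum>i\<in>I. \<Sum>j\<in>I. t i * t j * kern (x i) (x j)) / 2))"
  proof (rule \<Omega>.central_limit_char)
    have "\<Omega>.indep_vars (\<lambda>_. P) (\<lambda>j. \<Lambda> (Suc j)) UNIV"
      by (rule \<Omega>.indep_vars_compose_inj[OF \<Lambda>_indep]) auto
    then show "\<Omega>.indep_vars (\<lambda>_. borel) ?X UNIV"
      by (rule \<Omega>.indep_vars_compose2) (rule u)
    show "distr \<Omega> borel (?X n) = distr P borel u" for n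
      using distr_distr[OF u \<Lambda>_meas[of "Suc n"]] \<Lambda>_distr[of "Suc n"] by (simp add: comp_def)
    show "\<bar>?X n \<omega>\<bar> \<le> (\<Sum>i\<in>I. \<bar>t i\<bar> * (2 * T))" if "\<omega> \<in> space \<Omega>" for n \<omega>
    proof -
      have "\<bar>?X n \<omega>\<bar> \<le> (\<Sum>i\<in>I. \<bar>t i * (\<Lambda> (Suc n) \<omega> (x i) - mean (x i))\<bar>)"
        unfolding u_def by (rule sum_abs)
      also have "\<dots> \<le> (\<Sum>i\<in>I. \<bar>t i\<bar> * (2 * T))"
      proof (rule sum_mono)
        fix i assume i: "i \<in> I"
        have "\<bar>\<Lambda> (Suc n) \<omega> (x i)\<bar> \<le> T" by (intro bound \<Lambda>_space x i that) simp
        then have "\<bar>\<Lambda> (Suc n) \<omega> (x i) - mean (x i)\<bar> \<le> 2 * T" using mean_bound[OF x[OF i]] by linarith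
        then show "\<bar>t i * (\<Lambda> (Suc n) \<omega> (x i) - mean (x i))\<bar> \<le> \<bar>t i\<bar> * (2 * T)"
          by (simp add: abs_mult mult_left_mono)
      qed
      finally show ?thesis .
    qed
    have "(\<integral>f. u f \<partial>P) = 0"
      using x integrable_eval by (simp add: u_def mean_def prob_space)
    then show "\<Omega>.expectation (?X n) = 0" for n
      using \<Lambda>_expectation[OF _ u, of "Suc n"] by simp
    show "\<Omega>.expectation (\<lambda>\<omega>. (?X n \<omega>)\<^sup>2) = (\<Sum>i\<in>I. \<Sum>j\<in>I. t i * t j * kern (x i) (x j))" for n
    proof -
      have "\<Omega>.expectation (\<lambda>\<omega>. (?X n \<omega>)\<^sup>2) = (\<integral>f. (u f)\<^sup>2 \<partial>P)"
        by (rule \<Lambda>_expectation) auto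
      then show ?thesis unfolding u_def by (simp only: kern_quadratic[where I = I and x = x and c = t, OF x])
    qed
  qed
  moreover have "(\<Sum>i\<in>I. t i * emp n \<omega> (x i)) = (\<Sum>j<n. ?X j \<omega>) / sqrt (real n)" for n \<omega>
  proof -
    have "(\<Sum>i\<in>I. t i * emp n \<omega> (x i)) = (\<Sum>i\<in>I. \<Sum>j=1..n. t i * (\<Lambda> j \<omega> (x i) - mean (x i))) / sqrt (real n)"
      using x by (simp add: emp_eq sum_divide_distrib sum_distrib_left)
    also have "(\<Sum>i\<in>I. \<Sum>j=1..n. t i * (\<Lambda> j \<omega> (x i) - mean (x i))) = (\<Sum>j=1..n. u (\<Lambda> j \<omega>))"
      unfolding u_def by (rule sum.swap)
    also have "\<dots> = (\<Sum>j<n. ?X j \<omega>)"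
      by (simp add: sum.atLeast1_atMost_eq)
    finally show ?thesis .
  qed
  ultimately show ?thesis by (simp only:)
qed

theorem emp_converges_to_gaussian_process:
  "\<exists>(N :: (real ^ 'd \<Rightarrow> real) measure) G.
    gaussian_process N (cube T) G \<and>
    G \<in> measurable N (borel_of (linf_topology (cube T))) \<and>
    (\<forall>x\<in>cube T. integral\<^sup>L N (\<lambda>\<omega>. G \<omega> x) = 0) \<and>
    (\<forall>x\<in>cube T. \<forall>y\<in>cube T. covariance N (\<lambda>\<omega>. G \<omega> x) (\<lambda>\<omega>. G \<omega> y) = kern x y) \<and>
    weakly_converges (linf_topology (cube T)) \<Omega> emp N G"
proof -
  let ?\<gamma> = "PiM (UNIV :: nat set) (\<lambda>_. std_normal_distribution)"
  let ?Q = "cube T :: (real ^ 'd) set" and ?C = "4 * fact (2 * CARD('d)) :: real"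
  let ?B = "borel_of (linf_topology ?Q)"
  interpret S: real_distribution std_normal_distribution by (rule real_dist_normal_dist)
  interpret \<gamma>: prob_space ?\<gamma> by (intro prob_space_PiM) unfold_locales
  obtain Z where Z: "gaussian_field ?\<gamma> Z ?Q kern" and Zreg: "\<And>\<omega>. Z \<omega> \<in> regulated T"
    and Zmom': "increment_moments TYPE('d) T (fact (2 * CARD('d))) ?\<gamma> (\<lambda>\<omega>. sample T (Z \<omega>))"
    using regulated_gaussian_field[OF T psd_kern kern_sym kern_increment kern_grid_map_tendsto] by blast
  \<comment> \<open>The convergence theorem takes one constant for both processes, so the Gaussian
    bound is relaxed to the empirical one.\<close>
  have Zmom: "increment_moments TYPE('d) T ?C ?\<gamma> (\<lambda>\<omega>. sample T (Z \<omega>))"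
    unfolding increment_moments_def
  proof (intro ballI conjI)
    fix x y :: "real ^ 'd" assume xy: "x \<in> dyadic T" "y \<in> dyadic T"
    note m = Zmom'[unfolded increment_moments_def, rule_format, OF xy]
    show "integrable ?\<gamma> (\<lambda>\<omega>. (sample T (Z \<omega>) (dyadic_index T x) - sample T (Z \<omega>) (dyadic_index T y)) ^ (2 * CARD('d)))"
      using m by blast
    have "0 \<le> infnorm (x - y) ^ (2 * CARD('d))" by (simp add: infnorm_pos_le)
    then have "fact (2 * CARD('d)) * infnorm (x - y) ^ (2 * CARD('d)) \<le> ?C * infnorm (x - y) ^ (2 * CARD('d))"
      by (intro mult_right_mono) auto
    then show "(\<integral>\<omega>. (sample T (Z \<omega>) (dyadic_index T x) - sample T (Z \<omega>) (dyadic_index T y)) ^ (2 * CARD('d)) \<partial>?\<gamma>)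
      \<le> ?C * infnorm (x - y) ^ (2 * CARD('d))"
      using m by linarith
  qed
  have Zev[measurable]: "(\<lambda>\<omega>. Z \<omega> x) \<in> borel_measurable ?\<gamma>" if "x \<in> ?Q" for x
    by (rule gaussian_fieldD(1)[OF Z that])
  have Zmeas[measurable]: "Z \<in> measurable ?\<gamma> ?B"
    by (rule measurable_borel_of_regulated[OF T Zev Zreg])
  have emp_meas: "emp n \<in> measurable \<Omega> ?B" for n
    by (rule measurable_borel_of_regulated[OF T measurable_emp emp_regulated])
  \<comment> \<open>\<open>Z\<close> lives on a space of real sequences. Its law on the function
    space has the type required of \<open>N\<close>, and the identity becomes the process.\<close>
  define N where "N = distr ?\<gamma> ?B Z"
  interpret N: prob_space N unfolding N_def by (rule \<gamma>.prob_space_distr[OF Zmeas])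
  have ev: "(\<lambda>f. f x) \<in> borel_measurable ?B" if "x \<in> ?Q" for x
    by (rule measurable_continuous_borel_of[OF continuous_map_linf_eval[OF that]])
  have evN[measurable]: "(\<lambda>f. f x) \<in> borel_measurable N" if "x \<in> ?Q" for x
    using ev[OF that] by (simp add: N_def)
  have integral_N: "integral\<^sup>L N k = (\<integral>\<omega>. k (Z \<omega>) \<partial>?\<gamma>)" if "k \<in> borel_measurable ?B" for k :: "_ \<Rightarrow> real"
    unfolding N_def by (rule integral_distr[OF Zmeas that])
  have mean_N: "integral\<^sup>L N (\<lambda>f. f x) = 0" if x: "x \<in> ?Q" for x
    using \<gamma>.gaussian_field_linear2(2)[OF Z x x refl, of 1 0] by (simp add: integral_N[OF ev[OF x]])
  have "gaussian_process N ?Q (\<lambda>f. f)"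
    unfolding gaussian_process_def multivariate_normal_def
  proof (intro conjI ballI allI impI N.prob_space_axioms evN; (elim conjE)?)
    fix J :: "(real ^ 'd) set" and c :: "real ^ 'd \<Rightarrow> real" assume J: "finite J" "J \<subseteq> ?Q"
    have res: "(\<lambda>f. restrict f J) \<in> measurable N (PiM J (\<lambda>_. borel))"
      using J(2) by (intro measurable_restrict evN) auto
    have lin: "(\<lambda>x. \<Sum>i\<in>J. c i * x i) \<in> borel_measurable (PiM J (\<lambda>_. borel))" by measurable
    have ZJ: "(\<lambda>f. \<Sum>i\<in>J. c i * f i) \<in> borel_measurable ?B"
      using J(2) ev by (intro borel_measurable_sum borel_measurable_times) auto
    have "distr (distr N (PiM J (\<lambda>_. borel)) (\<lambda>f. restrict f J)) borel (\<lambda>x. \<Sum>i\<in>J. c i * x i)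
      = distr N borel (\<lambda>f. \<Sum>i\<in>J. c i * f i)"
      by (subst distr_distr[OF lin res]) (simp add: comp_def)
    also have "\<dots> = distr ?\<gamma> borel (\<lambda>\<omega>. \<Sum>i\<in>J. c i * Z \<omega> i)"
      unfolding N_def by (subst distr_distr[OF ZJ Zmeas]) (simp add: comp_def)
    also have "\<dots> = distr std_normal_distribution borel (\<lambda>z. sqrt (\<Sum>i\<in>J. \<Sum>j\<in>J. c i * c j * kern i j) * z)"
      using J(2) by (intro \<gamma>.gaussian_field_finite_linear(3)[OF Z J(1), of "\<lambda>i. i"]) auto
    also have "normal_law \<dots>"
      using J(2) \<gamma>.gaussian_field_finite_linear(2)[OF Z J(1), of "\<lambda>i. i" c] by (intro normal_law_scaled_std_normal) auto
    finally show "normal_law (distr (distr N (PiM J (\<lambda>_. borel)) (\<lambda>f. restrict f J)) borel (\<lambda>x. \<Sum>i\<in>J. c i * x i))" .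
  qed (assumption | rule sets_distr)+
  moreover have "(\<lambda>f. f) \<in> measurable N ?B" by (simp add: N_def)
  moreover have "covariance N (\<lambda>f. f x) (\<lambda>f. f y) = kern x y" if xy: "x \<in> ?Q" "y \<in> ?Q" for x y
  proof -
    note lin = \<gamma>.gaussian_field_linear2[OF Z xy kern_sym]
    have int: "integrable ?\<gamma> (\<lambda>\<omega>. (Z \<omega> x + Z \<omega> y)\<^sup>2)" "integrable ?\<gamma> (\<lambda>\<omega>. (Z \<omega> x - Z \<omega> y)\<^sup>2)"
      using lin(1)[of 1 1 2] lin(1)[of 1 "-1" 2] by simp_all
    have "covariance N (\<lambda>f. f x) (\<lambda>f. f y) = integral\<^sup>L N (\<lambda>f. f x * f y)"
      by (simp add: covariance_def mean_N xy)
    also have "\<dots> = (\<integral>\<omega>. Z \<omega> x * Z \<omega> y \<partial>?\<gamma>)"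
      by (intro integral_N borel_measurable_times ev xy)
    \<comment> \<open>Polarisation: only second moments of linear combinations are known, so the
      product is written as a difference of squares.\<close>
    also have "\<dots> = (\<integral>\<omega>. ((Z \<omega> x + Z \<omega> y)\<^sup>2 - (Z \<omega> x - Z \<omega> y)\<^sup>2) / 4 \<partial>?\<gamma>)"
      by (simp add: power2_eq_square algebra_simps)
    also have "\<dots> = kern x y"
      using int lin(3)[of 1 1] lin(3)[of 1 "-1"] by simp
    finally show ?thesis .
  qed
  moreover have "weakly_converges (linf_topology ?Q) \<Omega> emp N (\<lambda>f. f)"
  proof (rule weakly_convergesI_lipschitz[OF cube_nonempty[OF T] \<Omega>.prob_space_axioms N.prob_space_axioms emp_meas])
    show "(\<lambda>f. f) \<in> measurable N ?B" by (simp add: N_def)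
    fix h L B assume h: "lipschitz_linf L ?Q h" "\<And>f. f \<in> linf ?Q \<Longrightarrow> \<bar>h f\<bar> \<le> B"
    have "(\<lambda>n. \<integral>\<omega>. h (emp n \<omega>) \<partial>\<Omega>) \<longlonglongrightarrow> (\<integral>\<omega>. h (Z \<omega>) \<partial>?\<gamma>)"
    proof (rule lipschitz_functional_convergence[OF T _ \<Omega>.prob_space_axioms \<gamma>.prob_space_axioms
          emp_increment_moments measurable_emp emp_regulated Zmom Zev Zreg _ h])
      fix I :: "nat set" and t :: "nat \<Rightarrow> real" assume I: "finite I"
      show "(\<lambda>n. CLINT \<omega>|\<Omega>. iexp (\<Sum>i\<in>I. t i * sample T (emp n \<omega>) i)) \<longlonglongrightarrow> (CLINT \<omega>|?\<gamma>. iexp (\<Sum>i\<in>I. t i * sample T (Z \<omega>) i))"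
        unfolding sample_def
        by (subst \<gamma>.gaussian_field_finite_linear(1)[OF Z I dyadic_point_in_cube[OF T]])
          (rule emp_char_tendsto[OF I dyadic_point_in_cube[OF T]])
    qed simp
    moreover have "integral\<^sup>L N h = (\<integral>\<omega>. h (Z \<omega>) \<partial>?\<gamma>)"
    proof (rule integral_N[OF measurable_continuous_borel_of])
      interpret Metric_space "linf ?Q" "linf_dist ?Q" by (rule Metric_space_linf[OF cube_nonempty[OF T]])
      show "continuous_map (linf_topology ?Q) euclideanreal h"
        unfolding linf_topology_def by (rule lipschitz_imp_continuous_map[OF lipschitz_linfD(2)[OF h(1)]])
    qed
    ultimately show "(\<lambda>n. \<integral>\<omega>. h (emp n \<omega>) \<partial>\<Omega>) \<longlonglongrightarrow> integral\<^sup>L N h" by simp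
  qed
  ultimately show ?thesis using mean_N by blast
qed

end

text \<open>\<open>P\<close> is carried by landscapes, which are bounded by \<open>T\<close> and
  1-Lipschitz on the cube; the sample is thereby an instance of \<open>lipschitz_sample\<close>,
  where the limit has been established.\<close>

theorem theorem3p1:
  fixes K :: "'k ring" and T :: real
    and P :: "(real ^ 'd \<Rightarrow> real) measure"
    and \<Omega> :: "'w measure"
    and \<Lambda> :: "nat \<Rightarrow> 'w \<Rightarrow> real ^ 'd \<Rightarrow> real"
  defines "Q \<equiv> (cube T :: (real ^ 'd) set)"
  defines "\<L> \<equiv> borel_of (subtopology (linf_topology Q) (landscapes TYPE('v) K T))"
  assumes "field K" and "T > 0"
    and "prob_space P" and "sets P = sets \<L>"
    and "prob_space \<Omega>"
    and "\<And>i. i \<ge> 1 \<Longrightarrow> \<Lambda> i \<in> measurable \<Omega> \<L>"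
    and "\<And>i. i \<ge> 1 \<Longrightarrow> distr \<Omega> \<L> (\<Lambda> i) = P"
    and "prob_space.indep_vars \<Omega> (\<lambda>_. \<L>) \<Lambda> {1..}"
  shows "\<exists>(N :: (real ^ 'd \<Rightarrow> real) measure) G.
    gaussian_process N Q G \<and>
    G \<in> measurable N (borel_of (linf_topology Q)) \<and>
    (\<forall>x\<in>Q. integral\<^sup>L N (\<lambda>\<omega>. G \<omega> x) = 0) \<and>
    (\<forall>x\<in>Q. \<forall>y\<in>Q. covariance N (\<lambda>\<omega>. G \<omega> x) (\<lambda>\<omega>. G \<omega> y) =
      integral\<^sup>L P (\<lambda>f. f x * f y) - integral\<^sup>L P (\<lambda>f. f x) * integral\<^sup>L P (\<lambda>f. f y)) \<and>
    weakly_converges (linf_topology Q) \<Omega> (empirical_process Q P \<Lambda>) N G"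
proof -
  interpret P: prob_space P by fact
  interpret \<Omega>: prob_space \<Omega> by fact
  note sets_P = \<open>sets P = sets \<L>\<close>
  have space_P: "space P = linf Q \<inter> landscapes TYPE('v) K T"
    using sets_eq_imp_space_eq[OF sets_P]
    by (simp add: \<L>_def Q_def space_borel_of topspace_linf_topology[OF cube_nonempty[OF \<open>T > 0\<close>]])
  have "lipschitz_sample P T \<Omega> \<Lambda>"
  proof unfold_locales
    show "T > 0" by fact
    show "(\<lambda>f. f x) \<in> borel_measurable P" if "x \<in> cube T" for x
    proof -
      \<comment> \<open>Evaluation is continuous for the supremum metric, hence also on the subspace
        of landscapes.\<close>
      have "(\<lambda>f. f x) \<in> borel_measurable \<L>"
        unfolding \<L>_def Q_def
        by (intro measurable_continuous_borel_of continuous_map_from_subtopology continuous_map_linf_eval that)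
      then show ?thesis using sets_P by (simp cong: measurable_cong_sets)
    qed
    have landscape: "f \<in> landscapes TYPE('v) K T" if "f \<in> space P" for f
      using that by (simp add: space_P)
    show "\<bar>f x\<bar> \<le> T" if "f \<in> space P" "x \<in> cube T" for f x
      using landscapes_bounds[OF landscape[OF that(1)] _ that(2)] \<open>T > 0\<close> by simp
    show "\<bar>f x - f y\<bar> \<le> infnorm (x - y)" if "f \<in> space P" "x \<in> cube T" "y \<in> cube T" for f x y
      using landscapes_lipschitz[OF landscape[OF that(1)] _ that(2,3)] \<open>T > 0\<close> by simp
    \<comment> \<open>\<open>P\<close> and \<open>\<L>\<close> have the same measurable sets, so
      measurability, laws and independence transfer from one to the other.\<close>
    show "\<Lambda> i \<in> measurable \<Omega> P" if "i \<ge> 1" for i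
      using assms(8)[OF that] sets_P by (simp cong: measurable_cong_sets)
    show "distr \<Omega> P (\<Lambda> i) = P" if "i \<ge> 1" for i
      using assms(9)[OF that] sets_P by (simp cong: distr_cong)
    show "\<Omega>.indep_vars (\<lambda>_. P) \<Lambda> {1..}"
      using assms(10) sets_P unfolding \<Omega>.indep_vars_def2 by (simp cong: measurable_cong_sets)
  qed
  then interpret lipschitz_sample P T \<Omega> \<Lambda> .
  show ?thesis
    using emp_converges_to_gaussian_process unfolding kern_def mean_def Q_def .
qed

end
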